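(* Let $A$ be an associative ring with unit, let $(R,i,\chi)$ be an $A$-ring with a right grouplike character, and let $B=A^R$ be its subring of invariants. Consider the following statements. (1) $R$ is finitely generated as a right $A$-module and $A$ is right FBN; (2) $R$ is right FBN and $A$ is right noetherian; (3) $B$ is right FBN and $A$ is right noetherian. Then: (1) implies (2). If $A$ is quasi-projective as a right $R$-module, then (2) implies (3). If $A$ is projective as a right $R$-module and $R$ is an $I$-Frobenius $A$-ring for some strict Morita context $(A,A,I,J,f,g)$, then (3) implies (1), and the three conditions are equivalent.
   Context: All rings are associative with unit. $A$-rings with a right grouplike character: an $A$-ring is a ring $R$ with a ring morphism $i:A\to R$; $R$ is an $A$-bimodule via $arb=i(a)\,r\,i(b)$. A right grouplike character on $R$ is a right $A$-linear map $\chi:R\to A$ with $\chi(\chi(r)s)=\chi(rs)$ for all $r,s\in R$ and $\chi(1_R)=1_A$ (here $\chi(r)s$ means $i(\chi(r))s$). Then $A$ is a right $R$-module via $a\leftharpoonup r=\chi(ar)$, and $B=A^R=\{b\in A\mid b\chi(r)=\chi(br)\text{ for all }r\in R\}$, a subring of $A$. Quasi-projective: a right $R$-module $M$ is quasi-projective if for every $R$-submodule $N\subseteq M$ the canonical map $\mathrm{Hom}_R(M,M)\to \mathrm{Hom}_R(M,M/N)$ is surjective. FBN: a ring $T$ is right bounded if every essential right ideal contains a non-zero two-sided ideal; right fully bounded if $T/P$ is right bounded for every two-sided prime ideal $P$; right FBN if it is right fully bounded and right noetherian. Strict Morita context $(A,A,I,J,f,g)$: $I,J$ are $A$-bimodules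 and $f:I\otimes_AJ\to A$, $g:J\otimes_AI\to A$ are $A$-bimodule isomorphisms with $f(u\otimes v)u'=u\,g(v\otimes u')$ and $g(v\otimes u)v'=v f(u\otimes v')$ for all $u,u'\in I$, $v,v'\in J$. $I$-Frobenius: the $A$-ring $R$ is $I$-Frobenius if there exist an element $e=e^1\otimes u^1\otimes e^2\in R\otimes_AI\otimes_AR$ (summation understood) and an $A$-bimodule map $\bar\nu:R\otimes_AI\to A$ such that for all $r\in R$, $u\in I$: $re^1\otimes u^1\otimes e^2=e^1\otimes u^1\otimes e^2r$; $\bar\nu(e^1\otimes_Au^1)e^2=1_R$; $e^1\otimes_Au^1\bar\nu(e^2\otimes_Au)=1_R\otimes_Au$. *)

theory Defs
  imports "HOL-Algebra.QuotRing" "HOL-Algebra.Free_Abelian_Groups"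
begin

section \<open>Right modules and bimodules over noncommutative rings\<close>

text \<open>The fields \<open>mult\<close> and \<open>one\<close> inherited from the ring record carry
  no meaning for modules.\<close>

record ('r, 'm) rmod = "'m ring" +
  rsmult :: "'m \<Rightarrow> 'r \<Rightarrow> 'm" (infixl \<open>\<triangleleft>\<index>\<close> 70)

record ('r, 'm) bimod = "('r, 'm) rmod" +
  lsmult :: "'r \<Rightarrow> 'm \<Rightarrow> 'm" (infixr \<open>\<triangleright>\<index>\<close> 70)

locale right_module = R?: ring R + M?: abelian_group M
  for R :: "('r, 'x) ring_scheme" (structure) and M :: "('r, 'm, 'y) rmod_scheme" (structure) +
  assumes rsmult_closed [simp, intro]:
      "\<lbrakk>x \<in> carrier M; r \<in> carrier R\<rbrakk> \<Longrightarrow> x \<triangleleft>\<^bsub>M\<^esub> r \<in> carrier M"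
    and rsmult_add_left:
      "\<lbrakk>x \<in> carrier M; y \<in> carrier M; r \<in> carrier R\<rbrakk>
        \<Longrightarrow> (x \<oplus>\<^bsub>M\<^esub> y) \<triangleleft>\<^bsub>M\<^esub> r = x \<triangleleft>\<^bsub>M\<^esub> r \<oplus>\<^bsub>M\<^esub> y \<triangleleft>\<^bsub>M\<^esub> r"
    and rsmult_add_right:
      "\<lbrakk>x \<in> carrier M; r \<in> carrier R; s \<in> carrier R\<rbrakk>
        \<Longrightarrow> x \<triangleleft>\<^bsub>M\<^esub> (r \<oplus>\<^bsub>R\<^esub> s) = x \<triangleleft>\<^bsub>M\<^esub> r \<oplus>\<^bsub>M\<^esub> x \<triangleleft>\<^bsub>M\<^esub> s"
    and rsmult_assoc:
      "\<lbrakk>x \<in> carrier M; r \<in> carrier R; s \<in> carrier R\<rbrakk>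
        \<Longrightarrow> (x \<triangleleft>\<^bsub>M\<^esub> r) \<triangleleft>\<^bsub>M\<^esub> s = x \<triangleleft>\<^bsub>M\<^esub> (r \<otimes>\<^bsub>R\<^esub> s)"
    and rsmult_one [simp]:
      "x \<in> carrier M \<Longrightarrow> x \<triangleleft>\<^bsub>M\<^esub> \<one>\<^bsub>R\<^esub> = x"

locale bimodule = right_module A M
  for A :: "('a, 'x) ring_scheme" (structure) and M :: "('a, 'm, 'y) bimod_scheme" (structure) +
  assumes lsmult_closed [simp, intro]:
      "\<lbrakk>a \<in> carrier A; x \<in> carrier M\<rbrakk> \<Longrightarrow> a \<triangleright>\<^bsub>M\<^esub> x \<in> carrier M"
    and lsmult_add_right:
      "\<lbrakk>a \<in> carrier A; x \<in> carrier M; y \<in> carrier M\<rbrakk>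
        \<Longrightarrow> a \<triangleright>\<^bsub>M\<^esub> (x \<oplus>\<^bsub>M\<^esub> y) = (a \<triangleright>\<^bsub>M\<^esub> x) \<oplus>\<^bsub>M\<^esub> (a \<triangleright>\<^bsub>M\<^esub> y)"
    and lsmult_add_left:
      "\<lbrakk>a \<in> carrier A; b \<in> carrier A; x \<in> carrier M\<rbrakk>
        \<Longrightarrow> (a \<oplus>\<^bsub>A\<^esub> b) \<triangleright>\<^bsub>M\<^esub> x = (a \<triangleright>\<^bsub>M\<^esub> x) \<oplus>\<^bsub>M\<^esub> (b \<triangleright>\<^bsub>M\<^esub> x)"
    and lsmult_assoc:
      "\<lbrakk>a \<in> carrier A; b \<in> carrier A; x \<in> carrier M\<rbrakk>
        \<Longrightarrow> a \<triangleright>\<^bsub>M\<^esub> (b \<triangleright>\<^bsub>M\<^esub> x) = (a \<otimes>\<^bsub>A\<^esub> b) \<triangleright>\<^bsub>M\<^esub> x"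
    and lsmult_one [simp]:
      "x \<in> carrier M \<Longrightarrow> \<one>\<^bsub>A\<^esub> \<triangleright>\<^bsub>M\<^esub> x = x"
    and lsmult_rsmult:
      "\<lbrakk>a \<in> carrier A; x \<in> carrier M; b \<in> carrier A\<rbrakk>
        \<Longrightarrow> (a \<triangleright>\<^bsub>M\<^esub> x) \<triangleleft>\<^bsub>M\<^esub> b = a \<triangleright>\<^bsub>M\<^esub> (x \<triangleleft>\<^bsub>M\<^esub> b)"

definition rmod_hom ::
  "('r, 'x) ring_scheme \<Rightarrow> ('r, 'm, 'y) rmod_scheme \<Rightarrow> ('r, 'n, 'z) rmod_scheme \<Rightarrow> ('m \<Rightarrow> 'n) set"
  where "rmod_hom R M N = {h \<in> carrier M \<rightarrow> carrier N.
    (\<forall>x\<in>carrier M. \<forall>y\<in>carrier M. h (x \<oplus>\<^bsub>M\<^esub> y) = h x \<oplus>\<^bsub>N\<^esub> h y) \<and>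
    (\<forall>x\<in>carrier M. \<forall>r\<in>carrier R. h (x \<triangleleft>\<^bsub>M\<^esub> r) = h x \<triangleleft>\<^bsub>N\<^esub> r)}"

definition bimod_hom ::
  "('r, 'x) ring_scheme \<Rightarrow> ('r, 'm, 'y) bimod_scheme \<Rightarrow> ('r, 'n, 'z) bimod_scheme \<Rightarrow> ('m \<Rightarrow> 'n) set"
  where "bimod_hom A M N = {h \<in> rmod_hom A M N.
    \<forall>a\<in>carrier A. \<forall>x\<in>carrier M. h (a \<triangleright>\<^bsub>M\<^esub> x) = a \<triangleright>\<^bsub>N\<^esub> h x}"

definition bimod_iso ::
  "('r, 'x) ring_scheme \<Rightarrow> ('r, 'm, 'y) bimod_scheme \<Rightarrow> ('r, 'n, 'z) bimod_scheme \<Rightarrow> ('m \<Rightarrow> 'n) set"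
  where "bimod_iso A M N = {h \<in> bimod_hom A M N. bij_betw h (carrier M) (carrier N)}"

definition rsubmodule :: "('r, 'x) ring_scheme \<Rightarrow> ('r, 'm, 'y) rmod_scheme \<Rightarrow> 'm set \<Rightarrow> bool"
  where "rsubmodule R M N \<longleftrightarrow>
    additive_subgroup N M \<and> (\<forall>x\<in>N. \<forall>r\<in>carrier R. x \<triangleleft>\<^bsub>M\<^esub> r \<in> N)"

definition rmod_quot :: "('r, 'm, 'y) rmod_scheme \<Rightarrow> 'm set \<Rightarrow> ('r, 'm set) rmod"
  where "rmod_quot M N =
    \<lparr>carrier = a_rcosets\<^bsub>M\<^esub> N, monoid.mult = undefined, one = undefined, ring.zero = N, add = set_add M,
     rsmult = (\<lambda>C r. \<Union>x\<in>C. N +>\<^bsub>M\<^esub> (x \<triangleleft>\<^bsub>M\<^esub> r))\<rparr>"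

definition rmod_finitely_generated :: "('r, 'x) ring_scheme \<Rightarrow> ('r, 'm, 'y) rmod_scheme \<Rightarrow> bool"
  where "rmod_finitely_generated R M \<longleftrightarrow>
    (\<exists>S. finite S \<and> S \<subseteq> carrier M \<and> carrier M = \<Inter>{N. rsubmodule R M N \<and> S \<subseteq> N})"

definition quasi_projective :: "('r, 'x) ring_scheme \<Rightarrow> ('r, 'm, 'y) rmod_scheme \<Rightarrow> bool"
  where "quasi_projective R M \<longleftrightarrow>
    (\<forall>N. rsubmodule R M N \<longrightarrow>
      (\<forall>g\<in>rmod_hom R M (rmod_quot M N). \<exists>h\<in>rmod_hom R M M.
        \<forall>x\<in>carrier M. g x = N +>\<^bsub>M\<^esub> h x))"

text \<open>HOL cannot quantify over the types of the modules \<open>N\<close> and \<open>L\<close> in the lifting property, so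
  they range over modules on two fixed types. Nothing is lost: the free module on \<open>carrier M\<close> lives
  on \<^typ>\<open>'m \<Rightarrow> 'r\<close>, and lemma \<open>projective_lifting\<close> below gives the lifting property for
  modules over arbitrary types.\<close>

definition projective :: "('r, 'x) ring_scheme \<Rightarrow> ('r, 'm, 'y) rmod_scheme \<Rightarrow> bool"
  where "projective R M \<longleftrightarrow> right_module R M \<and>
    (\<forall>(N :: ('r, 'm \<Rightarrow> 'r) rmod) (L :: ('r, 'm) rmod). right_module R N \<longrightarrow> right_module R L \<longrightarrow>
      (\<forall>p\<in>rmod_hom R N L. p ` carrier N = carrier L \<longrightarrow>
        (\<forall>g\<in>rmod_hom R M L. \<exists>h\<in>rmod_hom R M N. \<forall>x\<in>carrier M. p (h x) = g x)))"


section \<open>Right FBN rings\<close>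

definition right_ideal :: "('r, 'x) ring_scheme \<Rightarrow> 'r set \<Rightarrow> bool"
  where "right_ideal T K \<longleftrightarrow>
    additive_subgroup K T \<and> (\<forall>x\<in>K. \<forall>r\<in>carrier T. x \<otimes>\<^bsub>T\<^esub> r \<in> K)"

definition essential_right_ideal :: "('r, 'x) ring_scheme \<Rightarrow> 'r set \<Rightarrow> bool"
  where "essential_right_ideal T K \<longleftrightarrow> right_ideal T K \<and>
    (\<forall>L. right_ideal T L \<longrightarrow> L \<noteq> {\<zero>\<^bsub>T\<^esub>} \<longrightarrow> K \<inter> L \<noteq> {\<zero>\<^bsub>T\<^esub>})"

definition right_bounded :: "('r, 'x) ring_scheme \<Rightarrow> bool"
  where "right_bounded T \<longleftrightarrow>
    (\<forall>K. essential_right_ideal T K \<longrightarrow> (\<exists>J. ideal J T \<and> J \<noteq> {\<zero>\<^bsub>T\<^esub>} \<and> J \<subseteq> K))"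

text \<open>The library's \<^locale>\<open>primeideal\<close> is restricted to commutative rings. The product of two
  ideals lies in \<open>P\<close> iff all elementwise products do.\<close>

definition two_sided_prime :: "('r, 'x) ring_scheme \<Rightarrow> 'r set \<Rightarrow> bool"
  where "two_sided_prime T P \<longleftrightarrow> ideal P T \<and> P \<noteq> carrier T \<and>
    (\<forall>I J. ideal I T \<longrightarrow> ideal J T \<longrightarrow> (\<forall>x\<in>I. \<forall>y\<in>J. x \<otimes>\<^bsub>T\<^esub> y \<in> P) \<longrightarrow> I \<subseteq> P \<or> J \<subseteq> P)"

definition right_fully_bounded :: "('r, 'x) ring_scheme \<Rightarrow> bool"
  where "right_fully_bounded T \<longleftrightarrow> (\<forall>P. two_sided_prime T P \<longrightarrow> right_bounded (T Quot P))"

definition right_noetherian :: "('r, 'x) ring_scheme \<Rightarrow> bool"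
  where "right_noetherian T \<longleftrightarrow>
    (\<forall>K :: nat \<Rightarrow> 'r set. (\<forall>n. right_ideal T (K n)) \<longrightarrow> (\<forall>n. K n \<subseteq> K (Suc n)) \<longrightarrow>
      (\<exists>m. \<forall>n\<ge>m. K n = K m))"

definition right_FBN :: "('r, 'x) ring_scheme \<Rightarrow> bool"
  where "right_FBN T \<longleftrightarrow> right_fully_bounded T \<and> right_noetherian T"


section \<open>Rings over a base ring and right grouplike characters\<close>

definition ring_bimod :: "('r, 'x) ring_scheme \<Rightarrow> ('a \<Rightarrow> 'r) \<Rightarrow> ('a, 'r) bimod"
  where "ring_bimod R i =
    \<lparr>carrier = carrier R, monoid.mult = monoid.mult R, one = \<one>\<^bsub>R\<^esub>, ring.zero = \<zero>\<^bsub>R\<^esub>, add = add R,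
     rsmult = (\<lambda>r a. r \<otimes>\<^bsub>R\<^esub> i a), lsmult = (\<lambda>a r. i a \<otimes>\<^bsub>R\<^esub> r)\<rparr>"

abbreviation regular_bimod :: "('a, 'x) ring_scheme \<Rightarrow> ('a, 'a) bimod"
  where "regular_bimod A \<equiv> ring_bimod A (\<lambda>a. a)"

definition right_grouplike_character ::
  "('a, 'x) ring_scheme \<Rightarrow> ('r, 'y) ring_scheme \<Rightarrow> ('a \<Rightarrow> 'r) \<Rightarrow> ('r \<Rightarrow> 'a) \<Rightarrow> bool"
  where "right_grouplike_character A R i \<chi> \<longleftrightarrow>
    \<chi> \<in> rmod_hom A (ring_bimod R i) (regular_bimod A) \<and>
    (\<forall>r\<in>carrier R. \<forall>s\<in>carrier R. \<chi> (i (\<chi> r) \<otimes>\<^bsub>R\<^esub> s) = \<chi> (r \<otimes>\<^bsub>R\<^esub> s)) \<and>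
    \<chi> \<one>\<^bsub>R\<^esub> = \<one>\<^bsub>A\<^esub>"

definition char_rmod ::
  "('a, 'x) ring_scheme \<Rightarrow> ('r, 'y) ring_scheme \<Rightarrow> ('a \<Rightarrow> 'r) \<Rightarrow> ('r \<Rightarrow> 'a) \<Rightarrow> ('r, 'a) rmod"
  where "char_rmod A R i \<chi> =
    \<lparr>carrier = carrier A, monoid.mult = monoid.mult A, one = \<one>\<^bsub>A\<^esub>, ring.zero = \<zero>\<^bsub>A\<^esub>, add = add A,
     rsmult = (\<lambda>a r. \<chi> (i a \<otimes>\<^bsub>R\<^esub> r))\<rparr>"

definition char_invariants ::
  "('a, 'x) ring_scheme \<Rightarrow> ('r, 'y) ring_scheme \<Rightarrow> ('a \<Rightarrow> 'r) \<Rightarrow> ('r \<Rightarrow> 'a) \<Rightarrow> 'a set"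
  where "char_invariants A R i \<chi> =
    {b \<in> carrier A. \<forall>r\<in>carrier R. b \<otimes>\<^bsub>A\<^esub> \<chi> r = \<chi> (i b \<otimes>\<^bsub>R\<^esub> r)}"

abbreviation char_invariant_ring ::
  "('a, 'x) ring_scheme \<Rightarrow> ('r, 'y) ring_scheme \<Rightarrow> ('a \<Rightarrow> 'r) \<Rightarrow> ('r \<Rightarrow> 'a) \<Rightarrow> ('a, 'x) ring_scheme"
  where "char_invariant_ring A R i \<chi> \<equiv> A\<lparr>carrier := char_invariants A R i \<chi>\<rparr>"


section \<open>Tensor products of bimodules\<close>

definition tensor_relators ::
  "('a, 'x) ring_scheme \<Rightarrow> ('a, 'm, 'y) bimod_scheme \<Rightarrow> ('a, 'n, 'z) bimod_scheme
    \<Rightarrow> ('m \<times> 'n \<Rightarrow>\<^sub>0 int) set"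
  where "tensor_relators A M N =
    {frag_of (x \<oplus>\<^bsub>M\<^esub> x', y) - frag_of (x, y) - frag_of (x', y) | x x' y.
       x \<in> carrier M \<and> x' \<in> carrier M \<and> y \<in> carrier N} \<union>
    {frag_of (x, y \<oplus>\<^bsub>N\<^esub> y') - frag_of (x, y) - frag_of (x, y') | x y y'.
       x \<in> carrier M \<and> y \<in> carrier N \<and> y' \<in> carrier N} \<union>
    {frag_of (x \<triangleleft>\<^bsub>M\<^esub> a, y) - frag_of (x, a \<triangleright>\<^bsub>N\<^esub> y) | x a y.
       x \<in> carrier M \<and> a \<in> carrier A \<and> y \<in> carrier N}"

abbreviation tensor_free ::
  "('a, 'm, 'y) bimod_scheme \<Rightarrow> ('a, 'n, 'z) bimod_scheme \<Rightarrow> ('m \<times> 'n \<Rightarrow>\<^sub>0 int) monoid"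
  where "tensor_free M N \<equiv> free_Abelian_group (carrier M \<times> carrier N)"

definition tensor_kernel ::
  "('a, 'x) ring_scheme \<Rightarrow> ('a, 'm, 'y) bimod_scheme \<Rightarrow> ('a, 'n, 'z) bimod_scheme
    \<Rightarrow> ('m \<times> 'n \<Rightarrow>\<^sub>0 int) set"
  where "tensor_kernel A M N = generate (tensor_free M N) (tensor_relators A M N)"

definition tensor ::
  "('a, 'x) ring_scheme \<Rightarrow> ('a, 'm, 'y) bimod_scheme \<Rightarrow> ('a, 'n, 'z) bimod_scheme
    \<Rightarrow> ('a, ('m \<times> 'n \<Rightarrow>\<^sub>0 int) set) bimod"
  where "tensor A M N =
    (let F = tensor_free M N; K = tensor_kernel A M N in
     \<lparr>carrier = carrier (F Mod K), monoid.mult = undefined, one = undefined,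
      ring.zero = \<one>\<^bsub>F Mod K\<^esub>, add = monoid.mult (F Mod K),
      rsmult = (\<lambda>C a. \<Union>c\<in>C. K #>\<^bsub>F\<^esub> frag_extend (\<lambda>(x, y). frag_of (x, y \<triangleleft>\<^bsub>N\<^esub> a)) c),
      lsmult = (\<lambda>a C. \<Union>c\<in>C. K #>\<^bsub>F\<^esub> frag_extend (\<lambda>(x, y). frag_of (a \<triangleright>\<^bsub>M\<^esub> x, y)) c)\<rparr>)"

definition pure_tensor ::
  "('a, 'x) ring_scheme \<Rightarrow> ('a, 'm, 'y) bimod_scheme \<Rightarrow> ('a, 'n, 'z) bimod_scheme
    \<Rightarrow> 'm \<Rightarrow> 'n \<Rightarrow> ('m \<times> 'n \<Rightarrow>\<^sub>0 int) set"
  where "pure_tensor A M N x y = tensor_kernel A M N #>\<^bsub>tensor_free M N\<^esub> frag_of (x, y)"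


section \<open>Strict Morita contexts and Frobenius extensions\<close>

definition strict_Morita_context ::
  "('a, 'x) ring_scheme \<Rightarrow> ('a, 'i, 'y) bimod_scheme \<Rightarrow> ('a, 'j, 'z) bimod_scheme
    \<Rightarrow> (('i \<times> 'j \<Rightarrow>\<^sub>0 int) set \<Rightarrow> 'a) \<Rightarrow> (('j \<times> 'i \<Rightarrow>\<^sub>0 int) set \<Rightarrow> 'a) \<Rightarrow> bool"
  where "strict_Morita_context A I J f g \<longleftrightarrow>
    bimodule A I \<and> bimodule A J \<and>
    f \<in> bimod_iso A (tensor A I J) (regular_bimod A) \<and>
    g \<in> bimod_iso A (tensor A J I) (regular_bimod A) \<and>
    (\<forall>u\<in>carrier I. \<forall>v\<in>carrier J. \<forall>u'\<in>carrier I.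
      f (pure_tensor A I J u v) \<triangleright>\<^bsub>I\<^esub> u' = u \<triangleleft>\<^bsub>I\<^esub> g (pure_tensor A J I v u')) \<and>
    (\<forall>v\<in>carrier J. \<forall>u\<in>carrier I. \<forall>v'\<in>carrier J.
      g (pure_tensor A J I v u) \<triangleright>\<^bsub>J\<^esub> v' = v \<triangleleft>\<^bsub>J\<^esub> f (pure_tensor A I J u v'))"

text \<open>The tensor \<open>e\<close> is given by a representation
  \<open>(p 0 \<otimes> u 0) \<otimes> q 0 + \<dots> + (p (n - 1) \<otimes> u (n - 1)) \<otimes> q (n - 1)\<close> in \<open>(R \<otimes> I) \<otimes> R\<close>. None of
  the three conditions depends on the choice of the representation.\<close>

definition Frobenius_extension ::
  "('a, 'x) ring_scheme \<Rightarrow> ('r, 'y) ring_scheme \<Rightarrow> ('a \<Rightarrow> 'r) \<Rightarrow> ('a, 'i, 'z) bimod_scheme \<Rightarrow> bool"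
  where "Frobenius_extension A R i I \<longleftrightarrow>
    (let R' = ring_bimod R i; RI = tensor A R' I; RIR = tensor A RI R';
         t2 = pure_tensor A R' I; t3 = (\<lambda>r u s. pure_tensor A RI R' (t2 r u) s) in
     \<exists>(n :: nat) p u q. \<exists>\<nu>\<in>bimod_hom A RI (regular_bimod A).
       (\<forall>k<n. p k \<in> carrier R \<and> u k \<in> carrier I \<and> q k \<in> carrier R) \<and>
       (\<forall>r\<in>carrier R.
         (\<Oplus>\<^bsub>RIR\<^esub>k\<in>{..<n}. t3 (r \<otimes>\<^bsub>R\<^esub> p k) (u k) (q k)) =
         (\<Oplus>\<^bsub>RIR\<^esub>k\<in>{..<n}. t3 (p k) (u k) (q k \<otimes>\<^bsub>R\<^esub> r))) \<and>
       (\<Oplus>\<^bsub>R\<^esub>k\<in>{..<n}. i (\<nu> (t2 (p k) (u k))) \<otimes>\<^bsub>R\<^esub> q k) = \<one>\<^bsub>R\<^esub> \<and>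
       (\<forall>v\<in>carrier I.
         (\<Oplus>\<^bsub>RI\<^esub>k\<in>{..<n}. t2 (p k) (u k \<triangleleft>\<^bsub>I\<^esub> \<nu> (t2 (q k) v))) = t2 \<one>\<^bsub>R\<^esub> v))"


section \<open>The lifting property over arbitrary types\<close>

lemma rmod_hom_zero:
  assumes "right_module R M" "right_module R N" "h \<in> rmod_hom R M N"
  shows "h \<zero>\<^bsub>M\<^esub> = \<zero>\<^bsub>N\<^esub>"
proof -
  interpret M: right_module R M by fact
  interpret N: right_module R N by fact
  have z: "h \<zero>\<^bsub>M\<^esub> \<in> carrier N" using assms(3) by (auto simp: rmod_hom_def)
  have "h (\<zero>\<^bsub>M\<^esub> \<oplus>\<^bsub>M\<^esub> \<zero>\<^bsub>M\<^esub>) = h \<zero>\<^bsub>M\<^esub> \<oplus>\<^bsub>N\<^esub> h \<zero>\<^bsub>M\<^esub>"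
    using assms(3) unfolding rmod_hom_def by blast
  then show ?thesis using z N.add.r_cancel_one' by simp
qed

lemma rmod_hom_comp:
  assumes "f \<in> rmod_hom R L M" "g \<in> rmod_hom R M N"
  shows "(\<lambda>x. g (f x)) \<in> rmod_hom R L N"
proof -
  have f: "f x \<in> carrier M" if "x \<in> carrier L" for x
    using assms(1) that unfolding rmod_hom_def by blast
  show ?thesis
    unfolding rmod_hom_def
  proof (intro CollectI conjI funcsetI ballI)
    fix x assume x: "x \<in> carrier L"
    show "g (f x) \<in> carrier N" using assms(2) f[OF x] unfolding rmod_hom_def by blast
    show "g (f (x \<oplus>\<^bsub>L\<^esub> y)) = g (f x) \<oplus>\<^bsub>N\<^esub> g (f y)" if "y \<in> carrier L" for y
      using assms f[OF x] f[OF that] x that by (simp add: rmod_hom_def)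
    show "g (f (x \<triangleleft>\<^bsub>L\<^esub> r)) = g (f x) \<triangleleft>\<^bsub>N\<^esub> r" if "r \<in> carrier R" for r
      using assms f[OF x] x that by (simp add: rmod_hom_def)
  qed
qed

lemma rmod_hom_finsum:
  assumes "right_module R M" "right_module R N" "h \<in> rmod_hom R M N" "finite S" "c \<in> S \<rightarrow> carrier M"
  shows "h (finsum M c S) = finsum N (\<lambda>x. h (c x)) S"
  using assms(4,5)
proof (induction S rule: finite_induct)
  case empty
  interpret M: right_module R M by fact
  interpret N: right_module R N by fact
  show ?case using rmod_hom_zero[OF assms(1-3)] by simp
next
  case (insert x S)
  interpret M: right_module R M by fact
  interpret N: right_module R N by fact
  have "finsum M c S \<in> carrier M" "c x \<in> carrier M" using insert.prems by auto
  moreover have "(\<lambda>x. h (c x)) \<in> S \<rightarrow> carrier N" "h (c x) \<in> carrier N"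
    using insert.prems assms(3) by (auto simp: rmod_hom_def)
  ultimately show ?case using insert assms(3) by (auto simp: rmod_hom_def)
qed

lemma (in right_module) rsmult_hom: "r \<in> carrier R \<Longrightarrow> (\<lambda>x. x \<triangleleft>\<^bsub>M\<^esub> r) \<in> hom (add_monoid M) (add_monoid M)"
  by (auto simp: hom_def rsmult_add_left)

lemma (in right_module) rsmult_zero_left [simp]:
  assumes "r \<in> carrier R" shows "\<zero>\<^bsub>M\<^esub> \<triangleleft>\<^bsub>M\<^esub> r = \<zero>\<^bsub>M\<^esub>"
  using rsmult_add_left[of "\<zero>\<^bsub>M\<^esub>" "\<zero>\<^bsub>M\<^esub>" r] assms M.add.r_cancel_one' by simp

lemma (in right_module) rsmult_zero_right [simp]:
  assumes "x \<in> carrier M" shows "x \<triangleleft>\<^bsub>M\<^esub> \<zero>\<^bsub>R\<^esub> = \<zero>\<^bsub>M\<^esub>"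
  using rsmult_add_right[of x "\<zero>\<^bsub>R\<^esub>" "\<zero>\<^bsub>R\<^esub>"] assms M.add.r_cancel_one' by simp

lemma (in right_module) rsmult_finsum:
  assumes "finite S" "c \<in> S \<rightarrow> carrier M" "r \<in> carrier R"
  shows "finsum M c S \<triangleleft>\<^bsub>M\<^esub> r = finsum M (\<lambda>x. c x \<triangleleft>\<^bsub>M\<^esub> r) S"
  using assms(1,2)
proof (induction S rule: finite_induct)
  case empty then show ?case using assms(3) by simp
next
  case (insert x S)
  have "finsum M c S \<in> carrier M" "c x \<in> carrier M" using insert.prems by auto
  moreover have "(\<lambda>x. c x \<triangleleft>\<^bsub>M\<^esub> r) \<in> S \<rightarrow> carrier M" using insert.prems assms(3) by auto
  ultimately show ?case using insert assms(3) by (auto simp: rsmult_add_left)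
qed

definition free_rmod :: "('r, 'x) ring_scheme \<Rightarrow> 'b set \<Rightarrow> ('r, 'b \<Rightarrow> 'r) rmod"
  where "free_rmod R X =
    \<lparr>carrier = {c. finite {x. c x \<noteq> \<zero>\<^bsub>R\<^esub>} \<and> (\<forall>x. c x \<in> carrier R) \<and> (\<forall>x. x \<notin> X \<longrightarrow> c x = \<zero>\<^bsub>R\<^esub>)},
     monoid.mult = undefined, one = undefined, ring.zero = (\<lambda>_. \<zero>\<^bsub>R\<^esub>),
     add = (\<lambda>c d x. c x \<oplus>\<^bsub>R\<^esub> d x), rsmult = (\<lambda>c r x. c x \<otimes>\<^bsub>R\<^esub> r)\<rparr>"

lemma free_rmod_right_module:
  assumes "ring R"
  shows "right_module R (free_rmod R X)"
proof -
  interpret R: ring R by fact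
  have "abelian_group (free_rmod R X)"
  proof (rule abelian_groupI)
    fix c d assume c: "c \<in> carrier (free_rmod R X)" and d: "d \<in> carrier (free_rmod R X)"
    then have "finite ({x. c x \<noteq> \<zero>\<^bsub>R\<^esub>} \<union> {x. d x \<noteq> \<zero>\<^bsub>R\<^esub>})" by (simp add: free_rmod_def)
    then have "finite {x. c x \<oplus>\<^bsub>R\<^esub> d x \<noteq> \<zero>\<^bsub>R\<^esub>}" by (rule rev_finite_subset) auto
    then show "c \<oplus>\<^bsub>free_rmod R X\<^esub> d \<in> carrier (free_rmod R X)"
      using c d by (simp add: free_rmod_def)
    show "c \<oplus>\<^bsub>free_rmod R X\<^esub> d = d \<oplus>\<^bsub>free_rmod R X\<^esub> c"
      using c d by (simp add: free_rmod_def R.a_comm)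
  next
    fix c assume c: "c \<in> carrier (free_rmod R X)"
    then have "finite {x. c x \<noteq> \<zero>\<^bsub>R\<^esub>}" by (simp add: free_rmod_def)
    then have "finite {x. \<ominus>\<^bsub>R\<^esub> c x \<noteq> \<zero>\<^bsub>R\<^esub>}" by (rule rev_finite_subset) auto
    then show "\<exists>d\<in>carrier (free_rmod R X). d \<oplus>\<^bsub>free_rmod R X\<^esub> c = \<zero>\<^bsub>free_rmod R X\<^esub>"
      using c by (intro bexI[of _ "\<lambda>x. \<ominus>\<^bsub>R\<^esub> c x"]) (auto simp: free_rmod_def R.l_neg)
  qed (auto simp: free_rmod_def R.a_assoc)
  then show ?thesis
  proof (intro right_module.intro right_module_axioms.intro assms)
    fix c r assume c: "c \<in> carrier (free_rmod R X)" and r: "r \<in> carrier R"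
    then have "finite {x. c x \<noteq> \<zero>\<^bsub>R\<^esub>}" by (simp add: free_rmod_def)
    then have "finite {x. c x \<otimes>\<^bsub>R\<^esub> r \<noteq> \<zero>\<^bsub>R\<^esub>}" by (rule rev_finite_subset) (use r in auto)
    then show "c \<triangleleft>\<^bsub>free_rmod R X\<^esub> r \<in> carrier (free_rmod R X)"
      using c r by (simp add: free_rmod_def)
  qed (auto simp: free_rmod_def R.l_distr R.r_distr R.m_assoc)
qed

definition free_rmod_eval :: "('r, 'x) ring_scheme \<Rightarrow> ('r, 'm, 'y) rmod_scheme \<Rightarrow> ('b \<Rightarrow> 'm) \<Rightarrow> ('b \<Rightarrow> 'r) \<Rightarrow> 'm"
  where "free_rmod_eval R M n c = (\<Oplus>\<^bsub>M\<^esub>x\<in>{x. c x \<noteq> \<zero>\<^bsub>R\<^esub>}. n x \<triangleleft>\<^bsub>M\<^esub> c x)"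

lemma (in right_module) free_rmod_eval_superset:
  assumes "c \<in> carrier (free_rmod R X)" "n \<in> X \<rightarrow> carrier M"
    and "finite S" "S \<subseteq> X" "{x. c x \<noteq> \<zero>\<^bsub>R\<^esub>} \<subseteq> S"
  shows "free_rmod_eval R M n c = (\<Oplus>\<^bsub>M\<^esub>x\<in>S. n x \<triangleleft>\<^bsub>M\<^esub> c x)"
  unfolding free_rmod_eval_def
proof (rule M.add.finprod_mono_neutral_cong_left)
  show "(\<lambda>x. n x \<triangleleft>\<^bsub>M\<^esub> c x) \<in> S \<rightarrow> carrier M"
    using assms(1,2,4) by (intro funcsetI rsmult_closed) (auto simp: free_rmod_def)
  show "\<And>i. i \<in> S - {x. c x \<noteq> \<zero>\<^bsub>R\<^esub>} \<Longrightarrow> n i \<triangleleft>\<^bsub>M\<^esub> c i = \<zero>\<^bsub>M\<^esub>"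
    using assms(2,4) by (simp add: Pi_iff subset_iff)
qed (use assms in auto)

lemma (in right_module) free_rmod_eval_hom:
  assumes n: "n \<in> X \<rightarrow> carrier M"
  shows "free_rmod_eval R M n \<in> rmod_hom R (free_rmod R X) M"
proof -
  let ?F = "free_rmod R X" and ?e = "free_rmod_eval R M n"
  interpret F: right_module R ?F by (rule free_rmod_right_module) unfold_locales
  have supp: "finite {x. c x \<noteq> \<zero>\<^bsub>R\<^esub>}" "{x. c x \<noteq> \<zero>\<^bsub>R\<^esub>} \<subseteq> X" "\<And>x. c x \<in> carrier R"
    if "c \<in> carrier ?F" for c
    using that by (auto simp: free_rmod_def)
  have "?e c \<in> carrier M" if c: "c \<in> carrier ?F" for c
    unfolding free_rmod_eval_def using supp[OF c] n by (auto intro!: M.finsum_closed)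
  moreover have "?e (c \<oplus>\<^bsub>?F\<^esub> d) = ?e c \<oplus>\<^bsub>M\<^esub> ?e d"
    if c: "c \<in> carrier ?F" and d: "d \<in> carrier ?F" for c d
  proof -
    let ?S = "{x. c x \<noteq> \<zero>\<^bsub>R\<^esub>} \<union> {x. d x \<noteq> \<zero>\<^bsub>R\<^esub>}"
    have S: "finite ?S" "?S \<subseteq> X" using supp[OF c] supp[OF d] by auto
    have cd: "c \<oplus>\<^bsub>?F\<^esub> d \<in> carrier ?F" using c d by (rule F.M.add.m_closed)
    have "?e (c \<oplus>\<^bsub>?F\<^esub> d) = (\<Oplus>\<^bsub>M\<^esub>x\<in>?S. n x \<triangleleft>\<^bsub>M\<^esub> (c \<oplus>\<^bsub>?F\<^esub> d) x)"
      using S by (intro free_rmod_eval_superset[OF cd n]) (auto simp: free_rmod_def)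
    also have "\<dots> = (\<Oplus>\<^bsub>M\<^esub>x\<in>?S. n x \<triangleleft>\<^bsub>M\<^esub> c x \<oplus>\<^bsub>M\<^esub> n x \<triangleleft>\<^bsub>M\<^esub> d x)"
    proof (rule M.finsum_cong')
      show "(\<lambda>x. n x \<triangleleft>\<^bsub>M\<^esub> c x \<oplus>\<^bsub>M\<^esub> n x \<triangleleft>\<^bsub>M\<^esub> d x) \<in> ?S \<rightarrow> carrier M"
        using supp[OF c] supp[OF d] n by blast
      show "n x \<triangleleft>\<^bsub>M\<^esub> (c \<oplus>\<^bsub>?F\<^esub> d) x = n x \<triangleleft>\<^bsub>M\<^esub> c x \<oplus>\<^bsub>M\<^esub> n x \<triangleleft>\<^bsub>M\<^esub> d x" if "x \<in> ?S" for x
      proof -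
        have "n x \<in> carrier M" using that S n by blast
        then show ?thesis using supp[OF c] supp[OF d] by (simp add: free_rmod_def rsmult_add_right)
      qed
    qed simp
    also have "\<dots> = (\<Oplus>\<^bsub>M\<^esub>x\<in>?S. n x \<triangleleft>\<^bsub>M\<^esub> c x) \<oplus>\<^bsub>M\<^esub> (\<Oplus>\<^bsub>M\<^esub>x\<in>?S. n x \<triangleleft>\<^bsub>M\<^esub> d x)"
      using supp[OF c] supp[OF d] n by (intro M.finsum_addf) blast+
    also have "\<dots> = ?e c \<oplus>\<^bsub>M\<^esub> ?e d"
      using free_rmod_eval_superset[OF c n S] free_rmod_eval_superset[OF d n S] by auto
    finally show ?thesis .
  qed
  moreover have "?e (c \<triangleleft>\<^bsub>?F\<^esub> r) = ?e c \<triangleleft>\<^bsub>M\<^esub> r" if c: "c \<in> carrier ?F" and r: "r \<in> carrier R" for c r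
  proof -
    let ?S = "{x. c x \<noteq> \<zero>\<^bsub>R\<^esub>}"
    have mem: "n x \<triangleleft>\<^bsub>M\<^esub> c x \<in> carrier M" "n x \<in> carrier M" if "x \<in> ?S" for x
      using that supp[OF c] n by auto
    have "?e (c \<triangleleft>\<^bsub>?F\<^esub> r) = (\<Oplus>\<^bsub>M\<^esub>x\<in>?S. n x \<triangleleft>\<^bsub>M\<^esub> (c \<triangleleft>\<^bsub>?F\<^esub> r) x)"
      using supp[OF c] n c r F.rsmult_closed[OF c r]
      by (intro free_rmod_eval_superset) (auto simp: free_rmod_def)
    also have "\<dots> = (\<Oplus>\<^bsub>M\<^esub>x\<in>?S. (n x \<triangleleft>\<^bsub>M\<^esub> c x) \<triangleleft>\<^bsub>M\<^esub> r)"
      using mem r supp[OF c] by (intro M.finsum_cong') (auto simp: free_rmod_def rsmult_assoc)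
    also have "\<dots> = ?e c \<triangleleft>\<^bsub>M\<^esub> r"
      unfolding free_rmod_eval_def using supp[OF c] mem r by (intro rsmult_finsum[symmetric]) auto
    finally show ?thesis .
  qed
  ultimately show ?thesis unfolding rmod_hom_def by blast
qed

lemma (in right_module) free_rmod_eval_single:
  assumes "n \<in> X \<rightarrow> carrier M" "x \<in> X"
  shows "(\<lambda>y. if y = x then \<one>\<^bsub>R\<^esub> else \<zero>\<^bsub>R\<^esub>) \<in> carrier (free_rmod R X)" (is "?c \<in> _")
    and "free_rmod_eval R M n (\<lambda>y. if y = x then \<one>\<^bsub>R\<^esub> else \<zero>\<^bsub>R\<^esub>) = n x"
proof -
  have "finite {y. ?c y \<noteq> \<zero>\<^bsub>R\<^esub>}" by (rule finite_subset[of _ "{x}"]) auto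
  then show c: "?c \<in> carrier (free_rmod R X)" using assms(2) by (auto simp: free_rmod_def)
  have "free_rmod_eval R M n ?c = (\<Oplus>\<^bsub>M\<^esub>y\<in>{x}. n y \<triangleleft>\<^bsub>M\<^esub> ?c y)"
    using assms c by (intro free_rmod_eval_superset) auto
  moreover have "n x \<in> carrier M" using assms by auto
  ultimately show "free_rmod_eval R M n ?c = n x" by simp
qed

lemma projective_lifting:
  fixes M :: "('r, 'm, 'y) rmod_scheme" and N :: "('r, 'n, 'z) rmod_scheme"
    and L :: "('r, 'l, 'w) rmod_scheme"
  assumes "projective R M" "right_module R N" "right_module R L"
    and p: "p \<in> rmod_hom R N L" "p ` carrier N = carrier L" and g: "g \<in> rmod_hom R M L"
  shows "\<exists>h\<in>rmod_hom R M N. \<forall>x\<in>carrier M. p (h x) = g x"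
proof -
  define M' where "M' = rmod.truncate M"
  have eqs: "carrier M' = carrier M" "add M' = add M" "\<zero>\<^bsub>M'\<^esub> = \<zero>\<^bsub>M\<^esub>" "rsmult M' = rsmult M"
    by (simp_all add: M'_def rmod.truncate_def)
  have M: "right_module R M" using assms(1) by (simp add: projective_def)
  interpret M: right_module R M by fact
  interpret N: right_module R N by fact
  interpret L: right_module R L by fact
  have M': "right_module R M'"
  proof (intro right_module.intro right_module_axioms.intro M.R.ring_axioms)
    show "abelian_group M'"
    proof (rule abelian_groupI)
      fix x assume "x \<in> carrier M'"
      then show "\<exists>y\<in>carrier M'. y \<oplus>\<^bsub>M'\<^esub> x = \<zero>\<^bsub>M'\<^esub>"
        by (intro bexI[of _ "\<ominus>\<^bsub>M\<^esub> x"]) (auto simp: eqs M.M.l_neg)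
    qed (auto simp: eqs M.M.a_ac)
  qed (auto simp: eqs M.rsmult_add_left M.rsmult_add_right M.rsmult_assoc)
  interpret M': right_module R M' by fact
  let ?X = "carrier M"
  let ?F = "free_rmod R ?X"
  have F: "right_module R ?F" by (rule free_rmod_right_module) (rule M.R.ring_axioms)
  let ?e = "free_rmod_eval R M' (\<lambda>x. x)"
  have e: "?e \<in> rmod_hom R ?F M'" by (rule M'.free_rmod_eval_hom) (simp add: eqs)
  have "x \<in> ?e ` carrier ?F" if "x \<in> carrier M'" for x
  proof (rule image_eqI)
    have x: "x \<in> ?X" and id: "(\<lambda>x. x) \<in> ?X \<rightarrow> carrier M'" using that by (simp_all add: eqs)
    show "x = ?e (\<lambda>y. if y = x then \<one>\<^bsub>R\<^esub> else \<zero>\<^bsub>R\<^esub>)"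
      by (rule M'.free_rmod_eval_single(2)[OF id x, symmetric])
    show "(\<lambda>y. if y = x then \<one>\<^bsub>R\<^esub> else \<zero>\<^bsub>R\<^esub>) \<in> carrier ?F"
      by (rule M'.free_rmod_eval_single(1)[OF id x])
  qed
  moreover have "?e c \<in> carrier M'" if "c \<in> carrier ?F" for c
    using e that by (simp add: rmod_hom_def Pi_iff)
  ultimately have surj: "?e ` carrier ?F = carrier M'" by blast
  have id: "(\<lambda>x. x) \<in> rmod_hom R M M'" by (simp add: rmod_hom_def eqs)
  obtain s where s: "s \<in> rmod_hom R M ?F" "\<And>x. x \<in> ?X \<Longrightarrow> ?e (s x) = x"
    using assms(1)[unfolded projective_def, THEN conjunct2, rule_format, OF F M' e surj id] by blast
  have gL: "g x \<in> carrier L" if "x \<in> ?X" for x using that g by (auto simp: rmod_hom_def)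
  define n where "n x = (SOME y. y \<in> carrier N \<and> p y = g x)" for x
  have n: "n x \<in> carrier N \<and> p (n x) = g x" if "x \<in> ?X" for x
  proof -
    have "g x \<in> p ` carrier N" unfolding p(2) by (rule gL[OF that])
    then have "\<exists>y. y \<in> carrier N \<and> p y = g x" by (metis imageE)
    then show ?thesis unfolding n_def by (rule someI_ex)
  qed
  let ?k = "free_rmod_eval R N n"
  have k: "?k \<in> rmod_hom R ?F N" using n by (intro N.free_rmod_eval_hom) auto
  have pk: "p (?k c) = g (?e c)" if c: "c \<in> carrier ?F" for c
  proof -
    have supp: "finite {x. c x \<noteq> \<zero>\<^bsub>R\<^esub>}" "{x. c x \<noteq> \<zero>\<^bsub>R\<^esub>} \<subseteq> ?X" "\<And>x. c x \<in> carrier R"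
      using c by (auto simp: free_rmod_def)
    have g': "g \<in> rmod_hom R M' L" using g by (simp add: rmod_hom_def eqs)
    have "p (?k c) = (\<Oplus>\<^bsub>L\<^esub>x\<in>{x. c x \<noteq> \<zero>\<^bsub>R\<^esub>}. p (n x \<triangleleft>\<^bsub>N\<^esub> c x))"
      unfolding free_rmod_eval_def using supp n
      by (intro rmod_hom_finsum[OF assms(2,3) p(1)]) auto
    also have "\<dots> = (\<Oplus>\<^bsub>L\<^esub>x\<in>{x. c x \<noteq> \<zero>\<^bsub>R\<^esub>}. g (x \<triangleleft>\<^bsub>M'\<^esub> c x))"
    proof (rule L.M.finsum_cong')
      show "(\<lambda>x. g (x \<triangleleft>\<^bsub>M'\<^esub> c x)) \<in> {x. c x \<noteq> \<zero>\<^bsub>R\<^esub>} \<rightarrow> carrier L"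
        using supp by (auto simp: eqs intro!: gL)
      show "p (n x \<triangleleft>\<^bsub>N\<^esub> c x) = g (x \<triangleleft>\<^bsub>M'\<^esub> c x)" if "x \<in> {x. c x \<noteq> \<zero>\<^bsub>R\<^esub>}" for x
      proof -
        have "x \<in> ?X" using that supp by blast
        then show ?thesis using n[of x] p(1) g supp(3)[of x] by (simp add: rmod_hom_def eqs)
      qed
    qed simp
    also have "\<dots> = g (?e c)"
      unfolding free_rmod_eval_def using supp
      by (intro rmod_hom_finsum[OF M' assms(3) g', symmetric]) (auto simp: eqs)
    finally show ?thesis .
  qed
  have "(\<lambda>x. ?k (s x)) \<in> rmod_hom R M N" by (rule rmod_hom_comp[OF s(1) k])
  moreover have "p (?k (s x)) = g x" if "x \<in> ?X" for x
  proof -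
    have "s x \<in> carrier ?F" using s(1) that by (simp add: rmod_hom_def Pi_iff)
    then have "p (?k (s x)) = g (?e (s x))" by (rule pk)
    then show ?thesis by (simp only: s(2)[OF that])
  qed
  ultimately show ?thesis by (intro bexI[of _ "\<lambda>x. ?k (s x)"] ballI)
qed


section \<open>The module structures are well defined\<close>

lemma tensor_free_diff:
  assumes "c \<in> carrier (free_Abelian_group S)" "d \<in> carrier (free_Abelian_group S)"
  shows "c - d \<in> carrier (free_Abelian_group S)"
proof -
  have "Poly_Mapping.keys c \<subseteq> S" "Poly_Mapping.keys d \<subseteq> S" using assms by simp_all
  then have "Poly_Mapping.keys (c - d) \<subseteq> S" using keys_diff[of c d] by blast
  then show ?thesis by simp
qed

lemma tensor_free_add:
  assumes "c \<in> carrier (free_Abelian_group S)" "d \<in> carrier (free_Abelian_group S)"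
  shows "c + d \<in> carrier (free_Abelian_group S)"
proof -
  have "Poly_Mapping.keys c \<subseteq> S" "Poly_Mapping.keys d \<subseteq> S" using assms by simp_all
  then have "Poly_Mapping.keys (c + d) \<subseteq> S" using keys_add[of c d] by blast
  then show ?thesis by simp
qed

lemma tensor_free_frag_extend:
  assumes "c \<in> carrier (free_Abelian_group S)" "\<And>z. z \<in> S \<Longrightarrow> \<phi> z \<in> S"
  shows "frag_extend (\<lambda>z. frag_of (\<phi> z)) c \<in> carrier (free_Abelian_group S)"
proof -
  have "Poly_Mapping.keys c \<subseteq> S" using assms(1) by simp
  moreover have "Poly_Mapping.keys (frag_extend (\<lambda>z. frag_of (\<phi> z)) c)
      \<subseteq> (\<Union>z\<in>Poly_Mapping.keys c. Poly_Mapping.keys (frag_of (\<phi> z)))"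
    by (rule keys_frag_extend)
  ultimately have "Poly_Mapping.keys (frag_extend (\<lambda>z. frag_of (\<phi> z)) c) \<subseteq> S"
    using assms(2) unfolding keys_frag_of by blast
  then show ?thesis by simp
qed

locale tensor_bimodules = M: bimodule A M + N: bimodule A N
  for A :: "('a, 'x) ring_scheme" (structure) and M :: "('a, 'm, 'y) bimod_scheme" (structure)
    and N :: "('a, 'n, 'z) bimod_scheme" (structure)
begin

abbreviation "F \<equiv> tensor_free M N"
abbreviation "K \<equiv> tensor_kernel A M N"
abbreviation "T \<equiv> tensor A M N"
abbreviation "ract a \<equiv> frag_extend (\<lambda>(x, y). frag_of (x, y \<triangleleft>\<^bsub>N\<^esub> a))"
abbreviation "lact a \<equiv> frag_extend (\<lambda>(x, y). frag_of (a \<triangleright>\<^bsub>M\<^esub> x, y))"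

sublocale F: comm_group F by (rule abelian_free_Abelian_group)

lemma frag_of_closed: "\<lbrakk>x \<in> carrier M; y \<in> carrier N\<rbrakk> \<Longrightarrow> frag_of (x, y) \<in> carrier F"
  by simp

lemma relators_carrier: "tensor_relators A M N \<subseteq> carrier F"
proof
  fix d assume "d \<in> tensor_relators A M N"
  then show "d \<in> carrier F"
    unfolding tensor_relators_def
  proof (elim UnE CollectE exE conjE)
    fix x x' y
    assume d: "d = frag_of (x \<oplus>\<^bsub>M\<^esub> x', y) - frag_of (x, y) - frag_of (x', y)"
      and "x \<in> carrier M" "x' \<in> carrier M" "y \<in> carrier N"
    then show ?thesis
      unfolding d by (intro tensor_free_diff frag_of_closed) simp_all
  next
    fix x y y'
    assume d: "d = frag_of (x, y \<oplus>\<^bsub>N\<^esub> y') - frag_of (x, y) - frag_of (x, y')"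
      and "x \<in> carrier M" "y \<in> carrier N" "y' \<in> carrier N"
    then show ?thesis
      unfolding d by (intro tensor_free_diff frag_of_closed) simp_all
  next
    fix x a y
    assume d: "d = frag_of (x \<triangleleft>\<^bsub>M\<^esub> a, y) - frag_of (x, a \<triangleright>\<^bsub>N\<^esub> y)"
      and "x \<in> carrier M" "a \<in> carrier A" "y \<in> carrier N"
    then show ?thesis
      unfolding d by (intro tensor_free_diff frag_of_closed) simp_all
  qed
qed

lemma relator_in_K: "d \<in> tensor_relators A M N \<Longrightarrow> d \<in> K"
  unfolding tensor_kernel_def by (rule generate.incl)

lemma K_subgroup: "subgroup K F"
  unfolding tensor_kernel_def by (rule F.generate_is_subgroup[OF relators_carrier])

lemma K_normal: "K \<lhd> F"
  using K_subgroup by (rule F.subgroup_imp_normal)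

lemma K_carrier: "c \<in> K \<Longrightarrow> c \<in> carrier F"
  using subgroup.mem_carrier[OF K_subgroup] .

lemma K_add: "\<lbrakk>c \<in> K; d \<in> K\<rbrakk> \<Longrightarrow> c + d \<in> K"
  using subgroup.m_closed[OF K_subgroup] by simp

lemma K_minus: "c \<in> K \<Longrightarrow> - c \<in> K"
  using subgroup.m_inv_closed[OF K_subgroup, of c] K_carrier[of c] by simp

lemma K_zero: "0 \<in> K"
  using subgroup.one_closed[OF K_subgroup] by simp

lemma coset_eqI:
  assumes "c \<in> carrier F" "d \<in> carrier F" "c - d \<in> K"
  shows "K #>\<^bsub>F\<^esub> c = K #>\<^bsub>F\<^esub> d"
proof -
  have "c \<in> K #>\<^bsub>F\<^esub> d" using assms(3) by (force simp: r_coset_def)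
  then show ?thesis using F.repr_independence[OF _ assms(2) K_subgroup] by metis
qed

lemma coset_memD:
  assumes "d \<in> K #>\<^bsub>F\<^esub> c" "c \<in> carrier F"
  shows "d \<in> carrier F" "d - c \<in> K"
proof -
  obtain k where k: "k \<in> K" "d = k + c" using assms by (auto simp: r_coset_def)
  then show "d - c \<in> K" by simp
  show "d \<in> carrier F" unfolding k(2) using K_carrier[OF k(1)] assms(2) by (rule tensor_free_add)
qed

lemma action_coset:
  assumes cl: "\<And>c. c \<in> carrier F \<Longrightarrow> frag_extend \<phi> c \<in> carrier F"
    and rel: "\<And>d. d \<in> tensor_relators A M N \<Longrightarrow> frag_extend \<phi> d \<in> K"
    and c: "c \<in> carrier F"
  shows "(\<Union>d\<in>K #>\<^bsub>F\<^esub> c. K #>\<^bsub>F\<^esub> frag_extend \<phi> d) = K #>\<^bsub>F\<^esub> frag_extend \<phi> c"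
proof -
  have K: "frag_extend \<phi> d \<in> K" if "d \<in> K" for d
    using that unfolding tensor_kernel_def
  proof (induction d rule: generate.induct)
    case one then show ?case using K_zero by (simp add: tensor_kernel_def)
  next
    case (incl h) then show ?case using rel by (simp add: tensor_kernel_def)
  next
    case (inv h)
    then have "h \<in> carrier F" using relators_carrier by blast
    then have "inv\<^bsub>F\<^esub> h = - h" by simp
    then show ?case using K_minus[OF rel[OF inv]] by (simp add: tensor_kernel_def frag_extend_minus)
  next
    case (eng g h)
    then show ?case using K_add[unfolded tensor_kernel_def] by (simp add: frag_extend_add)
  qed
  have "K #>\<^bsub>F\<^esub> frag_extend \<phi> d = K #>\<^bsub>F\<^esub> frag_extend \<phi> c" if "d \<in> K #>\<^bsub>F\<^esub> c" for d
    using K[OF coset_memD(2)[OF that c]] coset_memD(1)[OF that c]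
    by (intro coset_eqI cl c) (simp_all add: frag_extend_diff)
  moreover have "c \<in> K #>\<^bsub>F\<^esub> c" using F.rcos_self[OF c K_subgroup] .
  ultimately show ?thesis by blast
qed

lemma rel1: "\<lbrakk>x \<in> carrier M; x' \<in> carrier M; y \<in> carrier N\<rbrakk>
    \<Longrightarrow> frag_of (x \<oplus>\<^bsub>M\<^esub> x', y) - frag_of (x, y) - frag_of (x', y) \<in> K"
  by (rule relator_in_K) (auto simp: tensor_relators_def)

lemma rel2: "\<lbrakk>x \<in> carrier M; y \<in> carrier N; y' \<in> carrier N\<rbrakk>
    \<Longrightarrow> frag_of (x, y \<oplus>\<^bsub>N\<^esub> y') - frag_of (x, y) - frag_of (x, y') \<in> K"
  by (rule relator_in_K) (auto simp: tensor_relators_def)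

lemma rel3: "\<lbrakk>x \<in> carrier M; a \<in> carrier A; y \<in> carrier N\<rbrakk>
    \<Longrightarrow> frag_of (x \<triangleleft>\<^bsub>M\<^esub> a, y) - frag_of (x, a \<triangleright>\<^bsub>N\<^esub> y) \<in> K"
  by (rule relator_in_K) (auto simp: tensor_relators_def)

lemma ract_closed: "\<lbrakk>c \<in> carrier F; a \<in> carrier A\<rbrakk> \<Longrightarrow> ract a c \<in> carrier F"
  using tensor_free_frag_extend[of c "carrier M \<times> carrier N" "\<lambda>(x, y). (x, y \<triangleleft>\<^bsub>N\<^esub> a)"]
  by (auto simp: case_prod_unfold simp del: carrier_free_Abelian_group_iff)

lemma lact_closed: "\<lbrakk>c \<in> carrier F; a \<in> carrier A\<rbrakk> \<Longrightarrow> lact a c \<in> carrier F"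
  using tensor_free_frag_extend[of c "carrier M \<times> carrier N" "\<lambda>(x, y). (a \<triangleright>\<^bsub>M\<^esub> x, y)"]
  by (auto simp: case_prod_unfold simp del: carrier_free_Abelian_group_iff)

lemma rsmult_coset:
  assumes "c \<in> carrier F" "a \<in> carrier A"
  shows "(K #>\<^bsub>F\<^esub> c) \<triangleleft>\<^bsub>T\<^esub> a = K #>\<^bsub>F\<^esub> ract a c"
proof -
  have "ract a d \<in> K" if "d \<in> tensor_relators A M N" for d
    using that assms(2) unfolding tensor_relators_def
    by (auto simp: frag_extend_diff N.rsmult_add_left N.lsmult_rsmult intro!: rel1 rel2 rel3)
  then show ?thesis
    using action_coset[OF ract_closed[OF _ assms(2)] _ assms(1)] by (simp add: tensor_def Let_def)
qed

lemma lsmult_coset: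
  assumes "c \<in> carrier F" "a \<in> carrier A"
  shows "a \<triangleright>\<^bsub>T\<^esub> (K #>\<^bsub>F\<^esub> c) = K #>\<^bsub>F\<^esub> lact a c"
proof -
  have "lact a d \<in> K" if "d \<in> tensor_relators A M N" for d
    using that assms(2) unfolding tensor_relators_def
    by (auto simp: frag_extend_diff M.lsmult_add_right M.lsmult_rsmult[symmetric] intro!: rel1 rel2 rel3)
  then show ?thesis
    using action_coset[OF lact_closed[OF _ assms(2)] _ assms(1)] by (simp add: tensor_def Let_def)
qed

lemma add_coset:
  assumes "c \<in> carrier F" "d \<in> carrier F"
  shows "(K #>\<^bsub>F\<^esub> c) \<oplus>\<^bsub>T\<^esub> (K #>\<^bsub>F\<^esub> d) = K #>\<^bsub>F\<^esub> (c + d)"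
  using normal.rcos_sum[OF K_normal assms] by (simp add: tensor_def Let_def FactGroup_def)

lemma carrier_tensor: "carrier T = (\<lambda>c. K #>\<^bsub>F\<^esub> c) ` carrier F"
  by (auto simp: tensor_def Let_def FactGroup_def RCOSETS_def)

lemma pure_tensor_closed:
  "\<lbrakk>x \<in> carrier M; y \<in> carrier N\<rbrakk> \<Longrightarrow> pure_tensor A M N x y \<in> carrier T"
  unfolding carrier_tensor pure_tensor_def by (intro imageI frag_of_closed)

lemma pure_tensor_rsmult:
  "\<lbrakk>x \<in> carrier M; y \<in> carrier N; a \<in> carrier A\<rbrakk>
    \<Longrightarrow> pure_tensor A M N x y \<triangleleft>\<^bsub>T\<^esub> a = pure_tensor A M N x (y \<triangleleft>\<^bsub>N\<^esub> a)"
  unfolding pure_tensor_def by (subst rsmult_coset) auto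

lemma pure_tensor_lsmult:
  "\<lbrakk>x \<in> carrier M; y \<in> carrier N; a \<in> carrier A\<rbrakk>
    \<Longrightarrow> a \<triangleright>\<^bsub>T\<^esub> pure_tensor A M N x y = pure_tensor A M N (a \<triangleright>\<^bsub>M\<^esub> x) y"
  unfolding pure_tensor_def by (subst lsmult_coset) auto

lemma pure_tensor_balanced:
  "\<lbrakk>x \<in> carrier M; y \<in> carrier N; a \<in> carrier A\<rbrakk>
    \<Longrightarrow> pure_tensor A M N (x \<triangleleft>\<^bsub>M\<^esub> a) y = pure_tensor A M N x (a \<triangleright>\<^bsub>N\<^esub> y)"
  unfolding pure_tensor_def by (intro coset_eqI rel3 frag_of_closed) auto

lemma abelian_group_tensor: "abelian_group T"
proof -
  interpret Q: comm_group "F Mod K" using F.abelian_FactGroup[OF K_subgroup] .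
  have eqs: "carrier T = carrier (F Mod K)" "add T = monoid.mult (F Mod K)" "\<zero>\<^bsub>T\<^esub> = \<one>\<^bsub>F Mod K\<^esub>"
    by (simp_all add: tensor_def Let_def)
  show ?thesis
  proof (rule abelian_groupI)
    fix X assume "X \<in> carrier T"
    then show "\<exists>Y\<in>carrier T. Y \<oplus>\<^bsub>T\<^esub> X = \<zero>\<^bsub>T\<^esub>"
      unfolding eqs by (intro bexI[of _ "inv\<^bsub>F Mod K\<^esub> X"] Q.l_inv Q.inv_closed)
  next
    fix X Y assume "X \<in> carrier T" "Y \<in> carrier T"
    then show "X \<oplus>\<^bsub>T\<^esub> Y \<in> carrier T" "X \<oplus>\<^bsub>T\<^esub> Y = Y \<oplus>\<^bsub>T\<^esub> X"
      unfolding eqs by (simp_all only: Q.m_closed Q.m_comm)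
  next
    fix X Y Z assume "X \<in> carrier T" "Y \<in> carrier T" "Z \<in> carrier T"
    then show "X \<oplus>\<^bsub>T\<^esub> Y \<oplus>\<^bsub>T\<^esub> Z = X \<oplus>\<^bsub>T\<^esub> (Y \<oplus>\<^bsub>T\<^esub> Z)"
      unfolding eqs by (rule Q.m_assoc)
  next
    fix X assume "X \<in> carrier T"
    then show "\<zero>\<^bsub>T\<^esub> \<oplus>\<^bsub>T\<^esub> X = X"
      unfolding eqs by (rule Q.l_one)
  qed (simp only: eqs Q.one_closed)
qed

text \<open>Additive maps \<open>F \<rightarrow> F\<close> are compared modulo \<open>K\<close> on generators.\<close>

lemma coset_eq_on_generators:
  assumes cl: "\<And>c. c \<in> carrier F \<Longrightarrow> p c \<in> carrier F" "\<And>c. c \<in> carrier F \<Longrightarrow> q c \<in> carrier F"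
    and p: "\<And>c d. p (c - d) = p c - p d" and q: "\<And>c d. q (c - d) = q c - q d"
    and gen: "\<And>x y. \<lbrakk>x \<in> carrier M; y \<in> carrier N\<rbrakk> \<Longrightarrow> p (frag_of (x, y)) - q (frag_of (x, y)) \<in> K"
    and c: "c \<in> carrier F"
  shows "K #>\<^bsub>F\<^esub> p c = K #>\<^bsub>F\<^esub> q c"
proof (intro coset_eqI cl c)
  have "Poly_Mapping.keys c \<subseteq> carrier M \<times> carrier N" using c by simp
  then show "p c - q c \<in> K"
  proof (induction c rule: frag_induction)
    case zero
    have "p 0 = 0" "q 0 = 0" using p[of 0 0] q[of 0 0] by simp_all
    then show ?case using K_zero by simp
  next
    case (one x) then show ?case using gen by auto
  next
    case (diff c d)
    have "p (c - d) - q (c - d) = (p c - q c) + - (p d - q d)" by (simp add: p q)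
    then show ?case using K_add[OF diff(1) K_minus[OF diff(2)]] by simp
  qed
qed

lemma bimodule_tensor: "bimodule A T"
proof (intro bimodule.intro right_module.intro right_module_axioms.intro bimodule_axioms.intro
    abelian_group_tensor)
  show "ring A" by (rule M.R.ring_axioms)
next
  fix X r assume "X \<in> carrier T" and r: "r \<in> carrier A"
  then obtain c where c: "c \<in> carrier F" "X = K #>\<^bsub>F\<^esub> c" by (auto simp: carrier_tensor)
  show "X \<triangleleft>\<^bsub>T\<^esub> r \<in> carrier T" "r \<triangleright>\<^bsub>T\<^esub> X \<in> carrier T"
    unfolding c rsmult_coset[OF c(1) r] lsmult_coset[OF c(1) r] carrier_tensor
    using ract_closed lact_closed c r by blast+
  fix s assume s: "s \<in> carrier A"
  show "X \<triangleleft>\<^bsub>T\<^esub> (r \<oplus>\<^bsub>A\<^esub> s) = X \<triangleleft>\<^bsub>T\<^esub> r \<oplus>\<^bsub>T\<^esub> X \<triangleleft>\<^bsub>T\<^esub> s"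
    unfolding c rsmult_coset[OF c(1) r] rsmult_coset[OF c(1) s]
      rsmult_coset[OF c(1) M.R.add.m_closed[OF r s]]
      add_coset[OF ract_closed[OF c(1) r] ract_closed[OF c(1) s]]
  proof (rule coset_eq_on_generators[where p = "ract (r \<oplus>\<^bsub>A\<^esub> s)"
        and q = "\<lambda>c. ract r c + ract s c"])
    show "ract (r \<oplus>\<^bsub>A\<^esub> s) d \<in> carrier F" "ract r d + ract s d \<in> carrier F" if "d \<in> carrier F" for d
      using ract_closed[OF that] r s by (blast intro: tensor_free_add M.R.add.m_closed)+
    show "ract (r \<oplus>\<^bsub>A\<^esub> s) (d - d') = ract (r \<oplus>\<^bsub>A\<^esub> s) d - ract (r \<oplus>\<^bsub>A\<^esub> s) d'" for d d'
      by (rule frag_extend_diff)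
    show "ract r (d - d') + ract s (d - d') = ract r d + ract s d - (ract r d' + ract s d')" for d d'
      unfolding frag_extend_diff by simp
    show "ract (r \<oplus>\<^bsub>A\<^esub> s) (frag_of (x, y)) - (ract r (frag_of (x, y)) + ract s (frag_of (x, y))) \<in> K"
      if "x \<in> carrier M" "y \<in> carrier N" for x y
      using rel2[of x "y \<triangleleft>\<^bsub>N\<^esub> r" "y \<triangleleft>\<^bsub>N\<^esub> s"] that r s by (simp add: N.rsmult_add_right diff_diff_add)
  qed (rule c(1))
  show "(X \<triangleleft>\<^bsub>T\<^esub> r) \<triangleleft>\<^bsub>T\<^esub> s = X \<triangleleft>\<^bsub>T\<^esub> (r \<otimes>\<^bsub>A\<^esub> s)"
    unfolding c rsmult_coset[OF c(1) r] rsmult_coset[OF ract_closed[OF c(1) r] s]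
      rsmult_coset[OF c(1) M.R.m_closed[OF r s]]
  proof (rule coset_eq_on_generators[where p = "\<lambda>c. ract s (ract r c)"
        and q = "ract (r \<otimes>\<^bsub>A\<^esub> s)"])
    show "ract s (ract r d) \<in> carrier F" "ract (r \<otimes>\<^bsub>A\<^esub> s) d \<in> carrier F" if "d \<in> carrier F" for d
      by (intro ract_closed lact_closed that M.R.m_closed M.R.one_closed r s)+
    show "ract s (ract r (d - d')) = ract s (ract r d) - ract s (ract r d')" for d d'
      by (simp only: frag_extend_diff)
    show "ract (r \<otimes>\<^bsub>A\<^esub> s) (d - d') = ract (r \<otimes>\<^bsub>A\<^esub> s) d - ract (r \<otimes>\<^bsub>A\<^esub> s) d'" for d d'
      by (simp only: frag_extend_diff)
    show "ract s (ract r (frag_of (x, y))) - ract (r \<otimes>\<^bsub>A\<^esub> s) (frag_of (x, y)) \<in> K"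
      if "x \<in> carrier M" "y \<in> carrier N" for x y
      using that r s by (simp add: N.rsmult_assoc K_zero)
  qed (rule c(1))
  show "(r \<oplus>\<^bsub>A\<^esub> s) \<triangleright>\<^bsub>T\<^esub> X = (r \<triangleright>\<^bsub>T\<^esub> X) \<oplus>\<^bsub>T\<^esub> (s \<triangleright>\<^bsub>T\<^esub> X)"
    unfolding c lsmult_coset[OF c(1) r] lsmult_coset[OF c(1) s]
      lsmult_coset[OF c(1) M.R.add.m_closed[OF r s]]
      add_coset[OF lact_closed[OF c(1) r] lact_closed[OF c(1) s]]
  proof (rule coset_eq_on_generators[where p = "lact (r \<oplus>\<^bsub>A\<^esub> s)"
        and q = "\<lambda>c. lact r c + lact s c"])
    show "lact (r \<oplus>\<^bsub>A\<^esub> s) d \<in> carrier F" "lact r d + lact s d \<in> carrier F" if "d \<in> carrier F" for d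
      using lact_closed[OF that] r s by (blast intro: tensor_free_add M.R.add.m_closed)+
    show "lact (r \<oplus>\<^bsub>A\<^esub> s) (d - d') = lact (r \<oplus>\<^bsub>A\<^esub> s) d - lact (r \<oplus>\<^bsub>A\<^esub> s) d'" for d d'
      by (rule frag_extend_diff)
    show "lact r (d - d') + lact s (d - d') = lact r d + lact s d - (lact r d' + lact s d')" for d d'
      unfolding frag_extend_diff by simp
    show "lact (r \<oplus>\<^bsub>A\<^esub> s) (frag_of (x, y)) - (lact r (frag_of (x, y)) + lact s (frag_of (x, y))) \<in> K"
      if "x \<in> carrier M" "y \<in> carrier N" for x y
      using rel1[of "r \<triangleright>\<^bsub>M\<^esub> x" "s \<triangleright>\<^bsub>M\<^esub> x" y] that r s by (simp add: M.lsmult_add_left diff_diff_add)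
  qed (rule c(1))
  show "r \<triangleright>\<^bsub>T\<^esub> (s \<triangleright>\<^bsub>T\<^esub> X) = (r \<otimes>\<^bsub>A\<^esub> s) \<triangleright>\<^bsub>T\<^esub> X"
    unfolding c lsmult_coset[OF c(1) s] lsmult_coset[OF lact_closed[OF c(1) s] r]
      lsmult_coset[OF c(1) M.R.m_closed[OF r s]]
  proof (rule coset_eq_on_generators[where p = "\<lambda>c. lact r (lact s c)"
        and q = "lact (r \<otimes>\<^bsub>A\<^esub> s)"])
    show "lact r (lact s d) \<in> carrier F" "lact (r \<otimes>\<^bsub>A\<^esub> s) d \<in> carrier F" if "d \<in> carrier F" for d
      by (intro ract_closed lact_closed that M.R.m_closed M.R.one_closed r s)+
    show "lact r (lact s (d - d')) = lact r (lact s d) - lact r (lact s d')" for d d'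
      by (simp only: frag_extend_diff)
    show "lact (r \<otimes>\<^bsub>A\<^esub> s) (d - d') = lact (r \<otimes>\<^bsub>A\<^esub> s) d - lact (r \<otimes>\<^bsub>A\<^esub> s) d'" for d d'
      by (simp only: frag_extend_diff)
    show "lact r (lact s (frag_of (x, y))) - lact (r \<otimes>\<^bsub>A\<^esub> s) (frag_of (x, y)) \<in> K"
      if "x \<in> carrier M" "y \<in> carrier N" for x y
      using that r s by (simp add: M.lsmult_assoc K_zero)
  qed (rule c(1))
  show "(r \<triangleright>\<^bsub>T\<^esub> X) \<triangleleft>\<^bsub>T\<^esub> s = r \<triangleright>\<^bsub>T\<^esub> (X \<triangleleft>\<^bsub>T\<^esub> s)"
    unfolding c lsmult_coset[OF c(1) r] rsmult_coset[OF lact_closed[OF c(1) r] s]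
      rsmult_coset[OF c(1) s] lsmult_coset[OF ract_closed[OF c(1) s] r]
  proof (rule coset_eq_on_generators[where p = "\<lambda>c. ract s (lact r c)"
        and q = "\<lambda>c. lact r (ract s c)"])
    show "ract s (lact r d) \<in> carrier F" "lact r (ract s d) \<in> carrier F" if "d \<in> carrier F" for d
      by (intro ract_closed lact_closed that M.R.m_closed M.R.one_closed r s)+
    show "ract s (lact r (d - d')) = ract s (lact r d) - ract s (lact r d')" for d d'
      by (simp only: frag_extend_diff)
    show "lact r (ract s (d - d')) = lact r (ract s d) - lact r (ract s d')" for d d'
      by (simp only: frag_extend_diff)
    show "ract s (lact r (frag_of (x, y))) - lact r (ract s (frag_of (x, y))) \<in> K"
      if "x \<in> carrier M" "y \<in> carrier N" for x y
      using that r s by (simp add: K_zero)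
  qed (rule c(1))
next
  fix X Y r assume "X \<in> carrier T" "Y \<in> carrier T" and r: "r \<in> carrier A"
  then obtain c d where c: "c \<in> carrier F" "X = K #>\<^bsub>F\<^esub> c" and d: "d \<in> carrier F" "Y = K #>\<^bsub>F\<^esub> d"
    by (auto simp: carrier_tensor)
  have cd: "c + d \<in> carrier F" using c(1) d(1) by (rule tensor_free_add)
  show "(X \<oplus>\<^bsub>T\<^esub> Y) \<triangleleft>\<^bsub>T\<^esub> r = X \<triangleleft>\<^bsub>T\<^esub> r \<oplus>\<^bsub>T\<^esub> Y \<triangleleft>\<^bsub>T\<^esub> r"
    unfolding c d add_coset[OF c(1) d(1)] rsmult_coset[OF cd r] rsmult_coset[OF c(1) r]
      rsmult_coset[OF d(1) r] add_coset[OF ract_closed[OF c(1) r] ract_closed[OF d(1) r]]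
    by (simp add: frag_extend_add)
  show "r \<triangleright>\<^bsub>T\<^esub> (X \<oplus>\<^bsub>T\<^esub> Y) = (r \<triangleright>\<^bsub>T\<^esub> X) \<oplus>\<^bsub>T\<^esub> (r \<triangleright>\<^bsub>T\<^esub> Y)"
    unfolding c d add_coset[OF c(1) d(1)] lsmult_coset[OF cd r] lsmult_coset[OF c(1) r]
      lsmult_coset[OF d(1) r] add_coset[OF lact_closed[OF c(1) r] lact_closed[OF d(1) r]]
    by (simp add: frag_extend_add)
next
  fix X assume "X \<in> carrier T"
  then obtain c where c: "c \<in> carrier F" "X = K #>\<^bsub>F\<^esub> c" by (auto simp: carrier_tensor)
  show "X \<triangleleft>\<^bsub>T\<^esub> \<one>\<^bsub>A\<^esub> = X"
    unfolding c rsmult_coset[OF c(1) M.R.one_closed]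
  proof (rule coset_eq_on_generators[where p = "ract \<one>\<^bsub>A\<^esub>"
        and q = "\<lambda>c. c"])
    show "ract \<one>\<^bsub>A\<^esub> d \<in> carrier F" "d \<in> carrier F" if "d \<in> carrier F" for d
      by (intro ract_closed lact_closed that M.R.m_closed M.R.one_closed)+
    show "ract \<one>\<^bsub>A\<^esub> (d - d') = ract \<one>\<^bsub>A\<^esub> d - ract \<one>\<^bsub>A\<^esub> d'" for d d'
      by (simp only: frag_extend_diff)
    show "d - d' = d - d'" for d d' :: "'m \<times> 'n \<Rightarrow>\<^sub>0 int" by (rule refl)
    show "ract \<one>\<^bsub>A\<^esub> (frag_of (x, y)) - frag_of (x, y) \<in> K"
      if "x \<in> carrier M" "y \<in> carrier N" for x y
      using that by (simp add: K_zero)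
  qed (rule c(1))
  show "\<one>\<^bsub>A\<^esub> \<triangleright>\<^bsub>T\<^esub> X = X"
    unfolding c lsmult_coset[OF c(1) M.R.one_closed]
  proof (rule coset_eq_on_generators[where p = "lact \<one>\<^bsub>A\<^esub>"
        and q = "\<lambda>c. c"])
    show "lact \<one>\<^bsub>A\<^esub> d \<in> carrier F" "d \<in> carrier F" if "d \<in> carrier F" for d
      by (intro ract_closed lact_closed that M.R.m_closed M.R.one_closed)+
    show "lact \<one>\<^bsub>A\<^esub> (d - d') = lact \<one>\<^bsub>A\<^esub> d - lact \<one>\<^bsub>A\<^esub> d'" for d d'
      by (simp only: frag_extend_diff)
    show "d - d' = d - d'" for d d' :: "'m \<times> 'n \<Rightarrow>\<^sub>0 int" by (rule refl)
    show "lact \<one>\<^bsub>A\<^esub> (frag_of (x, y)) - frag_of (x, y) \<in> K"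
      if "x \<in> carrier M" "y \<in> carrier N" for x y
      using that by (simp add: K_zero)
  qed (rule c(1))
qed

end

lemma ring_bimod_bimodule:
  assumes "ring A" "ring R" "i \<in> ring_hom A R"
  shows "bimodule A (ring_bimod R i)"
proof -
  interpret A: ring A by fact
  interpret R: ring R by fact
  have "abelian_group (ring_bimod R i)"
  proof (rule abelian_groupI)
    fix x assume "x \<in> carrier (ring_bimod R i)"
    then show "\<exists>y\<in>carrier (ring_bimod R i). y \<oplus>\<^bsub>ring_bimod R i\<^esub> x = \<zero>\<^bsub>ring_bimod R i\<^esub>"
      by (intro bexI[of _ "\<ominus>\<^bsub>R\<^esub> x"]) (auto simp: ring_bimod_def R.l_neg)
  qed (auto simp: ring_bimod_def R.a_ac)
  then show ?thesis
    using assms(3)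
    by (intro bimodule.intro right_module.intro right_module_axioms.intro bimodule_axioms.intro
        assms(1))
      (auto simp: ring_bimod_def ring_hom_def R.l_distr R.r_distr R.m_assoc Pi_iff)
qed

lemma char_rmod_right_module:
  assumes "ring A" "ring R" "i \<in> ring_hom A R" "right_grouplike_character A R i \<chi>"
  shows "right_module R (char_rmod A R i \<chi>)"
proof -
  interpret A: ring A by fact
  interpret R: ring R by fact
  have i: "\<And>a. a \<in> carrier A \<Longrightarrow> i a \<in> carrier R"
    "\<And>a b. \<lbrakk>a \<in> carrier A; b \<in> carrier A\<rbrakk> \<Longrightarrow> i (a \<oplus>\<^bsub>A\<^esub> b) = i a \<oplus>\<^bsub>R\<^esub> i b"
    using assms(3) by (auto simp: ring_hom_def)
  have \<chi>: "\<And>r. r \<in> carrier R \<Longrightarrow> \<chi> r \<in> carrier A"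
    "\<And>r s. \<lbrakk>r \<in> carrier R; s \<in> carrier R\<rbrakk> \<Longrightarrow> \<chi> (r \<oplus>\<^bsub>R\<^esub> s) = \<chi> r \<oplus>\<^bsub>A\<^esub> \<chi> s"
    "\<And>r a. \<lbrakk>r \<in> carrier R; a \<in> carrier A\<rbrakk> \<Longrightarrow> \<chi> (r \<otimes>\<^bsub>R\<^esub> i a) = \<chi> r \<otimes>\<^bsub>A\<^esub> a"
    "\<And>r s. \<lbrakk>r \<in> carrier R; s \<in> carrier R\<rbrakk> \<Longrightarrow> \<chi> (i (\<chi> r) \<otimes>\<^bsub>R\<^esub> s) = \<chi> (r \<otimes>\<^bsub>R\<^esub> s)"
    "\<chi> \<one>\<^bsub>R\<^esub> = \<one>\<^bsub>A\<^esub>"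
    using assms(4) by (auto simp: right_grouplike_character_def rmod_hom_def ring_bimod_def)
  have one: "\<chi> (i a) = a" if "a \<in> carrier A" for a
    using \<chi>(3)[of "\<one>\<^bsub>R\<^esub>" a] \<chi>(5) i(1) that by simp
  have "abelian_group (char_rmod A R i \<chi>)"
  proof (rule abelian_groupI)
    fix x assume "x \<in> carrier (char_rmod A R i \<chi>)"
    then show "\<exists>y\<in>carrier (char_rmod A R i \<chi>). y \<oplus>\<^bsub>char_rmod A R i \<chi>\<^esub> x = \<zero>\<^bsub>char_rmod A R i \<chi>\<^esub>"
      by (intro bexI[of _ "\<ominus>\<^bsub>A\<^esub> x"]) (auto simp: char_rmod_def A.l_neg)
  qed (auto simp: char_rmod_def A.a_ac)
  then show ?thesis
    by (intro right_module.intro right_module_axioms.intro assms(2))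
      (auto simp: char_rmod_def i \<chi> one R.l_distr R.r_distr R.m_assoc)
qed

end

theory Submission
  imports Defs "HOL-Algebra.Subrings"
begin

text \<open>
  Everything rests on a form of Cauchon's theorem: over a right FBN ring \<open>T\<close>, the common
  preimage of a submodule \<open>V\<close> under any set of homomorphisms between noetherian modules is
  already the common preimage under finitely many of them. Conversely, if this holds for the left
  multiplications of a noetherian ring and every right ideal \<open>V\<close>, then the ring is fully bounded,
  because \<open>{s. T s \<subseteq> V}\<close> is a two-sided ideal and a finite intersection of essential right ideals is
  essential. Hence FBN passes to extensions that are noetherian modules over the base, and, as
  invariants act by \<open>R\<close>-linear endomorphisms on \<open>A\<close>, from \<open>R\<close> to \<open>B\<close> as soon as \<open>K A \<inter> B = K\<close> for
  right ideals \<open>K\<close> of \<open>B\<close>.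

  For the remaining implication, \<open>A\<close> is shown to be a noetherian right \<open>B\<close>-module. Writing the
  Frobenius element as \<open>\<Sum> p\<^sub>k \<otimes> u\<^sub>k \<otimes> q\<^sub>k\<close>, put \<open>z(w) = \<Sum> w \<chi>(p\<^sub>k) u\<^sub>k \<otimes> q\<^sub>k\<close> in the noetherian right
  \<open>A\<close>-module \<open>I \<otimes> R\<close>. A \<open>B\<close>-submodule \<open>W\<close> of \<open>A\<close> can be recovered from the \<open>A\<close>-submodule generated by
  \<open>z(W)\<close>, so chains in \<open>A\<close> become stationary.
\<close>

section \<open>Submodules and noetherian modules\<close>

text \<open>Full boundedness speaks about prime factor rings, and no correspondence between the
  primes of \<open>A\<close>, \<open>R\<close> and \<open>B\<close> is at hand. Cauchon's finiteness
  property mentions only submodules and homomorphisms, so it survives a change of rings; this is why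
  the primes are left behind as soon as possible.

  The equality \<open>K A \<inter> B = K\<close> has two sources. If \<open>A\<close> is
  quasi-projective, endomorphisms can be lifted from quotients of \<open>A\<close>, which turns
  arbitrary coefficients into invariant ones. If \<open>A\<close> is projective, the epimorphism
  \<open>\<chi>\<close> from \<open>R\<close> to \<open>A\<close> splits.

  The submodule \<open>W\<close> is read off from \<open>z(W)\<close> by the additive maps
  \<open>x \<otimes> s \<mapsto> x \<nu>(s r \<otimes> v)\<close> from \<open>I \<otimes> R\<close>
  to \<open>I\<close>: the Frobenius identities make them send \<open>z(w)\<close> to
  \<open>w \<chi>(r) v\<close>. Once \<open>A\<close> is noetherian over \<open>B\<close>, the
  extension result applies to \<open>B \<subseteq> A\<close>. Finite generation of \<open>R\<close>
  comes from the same identities, with the Morita context turning tensors in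
  \<open>R \<otimes> I\<close> back into elements of \<open>R\<close>.\<close>

lemma rsubmodule_subset: "rsubmodule R M N \<Longrightarrow> N \<subseteq> carrier M"
  by (auto simp: rsubmodule_def dest: additive_subgroup.a_Hcarr)

lemma rsubmodule_zero: "rsubmodule R M N \<Longrightarrow> \<zero>\<^bsub>M\<^esub> \<in> N"
  by (auto simp: rsubmodule_def additive_subgroup.zero_closed)

lemma rsubmodule_add: "\<lbrakk>rsubmodule R M N; x \<in> N; y \<in> N\<rbrakk> \<Longrightarrow> x \<oplus>\<^bsub>M\<^esub> y \<in> N"
  by (auto simp: rsubmodule_def additive_subgroup.a_closed)

lemma rsubmodule_rsmult: "\<lbrakk>rsubmodule R M N; x \<in> N; r \<in> carrier R\<rbrakk> \<Longrightarrow> x \<triangleleft>\<^bsub>M\<^esub> r \<in> N"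
  by (auto simp: rsubmodule_def)

context right_module
begin

lemma rsmult_minus_one:
  assumes "x \<in> carrier M"
  shows "x \<triangleleft>\<^bsub>M\<^esub> (\<ominus>\<^bsub>R\<^esub> \<one>\<^bsub>R\<^esub>) = \<ominus>\<^bsub>M\<^esub> x"
proof -
  have "x \<triangleleft>\<^bsub>M\<^esub> (\<ominus>\<^bsub>R\<^esub> \<one>\<^bsub>R\<^esub>) \<oplus>\<^bsub>M\<^esub> x = x \<triangleleft>\<^bsub>M\<^esub> (\<ominus>\<^bsub>R\<^esub> \<one>\<^bsub>R\<^esub> \<oplus>\<^bsub>R\<^esub> \<one>\<^bsub>R\<^esub>)"
    using assms by (subst rsmult_add_right) auto
  also have "\<dots> = \<zero>\<^bsub>M\<^esub>" using assms by (simp add: R.l_neg)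
  finally show ?thesis using assms M.minus_equality by (metis M.minus_equality R.a_inv_closed R.one_closed rsmult_closed)
qed

text \<open>Negatives come for free: \<open>\<ominus> x\<close> is \<open>x\<close> acted on by
  \<open>\<ominus> \<one>\<close>.\<close>

lemma rsubmoduleI:
  assumes "N \<subseteq> carrier M" "\<zero>\<^bsub>M\<^esub> \<in> N" "\<And>x y. \<lbrakk>x \<in> N; y \<in> N\<rbrakk> \<Longrightarrow> x \<oplus>\<^bsub>M\<^esub> y \<in> N"
    and smult: "\<And>x r. \<lbrakk>x \<in> N; r \<in> carrier R\<rbrakk> \<Longrightarrow> x \<triangleleft>\<^bsub>M\<^esub> r \<in> N"
  shows "rsubmodule R M N"
proof -
  have "\<ominus>\<^bsub>M\<^esub> x \<in> N" if "x \<in> N" for x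
    using smult[OF that, of "\<ominus>\<^bsub>R\<^esub> \<one>\<^bsub>R\<^esub>"] rsmult_minus_one[of x] that assms(1) by auto
  then have "subgroup N (add_monoid M)"
    using assms by (intro M.add.subgroupI) (auto simp: a_inv_def)
  then show ?thesis using smult by (auto simp: rsubmodule_def additive_subgroup_def)
qed

lemma rsubmodule_minus:
  assumes "rsubmodule R M N" "x \<in> N" shows "\<ominus>\<^bsub>M\<^esub> x \<in> N"
  using assms rsmult_minus_one[of x] rsubmodule_rsmult[OF assms, of "\<ominus>\<^bsub>R\<^esub> \<one>\<^bsub>R\<^esub>"] rsubmodule_subset[OF assms(1)]
  by auto

lemma rsubmodule_add_cancel:
  assumes "rsubmodule R M N" "x \<in> N" "y \<in> carrier M"
  shows "x \<oplus>\<^bsub>M\<^esub> y \<in> N \<longleftrightarrow> y \<in> N"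
proof
  assume "x \<oplus>\<^bsub>M\<^esub> y \<in> N"
  then have "\<ominus>\<^bsub>M\<^esub> x \<oplus>\<^bsub>M\<^esub> (x \<oplus>\<^bsub>M\<^esub> y) \<in> N"
    using rsubmodule_add rsubmodule_minus assms by metis
  moreover have "x \<in> carrier M" using assms rsubmodule_subset by blast
  ultimately show "y \<in> N" using assms(3) by (simp add: M.r_neg1)
qed (use assms rsubmodule_add in metis)

lemma rsubmodule_carrier: "rsubmodule R M (carrier M)"
  by (intro rsubmoduleI) auto

lemma rsubmodule_Int:
  assumes "rsubmodule R M N" "rsubmodule R M N'"
  shows "rsubmodule R M (N \<inter> N')"
  using rsubmodule_subset[OF assms(1)] rsubmodule_zero[OF assms(1)] rsubmodule_zero[OF assms(2)]
    rsubmodule_add[OF assms(1)] rsubmodule_add[OF assms(2)]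
    rsubmodule_rsmult[OF assms(1)] rsubmodule_rsmult[OF assms(2)]
  by (intro rsubmoduleI) auto

lemma rsubmodule_plus:
  assumes "rsubmodule R M N" "rsubmodule R M N'"
  shows "rsubmodule R M (N <+>\<^bsub>M\<^esub> N')"
proof (rule rsubmoduleI)
  note sub = rsubmodule_subset[OF assms(1)] rsubmodule_subset[OF assms(2)]
  show "N <+>\<^bsub>M\<^esub> N' \<subseteq> carrier M" using sub by (auto simp: set_add_def')
  show "\<zero>\<^bsub>M\<^esub> \<in> N <+>\<^bsub>M\<^esub> N'"
    using rsubmodule_zero[OF assms(1)] rsubmodule_zero[OF assms(2)]
    by (auto simp: set_add_def' intro!: bexI[of _ "\<zero>\<^bsub>M\<^esub>"])
  show "x \<oplus>\<^bsub>M\<^esub> y \<in> N <+>\<^bsub>M\<^esub> N'" if xy: "x \<in> N <+>\<^bsub>M\<^esub> N'" "y \<in> N <+>\<^bsub>M\<^esub> N'" for x y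
  proof -
    obtain a b c d where *: "a \<in> N" "b \<in> N'" "c \<in> N" "d \<in> N'" "x = a \<oplus>\<^bsub>M\<^esub> b" "y = c \<oplus>\<^bsub>M\<^esub> d"
      using xy by (auto simp: set_add_def')
    have "x \<oplus>\<^bsub>M\<^esub> y = (a \<oplus>\<^bsub>M\<^esub> c) \<oplus>\<^bsub>M\<^esub> (b \<oplus>\<^bsub>M\<^esub> d)"
      unfolding * using *(1-4) sub by (simp add: M.a_ac subset_iff)
    then show ?thesis
      using rsubmodule_add[OF assms(1) *(1,3)] rsubmodule_add[OF assms(2) *(2,4)]
      by (auto simp: set_add_def')
  qed
  show "x \<triangleleft>\<^bsub>M\<^esub> r \<in> N <+>\<^bsub>M\<^esub> N'" if x: "x \<in> N <+>\<^bsub>M\<^esub> N'" and r: "r \<in> carrier R" for x r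
  proof -
    obtain a b where *: "a \<in> N" "b \<in> N'" "x = a \<oplus>\<^bsub>M\<^esub> b"
      using x by (auto simp: set_add_def')
    have "x \<triangleleft>\<^bsub>M\<^esub> r = a \<triangleleft>\<^bsub>M\<^esub> r \<oplus>\<^bsub>M\<^esub> b \<triangleleft>\<^bsub>M\<^esub> r"
      unfolding * using *(1,2) sub r by (simp add: rsmult_add_left subset_iff)
    then show ?thesis
      using rsubmodule_rsmult[OF assms(1) *(1) r] rsubmodule_rsmult[OF assms(2) *(2) r]
      by (auto simp: set_add_def')
  qed
qed

lemma plus_upper:
  assumes "rsubmodule R M N" "rsubmodule R M N'"
  shows "N \<subseteq> N <+>\<^bsub>M\<^esub> N'" "N' \<subseteq> N <+>\<^bsub>M\<^esub> N'"
proof -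
  note sub = rsubmodule_subset[OF assms(1)] rsubmodule_subset[OF assms(2)]
  show "N \<subseteq> N <+>\<^bsub>M\<^esub> N'"
    using rsubmodule_zero[OF assms(2)] sub by (force simp: set_add_def')
  show "N' \<subseteq> N <+>\<^bsub>M\<^esub> N'"
    using rsubmodule_zero[OF assms(1)] sub by (force simp: set_add_def')
qed

end

lemma rsubmodule_vimage:
  assumes "right_module R M" "right_module R N" "h \<in> rmod_hom R M N" "rsubmodule R N V"
  shows "rsubmodule R M {x \<in> carrier M. h x \<in> V}"
proof -
  interpret right_module R M by fact
  show ?thesis
    using rmod_hom_zero[OF assms(1-3)] assms(3) rsubmodule_zero[OF assms(4)]
      rsubmodule_add[OF assms(4)] rsubmodule_rsmult[OF assms(4)]
    by (intro rsubmoduleI) (auto simp: rmod_hom_def)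
qed

lemma rsubmodule_image:
  assumes "right_module R M" "right_module R N" "h \<in> rmod_hom R M N" "rsubmodule R M V"
  shows "rsubmodule R N (h ` V)"
proof -
  interpret N: right_module R N by fact
  note sub = rsubmodule_subset[OF assms(4)]
  have h: "h x \<in> carrier N" "h (x \<oplus>\<^bsub>M\<^esub> y) = h x \<oplus>\<^bsub>N\<^esub> h y" "r \<in> carrier R \<Longrightarrow> h (x \<triangleleft>\<^bsub>M\<^esub> r) = h x \<triangleleft>\<^bsub>N\<^esub> r"
    if "x \<in> V" "y \<in> V" for x y r
    using assms(3) subsetD[OF sub that(1)] subsetD[OF sub that(2)] by (auto simp: rmod_hom_def)
  show ?thesis
  proof (rule N.rsubmoduleI)
    show "h ` V \<subseteq> carrier N" using h by auto
    show "\<zero>\<^bsub>N\<^esub> \<in> h ` V"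
      using rmod_hom_zero[OF assms(1-3)] rsubmodule_zero[OF assms(4)] by (metis imageI)
    show "x \<oplus>\<^bsub>N\<^esub> y \<in> h ` V" if "x \<in> h ` V" "y \<in> h ` V" for x y
      using that h(2) rsubmodule_add[OF assms(4)] by (auto simp: image_iff) metis
    show "x \<triangleleft>\<^bsub>N\<^esub> r \<in> h ` V" if "x \<in> h ` V" "r \<in> carrier R" for x r
      using that h(3) rsubmodule_rsmult[OF assms(4)] by (auto simp: image_iff) metis
  qed
qed

lemma (in right_module) rsubmodule_all_vimage:
  assumes "X \<subseteq> rmod_hom R M N" "right_module R N" "rsubmodule R N V" "rsubmodule R M N'"
  shows "rsubmodule R M {x \<in> N'. \<forall>f\<in>X. f x \<in> V}"
proof (rule rsubmoduleI)
  note N' = rsubmodule_subset[OF assms(4)] rsubmodule_zero[OF assms(4)] rsubmodule_add[OF assms(4)]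
    rsubmodule_rsmult[OF assms(4)]
  note V = rsubmodule_zero[OF assms(3)] rsubmodule_add[OF assms(3)] rsubmodule_rsmult[OF assms(3)]
  let ?S = "{x \<in> N'. \<forall>f\<in>X. f x \<in> V}"
  show "?S \<subseteq> carrier M" using N' by auto
  show "\<zero>\<^bsub>M\<^esub> \<in> ?S"
    using N'(2) V(1) rmod_hom_zero[OF right_module_axioms assms(2)] assms(1) by (auto dest: subsetD)
  show "x \<oplus>\<^bsub>M\<^esub> y \<in> ?S" if "x \<in> ?S" "y \<in> ?S" for x y
    using that N' V assms(1) by (auto simp: rmod_hom_def subset_iff)
  show "x \<triangleleft>\<^bsub>M\<^esub> r \<in> ?S" if "x \<in> ?S" "r \<in> carrier R" for x r
    using that N' V assms(1) by (auto simp: rmod_hom_def subset_iff)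
qed

section \<open>Chain conditions, and right ideals as submodules\<close>

definition noetherian_rmod :: "('r, 'x) ring_scheme \<Rightarrow> ('r, 'm, 'y) rmod_scheme \<Rightarrow> bool"
  where "noetherian_rmod R M \<longleftrightarrow>
    (\<forall>K :: nat \<Rightarrow> 'm set. (\<forall>n. rsubmodule R M (K n)) \<longrightarrow> (\<forall>n. K n \<subseteq> K (Suc n)) \<longrightarrow>
      (\<exists>m. \<forall>n\<ge>m. K n = K m))"

text \<open>Dependent choice turns a family without maximal member into a strictly increasing chain.
  The inductions over submodules in Cauchon's theorem are all run through a maximal member.\<close>

lemma noetherian_maximal:
  assumes "noetherian_rmod R M" "\<S> \<noteq> {}" "\<And>N. N \<in> \<S> \<Longrightarrow> rsubmodule R M N"
  shows "\<exists>N\<in>\<S>. \<forall>N'\<in>\<S>. N \<subseteq> N' \<longrightarrow> N' = N"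
proof (rule ccontr)
  assume "\<not> ?thesis"
  then have *: "\<exists>N'. N' \<in> \<S> \<and> N \<subset> N'" if "N \<in> \<S>" for N using that by blast
  have "\<exists>K. \<forall>n. K n \<in> \<S> \<and> K n \<subset> K (Suc n)"
    by (rule dependent_nat_choice) (use assms(2) * in auto)
  then obtain K where K: "\<And>n. K n \<in> \<S>" "\<And>n. K n \<subset> K (Suc n)" by blast
  then obtain m where "\<forall>n\<ge>m. K n = K m"
    using assms(1,3) unfolding noetherian_rmod_def by (meson psubset_imp_subset)
  then show False using K(2)[of m] by (metis Suc_n_not_le_n nat_le_linear psubset_eq)
qed

text \<open>Stationarity is pulled back along \<open>\<phi>\<close>, which has to reflect equality
  only for nested submodules, because the members of a chain are nested. Later \<open>\<phi>\<close>
  is the identity under restriction of scalars, or the generation of a submodule over another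
  ring.\<close>

lemma noetherian_transfer:
  assumes M': "noetherian_rmod R' M'"
    and sub: "\<And>N. rsubmodule R M N \<Longrightarrow> rsubmodule R' M' (\<phi> N)"
    and mono: "\<And>N N'. \<lbrakk>rsubmodule R M N; rsubmodule R M N'; N \<subseteq> N'\<rbrakk> \<Longrightarrow> \<phi> N \<subseteq> \<phi> N'"
    and inj: "\<And>N N'. \<lbrakk>rsubmodule R M N; rsubmodule R M N'; N \<subseteq> N'; \<phi> N = \<phi> N'\<rbrakk> \<Longrightarrow> N' \<subseteq> N"
  shows "noetherian_rmod R M"
  unfolding noetherian_rmod_def
proof (intro allI impI)
  fix K assume K: "\<forall>n. rsubmodule R M (K n)" "\<forall>n. K n \<subseteq> K (Suc n)"
  have "\<forall>n. rsubmodule R' M' (\<phi> (K n))" "\<forall>n. \<phi> (K n) \<subseteq> \<phi> (K (Suc n))"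
    using K sub mono by auto
  then obtain m where m: "\<And>n. n \<ge> m \<Longrightarrow> \<phi> (K n) = \<phi> (K m)"
    using M' unfolding noetherian_rmod_def by meson
  have mn: "K m \<subseteq> K n" if "n \<ge> m" for n using K(2) that by (metis lift_Suc_mono_le)
  have "K n = K m" if "n \<ge> m" for n
    using inj[of "K m" "K n"] K(1) mn[OF that] m[OF that] by auto
  then show "\<exists>m. \<forall>n\<ge>m. K n = K m" by blast
qed

lemma regular_bimodule: "ring T \<Longrightarrow> bimodule T (regular_bimod T)"
  by (rule ring_bimod_bimodule) (auto simp: ring_hom_def)

lemma ring_bimod_simps [simp]:
  "carrier (ring_bimod R i) = carrier R" "\<zero>\<^bsub>ring_bimod R i\<^esub> = \<zero>\<^bsub>R\<^esub>"
  "x \<oplus>\<^bsub>ring_bimod R i\<^esub> y = x \<oplus>\<^bsub>R\<^esub> y" "x \<triangleleft>\<^bsub>ring_bimod R i\<^esub> a = x \<otimes>\<^bsub>R\<^esub> i a"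
  "a \<triangleright>\<^bsub>ring_bimod R i\<^esub> x = i a \<otimes>\<^bsub>R\<^esub> x"
  by (simp_all add: ring_bimod_def)

lemma char_rmod_simps [simp]:
  "carrier (char_rmod A R i \<chi>) = carrier A" "\<zero>\<^bsub>char_rmod A R i \<chi>\<^esub> = \<zero>\<^bsub>A\<^esub>"
  "x \<oplus>\<^bsub>char_rmod A R i \<chi>\<^esub> y = x \<oplus>\<^bsub>A\<^esub> y" "x \<triangleleft>\<^bsub>char_rmod A R i \<chi>\<^esub> r = \<chi> (i x \<otimes>\<^bsub>R\<^esub> r)"
  by (simp_all add: char_rmod_def)

lemma right_ideal_iff: "right_ideal T K \<longleftrightarrow> rsubmodule T (regular_bimod T) K"
  by (simp add: right_ideal_def rsubmodule_def additive_subgroup_def subgroup_def m_inv_def)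

lemma right_noetherian_iff: "right_noetherian T \<longleftrightarrow> noetherian_rmod T (regular_bimod T)"
  by (simp add: right_noetherian_def noetherian_rmod_def right_ideal_iff)

lemma (in ring) right_idealI:
  assumes "K \<subseteq> carrier R" "\<zero> \<in> K" "\<And>x y. \<lbrakk>x \<in> K; y \<in> K\<rbrakk> \<Longrightarrow> x \<oplus> y \<in> K"
    "\<And>x r. \<lbrakk>x \<in> K; r \<in> carrier R\<rbrakk> \<Longrightarrow> x \<otimes> r \<in> K"
  shows "right_ideal R K"
proof -
  interpret bimodule R "regular_bimod R" by (rule regular_bimodule) (rule ring_axioms)
  show ?thesis unfolding right_ideal_iff using assms by (intro rsubmoduleI) auto
qed

lemma right_ideal_subset: "right_ideal T K \<Longrightarrow> K \<subseteq> carrier T"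
  and right_ideal_zero: "right_ideal T K \<Longrightarrow> \<zero>\<^bsub>T\<^esub> \<in> K"
  and right_ideal_add: "\<lbrakk>right_ideal T K; x \<in> K; y \<in> K\<rbrakk> \<Longrightarrow> x \<oplus>\<^bsub>T\<^esub> y \<in> K"
  and right_ideal_mult: "\<lbrakk>right_ideal T K; x \<in> K; r \<in> carrier T\<rbrakk> \<Longrightarrow> x \<otimes>\<^bsub>T\<^esub> r \<in> K"
  by (auto simp: right_ideal_def additive_subgroup.zero_closed additive_subgroup.a_closed
      dest: additive_subgroup.a_Hcarr)

lemma ideal_right_ideal: "ideal P T \<Longrightarrow> right_ideal T P"
  by (auto simp: right_ideal_def ideal_def ideal_axioms_def)

lemma (in ring) idealI_right:
  assumes "right_ideal R J" "\<And>x r. \<lbrakk>x \<in> J; r \<in> carrier R\<rbrakk> \<Longrightarrow> r \<otimes> x \<in> J"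
  shows "ideal J R"
  using assms right_ideal_mult[OF assms(1)]
  by (intro idealI ring_axioms) (auto simp: right_ideal_def additive_subgroup_def)

context right_module
begin

lemma rsubmodule_cyclic:
  assumes "right_ideal R L" "x \<in> carrier M"
  shows "rsubmodule R M ((\<lambda>r. x \<triangleleft>\<^bsub>M\<^esub> r) ` L)"
proof -
  interpret reg: bimodule R "regular_bimod R" by (rule regular_bimodule) (rule R.ring_axioms)
  show ?thesis
    using assms
    by (intro rsubmodule_image[OF reg.right_module_axioms right_module_axioms])
      (auto simp: right_ideal_iff rmod_hom_def rsmult_add_right rsmult_assoc)
qed

lemma right_ideal_colon:
  assumes "rsubmodule R M V" "x \<in> carrier M"
  shows "right_ideal R {r \<in> carrier R. x \<triangleleft>\<^bsub>M\<^esub> r \<in> V}"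
proof -
  interpret reg: bimodule R "regular_bimod R" by (rule regular_bimodule) (rule R.ring_axioms)
  have "rsubmodule R (regular_bimod R) {r \<in> carrier (regular_bimod R). x \<triangleleft>\<^bsub>M\<^esub> r \<in> V}"
    using assms by (intro rsubmodule_vimage[OF reg.right_module_axioms right_module_axioms])
      (auto simp: rmod_hom_def rsmult_add_right rsmult_assoc)
  then show ?thesis by (simp add: right_ideal_iff)
qed

lemma right_ideal_annihilator:
  assumes "rsubmodule R M V" "W \<subseteq> carrier M"
  shows "right_ideal R {r \<in> carrier R. \<forall>w\<in>W. w \<triangleleft>\<^bsub>M\<^esub> r \<in> V}"
  using assms(2) rsubmodule_zero[OF assms(1)] rsubmodule_add[OF assms(1)] rsubmodule_rsmult[OF assms(1)]
  by (intro R.right_idealI) (auto simp: subset_iff rsmult_add_right rsmult_assoc[symmetric])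

text \<open>These are the \<open>r\<close> that kill \<open>(W + V) / V\<close>. Left multiples stay
  in the set because \<open>W\<close> is stable under the action.\<close>

lemma ideal_annihilator:
  assumes V: "rsubmodule R M V" and W: "rsubmodule R M W"
  shows "ideal {r \<in> carrier R. \<forall>w\<in>W. w \<triangleleft>\<^bsub>M\<^esub> r \<in> V} R"
  using rsubmodule_subset[OF W] rsubmodule_rsmult[OF W]
  by (intro R.idealI_right right_ideal_annihilator[OF V]) (auto simp: subset_iff rsmult_assoc[symmetric])

text \<open>Built one generator at a time, so that inductions over generators can peel off the
  head.\<close>

fun list_span :: "'m list \<Rightarrow> 'm set"
  where "list_span [] = {\<zero>\<^bsub>M\<^esub>}"
  | "list_span (x # xs) = (\<lambda>r. x \<triangleleft>\<^bsub>M\<^esub> r) ` carrier R <+>\<^bsub>M\<^esub> list_span xs"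

lemma rsubmodule_orbit: "x \<in> carrier M \<Longrightarrow> rsubmodule R M ((\<lambda>r. x \<triangleleft>\<^bsub>M\<^esub> r) ` carrier R)"
  by (intro rsubmodule_cyclic R.right_idealI) auto

lemma rsubmodule_list_span: "set xs \<subseteq> carrier M \<Longrightarrow> rsubmodule R M (list_span xs)"
proof (induction xs)
  case Nil show ?case by (rule rsubmoduleI) auto
next
  case (Cons x xs) then show ?case by (auto intro: rsubmodule_plus rsubmodule_orbit)
qed

lemma list_span_superset: "set xs \<subseteq> carrier M \<Longrightarrow> set xs \<subseteq> list_span xs"
proof (induction xs)
  case (Cons x xs)
  then have x: "x \<in> carrier M" and xs: "set xs \<subseteq> carrier M" by auto
  have "x \<in> (\<lambda>r. x \<triangleleft>\<^bsub>M\<^esub> r) ` carrier R" using x by (intro image_eqI[of _ _ "\<one>\<^bsub>R\<^esub>"]) auto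
  then show ?case
    using plus_upper[OF rsubmodule_orbit[OF x] rsubmodule_list_span[OF xs]] Cons.IH[OF xs] by auto
qed simp

text \<open>Two shadows of the chain control it: its intersection with the span of the tail, and the
  right ideal of those \<open>r\<close> for which \<open>x r\<close> lies in \<open>K n\<close>
  modulo that span. When both are stationary, so is the chain.\<close>

lemma noetherian_list_span:
  fixes K :: "nat \<Rightarrow> 'm set"
  assumes R: "right_noetherian R" and "set xs \<subseteq> carrier M"
    and "\<And>n. rsubmodule R M (K n)" "\<And>n. K n \<subseteq> K (Suc n)" "\<And>n. K n \<subseteq> list_span xs"
  shows "\<exists>m. \<forall>n\<ge>m. K n = K m"
  using assms(2-)
proof (induction xs arbitrary: K)
  case Nil
  then have "K n = {\<zero>\<^bsub>M\<^esub>}" for n using rsubmodule_zero[OF Nil.prems(2), of n] by fastforce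
  then show ?case by simp
next
  case (Cons x xs)
  let ?S = "list_span xs" and ?L = "\<lambda>n. {r \<in> carrier R. x \<triangleleft>\<^bsub>M\<^esub> r \<in> K n <+>\<^bsub>M\<^esub> list_span xs}"
  have x: "x \<in> carrier M" and S: "rsubmodule R M ?S"
    using Cons.prems(1) by (auto intro: rsubmodule_list_span)
  have sub: "K n \<subseteq> carrier M" for n using Cons.prems(2) rsubmodule_subset by blast
  have "\<exists>m. \<forall>n\<ge>m. K n \<inter> ?S = K m \<inter> ?S"
    using Cons.prems by (intro Cons.IH) (auto intro: rsubmodule_Int S)
  then obtain m1 where m1: "\<And>n. n \<ge> m1 \<Longrightarrow> K n \<inter> ?S = K m1 \<inter> ?S" by blast
  have "\<forall>n. right_ideal R (?L n)" using Cons.prems(2) S x by (auto intro: right_ideal_colon rsubmodule_plus)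
  moreover have "\<forall>n. ?L n \<subseteq> ?L (Suc n)" using Cons.prems(3) by (auto simp: set_add_def')
  ultimately obtain m2 where m2: "\<And>n. n \<ge> m2 \<Longrightarrow> ?L n = ?L m2"
    using R unfolding right_noetherian_def by meson
  have "K n = K (max m1 m2)" if n: "n \<ge> max m1 m2" for n
  proof
    let ?m = "max m1 m2"
    have mn: "K ?m \<subseteq> K n" using Cons.prems(3) n by (metis lift_Suc_mono_le)
    show "K ?m \<subseteq> K n" by fact
    show "K n \<subseteq> K ?m"
    proof
      fix y assume y: "y \<in> K n"
      then obtain r s where rs: "r \<in> carrier R" "s \<in> ?S" "y = x \<triangleleft>\<^bsub>M\<^esub> r \<oplus>\<^bsub>M\<^esub> s"
        using Cons.prems(4)[of n] by (auto simp: set_add_def')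
      have s: "s \<in> carrier M" "\<ominus>\<^bsub>M\<^esub> s \<in> ?S" using rs S rsubmodule_subset rsubmodule_minus by blast+
      have "x \<triangleleft>\<^bsub>M\<^esub> r = y \<oplus>\<^bsub>M\<^esub> \<ominus>\<^bsub>M\<^esub> s" unfolding rs(3) using rs(1) s x by (simp add: M.a_assoc M.r_neg)
      then have "r \<in> ?L n" using y s rs(1) by (auto simp: set_add_def')
      moreover have "?L n = ?L ?m" using m2[of n] m2[of ?m] n by simp
      ultimately have "r \<in> ?L ?m" by (simp only:)
      then have "x \<triangleleft>\<^bsub>M\<^esub> r \<in> K ?m <+>\<^bsub>M\<^esub> ?S" by blast
      then obtain k s' where k: "k \<in> K ?m" "s' \<in> ?S" "x \<triangleleft>\<^bsub>M\<^esub> r = k \<oplus>\<^bsub>M\<^esub> s'"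
        unfolding set_add_def' by blast
      have kc: "k \<in> carrier M" "s' \<in> carrier M" using k sub S rsubmodule_subset by blast+
      \<comment> \<open>Replacing \<open>x r\<close> by \<open>k\<close> in \<open>K ?m\<close>
        leaves a remainder in the span of the tail that also lies in \<open>K n\<close>; there the
        first shadow is already stationary.\<close>
      have yk: "y = k \<oplus>\<^bsub>M\<^esub> (s' \<oplus>\<^bsub>M\<^esub> s)" unfolding rs(3) k(3) using kc s by (simp add: M.a_assoc)
      have "s' \<oplus>\<^bsub>M\<^esub> s \<in> ?S" using rsubmodule_add[OF S k(2) rs(2)] .
      moreover have "s' \<oplus>\<^bsub>M\<^esub> s \<in> K n"
        using rsubmodule_add_cancel[OF Cons.prems(2) subsetD[OF mn k(1)]] y kc(2) s(1)
        unfolding yk by blast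
      moreover have "K n \<inter> ?S = K ?m \<inter> ?S"
        using m1[of n] m1[of ?m] n by (metis max.boundedE max.cobounded1)
      ultimately have "s' \<oplus>\<^bsub>M\<^esub> s \<in> K ?m" by blast
      then show "y \<in> K ?m" unfolding yk using k(1) rsubmodule_add[OF Cons.prems(2)] by blast
    qed
  qed
  then show ?case by blast
qed

lemma noetherian_finitely_generated:
  assumes "right_noetherian R" "rmod_finitely_generated R M"
  shows "noetherian_rmod R M"
  unfolding noetherian_rmod_def
proof (intro allI impI)
  fix K assume K: "\<forall>n. rsubmodule R M (K n)" "\<forall>n. K n \<subseteq> K (Suc n)"
  obtain S where S: "finite S" "S \<subseteq> carrier M" "carrier M = \<Inter>{N. rsubmodule R M N \<and> S \<subseteq> N}"
    using assms(2) unfolding rmod_finitely_generated_def by blast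
  obtain xs where xs: "set xs = S" using S(1) finite_list by blast
  have "carrier M \<subseteq> list_span xs"
    using S(3) rsubmodule_list_span[of xs] list_span_superset[of xs] S(2) xs by blast
  then show "\<exists>m. \<forall>n\<ge>m. K n = K m"
    using K S(2) xs rsubmodule_subset by (intro noetherian_list_span[of xs] assms(1)) blast+
qed

lemma rmod_finitely_generatedI:
  assumes "finite S" "S \<subseteq> carrier M" "\<And>N. \<lbrakk>rsubmodule R M N; S \<subseteq> N\<rbrakk> \<Longrightarrow> carrier M \<subseteq> N"
  shows "rmod_finitely_generated R M"
  unfolding rmod_finitely_generated_def
  using assms rsubmodule_carrier by (intro exI[of _ S]) blast

end


section \<open>Fully bounded rings\<close>

text \<open>Essentiality of \<open>K / P\<close> in \<open>T / P\<close>, pulled back to right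
  ideals of \<open>T\<close> that contain \<open>P\<close>; the arguments about bounded factor rings
  then avoid cosets.\<close>

definition essential_modulo :: "('r, 'x) ring_scheme \<Rightarrow> 'r set \<Rightarrow> 'r set \<Rightarrow> bool"
  where "essential_modulo T P K \<longleftrightarrow> right_ideal T K \<and> P \<subseteq> K \<and>
    (\<forall>L. right_ideal T L \<longrightarrow> P \<subseteq> L \<longrightarrow> K \<inter> L \<subseteq> P \<longrightarrow> L \<subseteq> P)"

context ideal
begin

abbreviation "coset_of \<equiv> (+>) I"

lemma coset_of_eq_iff: "x \<in> carrier R \<Longrightarrow> coset_of x = I \<longleftrightarrow> x \<in> I"
  using rcos_const_imp_mem a_rcos_const by blast

lemma quot_simps:
  "carrier (R Quot I) = coset_of ` carrier R" "\<zero>\<^bsub>R Quot I\<^esub> = I"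
  "\<lbrakk>x \<in> carrier R; y \<in> carrier R\<rbrakk> \<Longrightarrow> coset_of x \<oplus>\<^bsub>R Quot I\<^esub> coset_of y = coset_of (x \<oplus> y)"
  "\<lbrakk>x \<in> carrier R; y \<in> carrier R\<rbrakk> \<Longrightarrow> coset_of x \<otimes>\<^bsub>R Quot I\<^esub> coset_of y = coset_of (x \<otimes> y)"
  using ring_hom_add[OF rcos_ring_hom] ring_hom_mult[OF rcos_ring_hom]
  by (auto simp: FactRing_def A_RCOSETS_def')

lemma right_ideal_coset_image:
  assumes "right_ideal R K"
  shows "right_ideal (R Quot I) (coset_of ` K)"
proof (rule ring.right_idealI[OF quotient_is_ring])
  note K = right_ideal_subset[OF assms] right_ideal_zero[OF assms] right_ideal_add[OF assms]
    right_ideal_mult[OF assms]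
  show "coset_of ` K \<subseteq> carrier (R Quot I)" using K by (auto simp: quot_simps)
  show "\<zero>\<^bsub>R Quot I\<^esub> \<in> coset_of ` K"
    using K(2) coset_of_eq_iff[of \<zero>] by (auto simp: quot_simps intro!: image_eqI[of _ _ \<zero>])
  show "x \<oplus>\<^bsub>R Quot I\<^esub> y \<in> coset_of ` K" if "x \<in> coset_of ` K" "y \<in> coset_of ` K" for x y
    using that K by (auto simp: quot_simps subset_iff)
  show "x \<otimes>\<^bsub>R Quot I\<^esub> y \<in> coset_of ` K" if "x \<in> coset_of ` K" "y \<in> carrier (R Quot I)" for x y
    using that K by (auto simp: quot_simps subset_iff)
qed

lemma right_ideal_coset_vimage:
  assumes "right_ideal (R Quot I) K"
  shows "right_ideal R {x \<in> carrier R. coset_of x \<in> K}"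
proof (rule right_idealI)
  note K = right_ideal_zero[OF assms] right_ideal_add[OF assms] right_ideal_mult[OF assms]
  show "\<zero> \<in> {x \<in> carrier R. coset_of x \<in> K}" using K(1) coset_of_eq_iff[of \<zero>] by (simp add: quot_simps)
  show "x \<oplus> y \<in> {x \<in> carrier R. coset_of x \<in> K}"
    if "x \<in> {x \<in> carrier R. coset_of x \<in> K}" "y \<in> {x \<in> carrier R. coset_of x \<in> K}" for x y
    using that K(2)[of "coset_of x" "coset_of y"] by (simp add: quot_simps)
  show "x \<otimes> r \<in> {x \<in> carrier R. coset_of x \<in> K}"
    if "x \<in> {x \<in> carrier R. coset_of x \<in> K}" "r \<in> carrier R" for x r
    using that K(3)[of "coset_of x" "coset_of r"] by (simp add: quot_simps)
qed auto

lemma subset_coset_vimage: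
  assumes "right_ideal (R Quot I) K"
  shows "I \<subseteq> {x \<in> carrier R. coset_of x \<in> K}"
proof
  fix x assume "x \<in> I"
  then have "x \<in> carrier R" using a_subset by blast
  then have "coset_of x = I" using coset_of_eq_iff \<open>x \<in> I\<close> by blast
  then show "x \<in> {x \<in> carrier R. coset_of x \<in> K}"
    using right_ideal_zero[OF assms] \<open>x \<in> carrier R\<close> by (simp add: quot_simps)
qed

lemma coset_vimage_nontrivial:
  assumes "right_ideal (R Quot I) K" "K \<noteq> {I}"
  shows "\<not> {x \<in> carrier R. coset_of x \<in> K} \<subseteq> I"
proof
  assume sub: "{x \<in> carrier R. coset_of x \<in> K} \<subseteq> I"
  have "X = I" if X: "X \<in> K" for X
  proof -
    obtain x where x: "x \<in> carrier R" "X = coset_of x"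
      using X right_ideal_subset[OF assms(1)] unfolding quot_simps by blast
    then show ?thesis using X sub coset_of_eq_iff by blast
  qed
  moreover have "I \<in> K" using right_ideal_zero[OF assms(1)] unfolding quot_simps .
  ultimately show False using assms(2) by blast
qed

lemma coset_of_image_iff:
  assumes "right_ideal R K" "I \<subseteq> K" "x \<in> carrier R"
  shows "coset_of x \<in> coset_of ` K \<longleftrightarrow> x \<in> K"
proof
  assume "coset_of x \<in> coset_of ` K"
  then obtain y where y: "y \<in> K" "coset_of x = coset_of y" by blast
  have yc: "y \<in> carrier R" using y right_ideal_subset[OF assms(1)] by blast
  have "x \<in> I +> y" using y a_rcos_self[OF assms(3)] by simp
  then have "x \<ominus> y \<in> I" using yc assms(3) a_rcos_module_minus[OF ring_axioms] by blast
  then have "(x \<ominus> y) \<oplus> y \<in> K" using assms(2) right_ideal_add[OF assms(1)] y(1) by blast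
  then show "x \<in> K" using assms(3) yc by (simp add: a_minus_def a_assoc l_neg)
qed simp

text \<open>Right ideals of the quotient correspond to right ideals containing \<open>I\<close>, by
  image and preimage under \<open>coset_of\<close>. Each direction moves an essential right ideal
  across and a two-sided ideal back.\<close>

lemma right_bounded_quotient_iff:
  "right_bounded (R Quot I) \<longleftrightarrow>
    (\<forall>K. essential_modulo R I K \<longrightarrow> (\<exists>J. ideal J R \<and> I \<subseteq> J \<and> \<not> J \<subseteq> I \<and> J \<subseteq> K))"
proof
  assume bd: "right_bounded (R Quot I)"
  show "\<forall>K. essential_modulo R I K \<longrightarrow> (\<exists>J. ideal J R \<and> I \<subseteq> J \<and> \<not> J \<subseteq> I \<and> J \<subseteq> K)"
  proof (intro allI impI)
    fix K assume K: "essential_modulo R I K"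
    then have Kr: "right_ideal R K" and IK: "I \<subseteq> K" by (auto simp: essential_modulo_def)
    have "essential_right_ideal (R Quot I) (coset_of ` K)"
      unfolding essential_right_ideal_def
    proof (intro conjI allI impI right_ideal_coset_image Kr)
      fix L assume L: "right_ideal (R Quot I) L" "L \<noteq> {\<zero>\<^bsub>R Quot I\<^esub>}"
      let ?L = "{x \<in> carrier R. coset_of x \<in> L}"
      have Lr: "right_ideal R ?L" by (rule right_ideal_coset_vimage[OF L(1)])
      have IL: "I \<subseteq> ?L" by (rule subset_coset_vimage[OF L(1)])
      have "\<not> ?L \<subseteq> I"
        using L(2) by (intro coset_vimage_nontrivial[OF L(1)]) (simp add: quot_simps)
      then obtain x where x: "x \<in> K" "x \<in> ?L" "x \<notin> I"
        using K Lr IL unfolding essential_modulo_def by blast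
      then have "coset_of x \<in> coset_of ` K \<inter> L" "coset_of x \<noteq> I" using coset_of_eq_iff by auto
      then show "coset_of ` K \<inter> L \<noteq> {\<zero>\<^bsub>R Quot I\<^esub>}" by (auto simp: quot_simps)
    qed
    then obtain J where J: "ideal J (R Quot I)" "J \<noteq> {\<zero>\<^bsub>R Quot I\<^esub>}" "J \<subseteq> coset_of ` K"
      using bd unfolding right_bounded_def by blast
    let ?J = "{x \<in> carrier R. coset_of x \<in> J}"
    have Jr: "right_ideal (R Quot I) J" using J(1) by (rule ideal_right_ideal)
    have "ideal ?J R" using ring_hom_ring.ideal_vimage[OF rcos_ring_hom_ring J(1)] .
    moreover have "I \<subseteq> ?J" by (rule subset_coset_vimage[OF Jr])
    moreover have "\<not> ?J \<subseteq> I"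
      using J(2) by (intro coset_vimage_nontrivial[OF Jr]) (simp add: quot_simps)
    moreover have "?J \<subseteq> K" using J(3) coset_of_image_iff[OF Kr IK] by auto
    ultimately show "\<exists>J. ideal J R \<and> I \<subseteq> J \<and> \<not> J \<subseteq> I \<and> J \<subseteq> K" by blast
  qed
next
  assume bd: "\<forall>K. essential_modulo R I K \<longrightarrow> (\<exists>J. ideal J R \<and> I \<subseteq> J \<and> \<not> J \<subseteq> I \<and> J \<subseteq> K)"
  show "right_bounded (R Quot I)"
    unfolding right_bounded_def
  proof (intro allI impI)
    fix K assume K: "essential_right_ideal (R Quot I) K"
    then have Kr: "right_ideal (R Quot I) K" by (auto simp: essential_right_ideal_def)
    let ?K = "{x \<in> carrier R. coset_of x \<in> K}"
    have ess: "essential_modulo R I ?K"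
      unfolding essential_modulo_def
    proof (intro conjI allI impI right_ideal_coset_vimage Kr)
      show "I \<subseteq> ?K" by (rule subset_coset_vimage[OF Kr])
      fix L assume L: "right_ideal R L" "I \<subseteq> L" "?K \<inter> L \<subseteq> I"
      have Lc: "L \<subseteq> carrier R" by (rule right_ideal_subset[OF L(1)])
      have Lq: "right_ideal (R Quot I) (coset_of ` L)" by (rule right_ideal_coset_image[OF L(1)])
      have "K \<inter> coset_of ` L \<subseteq> {\<zero>\<^bsub>R Quot I\<^esub>}"
      proof
        fix X assume "X \<in> K \<inter> coset_of ` L"
        then obtain x where x: "x \<in> L" "X = coset_of x" "coset_of x \<in> K" by blast
        then have "x \<in> I" using L(3) Lc by blast
        then show "X \<in> {\<zero>\<^bsub>R Quot I\<^esub>}" using x Lc coset_of_eq_iff by (auto simp: quot_simps)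
      qed
      then have "K \<inter> coset_of ` L = {\<zero>\<^bsub>R Quot I\<^esub>}"
        using right_ideal_zero[OF Kr] right_ideal_zero[OF Lq] by blast
      then have "coset_of ` L = {I}" using K Lq unfolding essential_right_ideal_def by (auto simp: quot_simps)
      then have "coset_of x = I" if "x \<in> L" for x using that by blast
      then show "L \<subseteq> I" using Lc coset_of_eq_iff by (meson subset_iff)
    qed
    obtain J where J: "ideal J R" "I \<subseteq> J" "\<not> J \<subseteq> I" "J \<subseteq> ?K"
      using bd[rule_format, OF ess] by (elim exE conjE)
    have Jc: "J \<subseteq> carrier R" using J(1) ideal_right_ideal right_ideal_subset by blast
    have "ideal (coset_of ` J) (R Quot I)"
      using ring_ideal_imp_quot_ideal[OF is_ideal J(1)] .
    moreover have "coset_of ` J \<noteq> {\<zero>\<^bsub>R Quot I\<^esub>}"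
    proof -
      obtain x where x: "x \<in> J" "x \<notin> I" using J(3) by blast
      then have "coset_of x \<noteq> I" using Jc coset_of_eq_iff by blast
      then show ?thesis unfolding quot_simps using x(1) by blast
    qed
    moreover have "coset_of ` J \<subseteq> K" using J(4) by auto
    ultimately show "\<exists>J. ideal J (R Quot I) \<and> J \<noteq> {\<zero>\<^bsub>R Quot I\<^esub>} \<and> J \<subseteq> K" by blast
  qed
qed

end

section \<open>Cauchon's finiteness property over right FBN rings\<close>

text \<open>Among the submodules strictly above \<open>V\<close>, \<open>W\<close> is one whose
  annihilator \<open>P\<close> modulo \<open>V\<close> is maximal. Such a \<open>P\<close> is prime,
  and boundedness of \<open>R / P\<close> prevents the annihilator of a single \<open>w\<close>
  outside \<open>V\<close> from being essential modulo \<open>P\<close>. The right ideal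
  \<open>L\<close> witnesses this, so \<open>W / V\<close> is nonsingular over
  \<open>R / P\<close>.\<close>

lemma (in right_module) prime_section:
  assumes FBN: "right_FBN R" and V: "rsubmodule R M V" and "V \<noteq> carrier M"
  obtains W P where "rsubmodule R M W" "V \<subset> W" "\<forall>w\<in>W. \<forall>p\<in>P. w \<triangleleft>\<^bsub>M\<^esub> p \<in> V"
    and "\<forall>w\<in>W - V.
      \<exists>L. right_ideal R L \<and> \<not> L \<subseteq> P \<and> (\<forall>l\<in>L. w \<triangleleft>\<^bsub>M\<^esub> l \<in> V \<longrightarrow> l \<in> P)"
proof -
  let ?ann = "\<lambda>W. {r \<in> carrier R. \<forall>w\<in>W. w \<triangleleft>\<^bsub>M\<^esub> r \<in> V}"
  let ?\<S> = "?ann ` {W. rsubmodule R M W \<and> V \<subset> W}"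
  have noeth: "noetherian_rmod R (regular_bimod R)"
    using FBN by (simp add: right_FBN_def right_noetherian_iff)
  have "V \<subset> carrier M" using V rsubmodule_subset assms(3) by blast
  then have "?\<S> \<noteq> {}" using rsubmodule_carrier by blast
  moreover have "rsubmodule R (regular_bimod R) K" if "K \<in> ?\<S>" for K
    using that right_ideal_annihilator[OF V] rsubmodule_subset unfolding right_ideal_iff[symmetric] by blast
  ultimately have "\<exists>P\<in>?\<S>. \<forall>K\<in>?\<S>. P \<subseteq> K \<longrightarrow> K = P"
    by (rule noetherian_maximal[OF noeth])
  then obtain P where "P \<in> ?\<S>" and max: "\<forall>K\<in>?\<S>. P \<subseteq> K \<longrightarrow> K = P"
    by (rule bexE)
  from \<open>P \<in> ?\<S>\<close> obtain W where W: "rsubmodule R M W" "V \<subset> W" and P: "P = ?ann W" by blast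
  note Wsub = rsubmodule_subset[OF W(1)]
  have P_ideal: "ideal P R" unfolding P by (rule ideal_annihilator[OF V W(1)])
  \<comment> \<open>The elements of \<open>W\<close> that \<open>J\<close> sends into
    \<open>V\<close> form a submodule strictly above \<open>V\<close>. Its annihilator contains
    \<open>P\<close>, equals \<open>P\<close> by maximality, and contains \<open>J\<close>.\<close>
  have absorb: "J \<subseteq> P" if J: "ideal J R" and w: "w \<in> W" "w \<notin> V" "\<And>j. j \<in> J \<Longrightarrow> w \<triangleleft>\<^bsub>M\<^esub> j \<in> V" for J w
  proof -
    interpret J: ideal J R by fact
    let ?W = "{x \<in> W. \<forall>j\<in>J. x \<triangleleft>\<^bsub>M\<^esub> j \<in> V}"
    have Jc: "j \<in> J \<Longrightarrow> j \<in> carrier R" for j by (rule J.a_Hcarr)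
    have "rsubmodule R M ?W"
    proof (rule rsubmoduleI)
      show "?W \<subseteq> carrier M" using Wsub by auto
      show "\<zero>\<^bsub>M\<^esub> \<in> ?W" using rsubmodule_zero[OF W(1)] rsubmodule_zero[OF V] Jc by auto
      show "x \<oplus>\<^bsub>M\<^esub> y \<in> ?W" if "x \<in> ?W" "y \<in> ?W" for x y
        using that Wsub rsubmodule_add[OF W(1)] rsubmodule_add[OF V] Jc
        by (auto simp: rsmult_add_left subset_iff)
      show "x \<triangleleft>\<^bsub>M\<^esub> r \<in> ?W" if "x \<in> ?W" "r \<in> carrier R" for x r
        using that Wsub rsubmodule_rsmult[OF W(1)] Jc J.I_l_closed
        by (auto simp: rsmult_assoc subset_iff)
    qed
    moreover have "V \<subset> ?W" using W(2) rsubmodule_rsmult[OF V] Jc w by auto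
    ultimately have mem: "?ann ?W \<in> ?\<S>" by (intro imageI CollectI conjI)
    have "P \<subseteq> ?ann ?W" by (auto simp: P)
    then have "?ann ?W = P" by (rule max[THEN bspec, OF mem, THEN mp])
    then show "J \<subseteq> P" using Jc by auto
  qed
  have prime: "two_sided_prime R P"
    unfolding two_sided_prime_def
  proof (intro conjI allI impI P_ideal)
    obtain w where w: "w \<in> W" "w \<notin> V" using W(2) by blast
    have "w \<triangleleft>\<^bsub>M\<^esub> \<one>\<^bsub>R\<^esub> = w" using w(1) Wsub rsmult_one by blast
    then have "\<one>\<^bsub>R\<^esub> \<notin> P" unfolding P using w by force
    then show "P \<noteq> carrier R" using R.one_closed by blast
    fix I J assume I: "ideal I R" and J: "ideal J R" and IJ: "\<forall>x\<in>I. \<forall>y\<in>J. x \<otimes>\<^bsub>R\<^esub> y \<in> P"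
    interpret I: ideal I R by fact
    interpret J: ideal J R by fact
    show "I \<subseteq> P \<or> J \<subseteq> P"
    proof (rule disjCI)
      assume "\<not> J \<subseteq> P"
      show "I \<subseteq> P"
      proof (rule ccontr)
        \<comment> \<open>Some \<open>w i\<close> lies outside \<open>V\<close> but is sent into
          \<open>V\<close> by all of \<open>J\<close>, so \<open>absorb\<close> puts
          \<open>J\<close> into \<open>P\<close>.\<close>
        assume "\<not> I \<subseteq> P"
        then obtain i w where iw: "i \<in> I" "w \<in> W" "w \<triangleleft>\<^bsub>M\<^esub> i \<notin> V" unfolding P by auto
        have "w \<triangleleft>\<^bsub>M\<^esub> i \<triangleleft>\<^bsub>M\<^esub> j \<in> V" if "j \<in> J" for j
          using iw that IJ Wsub unfolding P by (auto simp: rsmult_assoc subset_iff)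
        moreover have "w \<triangleleft>\<^bsub>M\<^esub> i \<in> W" using iw rsubmodule_rsmult[OF W(1)] by auto
        ultimately have "J \<subseteq> P" using absorb[OF J _ iw(3)] by blast
        then show False using \<open>\<not> J \<subseteq> P\<close> by blast
      qed
    qed
  qed
  have "right_bounded (R Quot P)"
    using FBN prime unfolding right_FBN_def right_fully_bounded_def by blast
  then have bounded: "\<And>K. essential_modulo R P K \<Longrightarrow> \<exists>J. ideal J R \<and> P \<subseteq> J \<and> \<not> J \<subseteq> P \<and> J \<subseteq> K"
    using ideal.right_bounded_quotient_iff[OF P_ideal] by blast
  show thesis
  proof (rule that[OF W])
    show "\<forall>w\<in>W. \<forall>p\<in>P. w \<triangleleft>\<^bsub>M\<^esub> p \<in> V" by (simp add: P)
    show "\<forall>w\<in>W - V. \<exists>L. right_ideal R L \<and> \<not> L \<subseteq> P \<and> (\<forall>l\<in>L. w \<triangleleft>\<^bsub>M\<^esub> l \<in> V \<longrightarrow> l \<in> P)"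
    proof
      fix w assume "w \<in> W - V"
      then have w: "w \<in> W" "w \<notin> V" by auto
      let ?K = "{r \<in> carrier R. w \<triangleleft>\<^bsub>M\<^esub> r \<in> V}"
      \<comment> \<open>Otherwise boundedness of \<open>R / P\<close> yields a two-sided ideal not
        inside \<open>P\<close> that sends \<open>w\<close> into \<open>V\<close>, against
        \<open>absorb\<close>.\<close>
      have "\<not> essential_modulo R P ?K"
      proof
        assume "essential_modulo R P ?K"
        then obtain J where J: "ideal J R" "\<not> J \<subseteq> P" "J \<subseteq> ?K" using bounded by meson
        then show False using absorb[OF J(1) w] by blast
      qed
      moreover have "right_ideal R ?K" using w Wsub by (intro right_ideal_colon[OF V]) auto
      moreover have "P \<subseteq> ?K" using w by (auto simp: P)
      ultimately obtain L where L: "right_ideal R L" "?K \<inter> L \<subseteq> P" "\<not> L \<subseteq> P"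
        unfolding essential_modulo_def by blast
      have "\<forall>l\<in>L. w \<triangleleft>\<^bsub>M\<^esub> l \<in> V \<longrightarrow> l \<in> P" using L(2) right_ideal_subset[OF L(1)] by blast
      then show "\<exists>L. right_ideal R L \<and> \<not> L \<subseteq> P \<and> (\<forall>l\<in>L. w \<triangleleft>\<^bsub>M\<^esub> l \<in> V \<longrightarrow> l \<in> P)"
        using L by blast
    qed
  qed
qed

lemma rmod_homD:
  assumes "h \<in> rmod_hom R M N"
  shows "x \<in> carrier M \<Longrightarrow> h x \<in> carrier N"
    "\<lbrakk>x \<in> carrier M; y \<in> carrier M\<rbrakk> \<Longrightarrow> h (x \<oplus>\<^bsub>M\<^esub> y) = h x \<oplus>\<^bsub>N\<^esub> h y"
    "\<lbrakk>x \<in> carrier M; r \<in> carrier R\<rbrakk> \<Longrightarrow> h (x \<triangleleft>\<^bsub>M\<^esub> r) = h x \<triangleleft>\<^bsub>N\<^esub> r"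
  using assms by (auto simp: rmod_hom_def)

text \<open>\<open>S\<close> is maximal among the submodules of \<open>N'\<close> on which finitely
  many maps suffice. A point \<open>y\<close> and a map \<open>f\<close> that refute
  \<open>F\<close> on \<open>N'\<close> allow \<open>S\<close> to be enlarged by \<open>y L\<close>,
  with \<open>L\<close> the right ideal attached to \<open>f y\<close>, at the price of one more
  map. Maximality puts \<open>y L\<close> into \<open>S\<close>, and then
  \<open>L \<subseteq> P\<close>, which is impossible.\<close>

lemma finite_detection_prime_section:
  assumes N: "right_module R N" "noetherian_rmod R N" and M: "right_module R M"
    and N': "rsubmodule R N N'" and V: "rsubmodule R M V"
    and W: "W \<subseteq> carrier M" "\<forall>w\<in>W. \<forall>p\<in>P. w \<triangleleft>\<^bsub>M\<^esub> p \<in> V"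
      "\<forall>w\<in>W - V.
        \<exists>L. right_ideal R L \<and> \<not> L \<subseteq> P \<and> (\<forall>l\<in>L. w \<triangleleft>\<^bsub>M\<^esub> l \<in> V \<longrightarrow> l \<in> P)"
    and X: "X \<subseteq> rmod_hom R N M" "\<forall>f\<in>X. \<forall>n\<in>N'. f n \<in> W"
  shows "\<exists>F\<subseteq>X. finite F \<and> (\<forall>n\<in>N'. (\<forall>f\<in>F. f n \<in> V) \<longrightarrow> (\<forall>f\<in>X. f n \<in> V))"
proof -
  interpret N: right_module R N by fact
  interpret M: right_module R M by fact
  let ?ker = "\<lambda>F. {n \<in> N'. \<forall>f\<in>F. f n \<in> V}"
  let ?good = "\<lambda>S F. F \<subseteq> X \<and> finite F \<and> S \<inter> ?ker F \<subseteq> ?ker X"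
  let ?\<S> = "{S. rsubmodule R N S \<and> S \<subseteq> N' \<and> (\<exists>F. ?good S F)}"
  note N'_sub = rsubmodule_subset[OF N']
  have "rsubmodule R N (?ker X)" by (rule N.rsubmodule_all_vimage[OF X(1) M V N'])
  then have "?ker X \<in> ?\<S>" by blast
  then have "?\<S> \<noteq> {}" by blast
  moreover have "\<And>S. S \<in> ?\<S> \<Longrightarrow> rsubmodule R N S" by blast
  ultimately have "\<exists>S\<in>?\<S>. \<forall>S'\<in>?\<S>. S \<subseteq> S' \<longrightarrow> S' = S"
    by (rule noetherian_maximal[OF N(2)])
  then obtain S where "S \<in> ?\<S>" and max: "\<forall>S'\<in>?\<S>. S \<subseteq> S' \<longrightarrow> S' = S"
    by (rule bexE)
  from \<open>S \<in> ?\<S>\<close> obtain F where S: "rsubmodule R N S" "S \<subseteq> N'" and F: "F \<subseteq> X" "finite F" "S \<inter> ?ker F \<subseteq> ?ker X"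
    by blast
  have "?ker F \<subseteq> ?ker X"
  proof (rule ccontr)
    assume "\<not> ?ker F \<subseteq> ?ker X"
    then obtain y f where y: "y \<in> N'" "\<And>g. g \<in> F \<Longrightarrow> g y \<in> V" and f: "f \<in> X" "f y \<notin> V" by blast
    have yN: "y \<in> carrier N" using y N'_sub by blast
    obtain L where L: "right_ideal R L" "\<not> L \<subseteq> P" "\<And>l. \<lbrakk>l \<in> L; f y \<triangleleft>\<^bsub>M\<^esub> l \<in> V\<rbrakk> \<Longrightarrow> l \<in> P"
      using W(3) X(2) f y(1) by (metis DiffI)
    note Lc = subsetD[OF right_ideal_subset[OF L(1)]]
    let ?yL = "(\<lambda>l. y \<triangleleft>\<^bsub>N\<^esub> l) ` L"
    have yL: "rsubmodule R N ?yL" by (rule N.rsubmodule_cyclic[OF L(1) yN])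
    let ?S = "S <+>\<^bsub>N\<^esub> ?yL"
    have hom: "g (y \<triangleleft>\<^bsub>N\<^esub> l) = g y \<triangleleft>\<^bsub>M\<^esub> l" if "g \<in> X" "l \<in> L" for g l
      using rmod_homD(3)[of g R N M y l] X(1) that yN Lc by blast
    have yl: "y \<triangleleft>\<^bsub>N\<^esub> l \<in> N'" if "l \<in> L" for l
      using rsubmodule_rsmult[OF N' y(1)] Lc[OF that] by blast
    \<comment> \<open>For \<open>x = s + y l\<close>, the maps in \<open>F\<close> already send
      \<open>y l\<close> into \<open>V\<close>, which leaves \<open>s\<close> in the old kernel.
      Then \<open>f\<close> forces \<open>l \<in> P\<close>, and elements of \<open>P\<close> move
      all of \<open>W\<close> into \<open>V\<close>.\<close>
    have "?S \<inter> ?ker (insert f F) \<subseteq> ?ker X"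
    proof
      fix x assume x: "x \<in> ?S \<inter> ?ker (insert f F)"
      then obtain s l where sl: "s \<in> S" "l \<in> L" "x = s \<oplus>\<^bsub>N\<^esub> y \<triangleleft>\<^bsub>N\<^esub> l" by (auto simp: set_add_def')
      have split: "g x = g s \<oplus>\<^bsub>M\<^esub> g y \<triangleleft>\<^bsub>M\<^esub> l" "g s \<in> carrier M" "g y \<triangleleft>\<^bsub>M\<^esub> l \<in> carrier M" if g: "g \<in> X" for g
      proof -
        have gh: "g \<in> rmod_hom R N M" using g X(1) by blast
        have *: "s \<in> carrier N" "y \<triangleleft>\<^bsub>N\<^esub> l \<in> carrier N" using sl S yl N'_sub by blast+
        show "g x = g s \<oplus>\<^bsub>M\<^esub> g y \<triangleleft>\<^bsub>M\<^esub> l"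
          unfolding sl(3) rmod_homD(2)[OF gh *] hom[OF g sl(2)] by (rule refl)
        show "g s \<in> carrier M" "g y \<triangleleft>\<^bsub>M\<^esub> l \<in> carrier M"
          using rmod_homD(1)[OF gh] * hom[OF g sl(2)] by metis+
      qed
      have "g s \<in> V" if g: "g \<in> F" for g
      proof -
        have gX: "g \<in> X" using g F(1) by blast
        have "g y \<triangleleft>\<^bsub>M\<^esub> l \<in> V" using rsubmodule_rsmult[OF V y(2)[OF g]] Lc[OF sl(2)] by blast
        moreover have "g x \<in> V" using x g by blast
        ultimately show ?thesis
          using M.rsubmodule_add_cancel[OF V, of "g y \<triangleleft>\<^bsub>M\<^esub> l" "g s"] split[OF gX]
          by (simp add: M.M.a_comm)
      qed
      then have "s \<in> ?ker X" using F(3) sl(1) S(2) by blast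
      then have gs: "g s \<in> V" if "g \<in> X" for g using that by blast
      have "f y \<triangleleft>\<^bsub>M\<^esub> l \<in> V"
        using M.rsubmodule_add_cancel[OF V gs[OF f(1)]] split[OF f(1)] x by auto
      then have "l \<in> P" using L(3) sl(2) by blast
      then have "g x \<in> V" if "g \<in> X" for g
        using split(1)[OF that] gs[OF that] W(2) X(2) that y(1) \<open>l \<in> P\<close> rsubmodule_add[OF V] by metis
      then show "x \<in> ?ker X" using x by blast
    qed
    moreover have "?S \<subseteq> N'"
      using S(2) yl rsubmodule_add[OF N'] by (auto simp: set_add_def')
    ultimately have "?S \<in> ?\<S>"
      using N.rsubmodule_plus[OF S(1) yL] F(1,2) f(1) by (intro CollectI conjI exI[of _ "insert f F"]) auto
    then have "?S = S" using max N.plus_upper(1)[OF S(1) yL] by blast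
    then have "?yL \<subseteq> S" using N.plus_upper(2)[OF S(1) yL] by blast
    \<comment> \<open>The maps in \<open>F\<close> send \<open>y\<close> into \<open>V\<close>,
      hence also \<open>y l\<close>; as an element of \<open>S\<close>, \<open>y l\<close> is then
      sent into \<open>V\<close> by \<open>f\<close> too.\<close>
    have "l \<in> P" if l: "l \<in> L" for l
    proof -
      have "g (y \<triangleleft>\<^bsub>N\<^esub> l) \<in> V" if "g \<in> F" for g
        using hom[of g l] that F(1) l rsubmodule_rsmult[OF V y(2)[OF that]] Lc[OF l] by auto
      then have "y \<triangleleft>\<^bsub>N\<^esub> l \<in> ?ker X" using F(3) \<open>?yL \<subseteq> S\<close> l yl[OF l] by blast
      then have "f (y \<triangleleft>\<^bsub>N\<^esub> l) \<in> V" using f(1) by blast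
      then show "l \<in> P" using L(3)[OF l] hom[OF f(1) l] by simp
    qed
    then show False using L(2) by blast
  qed
  then show ?thesis using F by (intro exI[of _ F]) blast
qed

text \<open>\<open>V\<close> is enlarged along a series whose factors are nonsingular over prime factor rings;
  full boundedness provides the nonsingularity.\<close>

theorem FBN_finite_detection:
  assumes FBN: "right_FBN R" and N: "right_module R N" "noetherian_rmod R N"
    and M: "right_module R M" "noetherian_rmod R M" and V: "rsubmodule R M V"
    and X: "X \<subseteq> rmod_hom R N M"
  shows "\<exists>F\<subseteq>X. finite F \<and> (\<forall>n\<in>carrier N. (\<forall>f\<in>F. f n \<in> V) \<longrightarrow> (\<forall>f\<in>X. f n \<in> V))"
proof -
  interpret N: right_module R N by fact
  interpret M: right_module R M by fact
  \<comment> \<open>The claim restricted to submodules \<open>N'\<close> whose values all lie in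
    \<open>U\<close>: trivial for \<open>U = V\<close>, and the full claim for
    \<open>U = carrier M\<close>.\<close>
  let ?det = "\<lambda>U. \<forall>N'. rsubmodule R N N' \<longrightarrow> (\<forall>f\<in>X. \<forall>n\<in>N'. f n \<in> U) \<longrightarrow>
    (\<exists>F\<subseteq>X. finite F \<and> (\<forall>n\<in>N'. (\<forall>f\<in>F. f n \<in> V) \<longrightarrow> (\<forall>f\<in>X. f n \<in> V)))"
  let ?\<S> = "{U. rsubmodule R M U \<and> V \<subseteq> U \<and> ?det U}"
  have "V \<in> ?\<S>" using V by blast
  then have "?\<S> \<noteq> {}" by blast
  moreover have "\<And>U. U \<in> ?\<S> \<Longrightarrow> rsubmodule R M U" by blast
  ultimately have "\<exists>U\<in>?\<S>. \<forall>U'\<in>?\<S>. U \<subseteq> U' \<longrightarrow> U' = U"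
    by (rule noetherian_maximal[OF M(2)])
  then obtain U where "U \<in> ?\<S>" and max: "\<forall>U'\<in>?\<S>. U \<subseteq> U' \<longrightarrow> U' = U"
    by (rule bexE)
  from \<open>U \<in> ?\<S>\<close> have U: "rsubmodule R M U" "V \<subseteq> U" and det: "?det U" by simp_all
  have "U = carrier M"
  proof (rule ccontr)
    assume "U \<noteq> carrier M"
    then obtain W P where W: "rsubmodule R M W" "U \<subset> W" "\<forall>w\<in>W. \<forall>p\<in>P. w \<triangleleft>\<^bsub>M\<^esub> p \<in> U"
      and L: "\<forall>w\<in>W - U.
        \<exists>L. right_ideal R L \<and> \<not> L \<subseteq> P \<and> (\<forall>l\<in>L. w \<triangleleft>\<^bsub>M\<^esub> l \<in> U \<longrightarrow> l \<in> P)"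
      by (rule M.prime_section[OF FBN U(1)])
    \<comment> \<open>Two finite sets are joined: \<open>F1\<close> detects that values in
      \<open>W\<close> lie in \<open>U\<close>, and \<open>F2\<close> detects that values in
      \<open>U\<close> lie in \<open>V\<close>.\<close>
    have "?det W"
    proof (intro allI impI)
      fix N' assume N': "rsubmodule R N N'" "\<forall>f\<in>X. \<forall>n\<in>N'. f n \<in> W"
      obtain F1 where F1: "F1 \<subseteq> X" "finite F1"
          "\<And>n. \<lbrakk>n \<in> N'; \<forall>f\<in>F1. f n \<in> U\<rbrakk> \<Longrightarrow> \<forall>f\<in>X. f n \<in> U"
        using finite_detection_prime_section[OF N M(1) N'(1) U(1) rsubmodule_subset[OF W(1)] W(3) L X N'(2)] by metis
      let ?N = "{n \<in> N'. \<forall>f\<in>X. f n \<in> U}"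
      have "rsubmodule R N ?N" by (rule N.rsubmodule_all_vimage[OF X M(1) U(1) N'(1)])
      then obtain F2 where F2: "F2 \<subseteq> X" "finite F2" "\<forall>n\<in>?N. (\<forall>f\<in>F2. f n \<in> V) \<longrightarrow> (\<forall>f\<in>X. f n \<in> V)"
        using det[rule_format, of ?N] by blast
      have "\<forall>f\<in>X. f n \<in> V" if n: "n \<in> N'" "\<forall>f\<in>F1 \<union> F2. f n \<in> V" for n
      proof -
        have "n \<in> ?N" using n F1(3)[OF n(1)] U(2) by blast
        then show ?thesis using F2(3) n(2) by blast
      qed
      then show "\<exists>F\<subseteq>X. finite F \<and> (\<forall>n\<in>N'. (\<forall>f\<in>F. f n \<in> V) \<longrightarrow> (\<forall>f\<in>X. f n \<in> V))"
        using F1(1,2) F2(1,2) by (intro exI[of _ "F1 \<union> F2"]) simp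
    qed
    then have "W \<in> ?\<S>" using W U by simp
    then show False using max[THEN bspec, of W] W(2) by blast
  qed
  moreover have "f n \<in> carrier M" if "f \<in> X" "n \<in> carrier N" for f n
    using rmod_homD(1)[OF subsetD[OF X that(1)] that(2)] .
  ultimately have "\<forall>f\<in>X. \<forall>n\<in>carrier N. f n \<in> U" by simp
  then show ?thesis by (rule det[THEN spec, THEN mp, THEN mp, OF N.rsubmodule_carrier])
qed

section \<open>From finite detection back to full boundedness\<close>

lemma (in ring) right_fully_boundedI:
  assumes detect: "\<And>K. right_ideal R K \<Longrightarrow> \<exists>F\<subseteq>carrier R. finite F \<and>
    (\<forall>s\<in>carrier R. (\<forall>r\<in>F. r \<otimes> s \<in> K) \<longrightarrow> (\<forall>r\<in>carrier R. r \<otimes> s \<in> K))"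
  shows "right_fully_bounded R"
  unfolding right_fully_bounded_def
proof (intro allI impI)
  interpret reg: bimodule R "regular_bimod R" by (rule regular_bimodule) (rule ring_axioms)
  fix P assume P: "two_sided_prime R P"
  interpret P: ideal P R using P by (simp add: two_sided_prime_def)
  have P_proper: "\<not> carrier R \<subseteq> P" using P P.a_subset by (auto simp: two_sided_prime_def)
  have Pr: "right_ideal R P" by (rule ideal_right_ideal) (rule P.is_ideal)
  show "right_bounded (R Quot P)"
    unfolding P.right_bounded_quotient_iff
  proof (intro allI impI)
    fix K assume K: "essential_modulo R P K"
    then have Kr: "right_ideal R K" and PK: "P \<subseteq> K" by (auto simp: essential_modulo_def)
    have colon: "right_ideal R {s \<in> carrier R. r \<otimes> s \<in> K}" if "r \<in> carrier R" for r
      using reg.right_ideal_colon[of K r] Kr that by (simp add: right_ideal_iff)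
    \<comment> \<open>Finite intersections of the right ideals \<open>{s. r s \<in> K}\<close>
      remain essential modulo \<open>P\<close>. \<open>L\<close> is arbitrary, so that the induction
      can pass from \<open>L\<close> to \<open>{s \<in> L. r s \<in> K}\<close>.\<close>
    have key: "\<not> {s \<in> L. \<forall>r\<in>F. r \<otimes> s \<in> K} \<subseteq> P"
      if "finite F" "F \<subseteq> carrier R" "right_ideal R L" "P \<subseteq> L" "\<not> L \<subseteq> P" for F L
      using that
    proof (induction F arbitrary: L rule: finite_induct)
      case empty then show ?case by simp
    next
      case (insert r F)
      note Lsub = right_ideal_subset[OF insert.prems(2)]
      have r: "r \<in> carrier R" using insert.prems by simp
      let ?L = "{s \<in> L. r \<otimes> s \<in> K}"
      have "right_ideal R (L \<inter> {s \<in> carrier R. r \<otimes> s \<in> K})"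
        using insert.prems(2) colon[OF r] unfolding right_ideal_iff by (rule reg.rsubmodule_Int)
      also have "L \<inter> {s \<in> carrier R. r \<otimes> s \<in> K} = ?L" using Lsub by blast
      finally have L: "right_ideal R ?L" .
      have PL: "P \<subseteq> ?L" using insert.prems(3) PK P.I_l_closed[OF _ r] by blast
      have "\<not> ?L \<subseteq> P"
      proof
        assume sub: "?L \<subseteq> P"
        obtain l where l: "l \<in> L" "l \<notin> P" using insert.prems(4) by blast
        have lc: "l \<in> carrier R" using l Lsub by blast
        let ?rL = "(\<lambda>s. r \<otimes> s) ` L"
        have rL: "right_ideal R ?rL"
          using reg.rsubmodule_cyclic[OF insert.prems(2), of r] r by (simp add: right_ideal_iff)
        \<comment> \<open>\<open>P\<close> is added to \<open>r L\<close> because essentiality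
          modulo \<open>P\<close> only tests right ideals containing \<open>P\<close>. With
          \<open>?L\<close> inside \<open>P\<close>, this sum meets \<open>K\<close> inside
          \<open>P\<close>, hence \<open>r L \<subseteq> P \<subseteq> K\<close> and
          \<open>?L\<close> is all of \<open>L\<close>, a contradiction.\<close>
        have Q: "right_ideal R (P <+>\<^bsub>regular_bimod R\<^esub> ?rL)"
          using Pr rL unfolding right_ideal_iff by (rule reg.rsubmodule_plus)
        have up: "P \<subseteq> P <+>\<^bsub>regular_bimod R\<^esub> ?rL" "?rL \<subseteq> P <+>\<^bsub>regular_bimod R\<^esub> ?rL"
          using reg.plus_upper Pr rL unfolding right_ideal_iff by blast+
        have "K \<inter> (P <+>\<^bsub>regular_bimod R\<^esub> ?rL) \<subseteq> P"
        proof
          fix x assume x: "x \<in> K \<inter> (P <+>\<^bsub>regular_bimod R\<^esub> ?rL)"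
          then obtain p s where ps: "p \<in> P" "s \<in> L" "x = p \<oplus> r \<otimes> s" by (auto simp: set_add_def')
          have "r \<otimes> s \<in> K"
            using reg.rsubmodule_add_cancel[of K p "r \<otimes> s"] Kr x ps PK r Lsub
            by (auto simp: right_ideal_iff)
          then have "s \<in> P" using sub ps by blast
          then show "x \<in> P" using ps P.I_l_closed r by (auto intro: P.a_closed)
        qed
        then have "P <+>\<^bsub>regular_bimod R\<^esub> ?rL \<subseteq> P" using K Q up(1) unfolding essential_modulo_def by blast
        then have "r \<otimes> l \<in> P" using up(2) l by blast
        then have "l \<in> ?L" using l PK by blast
        then show False using sub l by blast
      qed
      from insert.IH[OF _ L PL this] insert.prems(1)
      have "\<not> {s \<in> ?L. \<forall>r\<in>F. r \<otimes> s \<in> K} \<subseteq> P" by blast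
      then show ?case by auto
    qed
    obtain F where F: "F \<subseteq> carrier R" "finite F"
        "\<forall>s\<in>carrier R. (\<forall>r\<in>F. r \<otimes> s \<in> K) \<longrightarrow> (\<forall>r\<in>carrier R. r \<otimes> s \<in> K)"
      using detect[OF Kr] by blast
    \<comment> \<open>The largest two-sided ideal inside \<open>K\<close>; by the choice of
      \<open>F\<close> it is the finite intersection treated in \<open>key\<close>, taken with
      \<open>L = carrier R\<close>.\<close>
    let ?J = "{s \<in> carrier R. \<forall>r\<in>carrier R. r \<otimes> s \<in> K}"
    have "ideal ?J R"
    proof (intro idealI_right right_idealI)
      show "\<zero> \<in> ?J" using right_ideal_zero[OF Kr] by auto
      show "x \<oplus> y \<in> ?J" if "x \<in> ?J" "y \<in> ?J" for x y
        using that right_ideal_add[OF Kr] by (auto simp: r_distr)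
      show "x \<otimes> r \<in> ?J" if "x \<in> ?J" "r \<in> carrier R" for x r
        using that right_ideal_mult[OF Kr] by (auto simp: m_assoc[symmetric])
      show "r \<otimes> x \<in> ?J" if "x \<in> ?J" "r \<in> carrier R" for x r
        using that by (auto simp: m_assoc[symmetric])
    qed auto
    moreover have "P \<subseteq> ?J" using PK P.I_l_closed P.a_subset by blast
    moreover have "\<not> ?J \<subseteq> P"
      using key[OF F(2,1) _ P.a_subset P_proper] F(3) reg.rsubmodule_carrier by (auto simp: right_ideal_iff)
    moreover have "?J \<subseteq> K"
    proof
      fix s assume "s \<in> ?J"
      then have s: "s \<in> carrier R" "\<forall>r\<in>carrier R. r \<otimes> s \<in> K" by simp_all
      have "\<one> \<otimes> s \<in> K" by (rule bspec[OF s(2) one_closed])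
      with s(1) show "s \<in> K" by simp
    qed
    ultimately show "\<exists>J. ideal J R \<and> P \<subseteq> J \<and> \<not> J \<subseteq> P \<and> J \<subseteq> K" by blast
  qed
qed

text \<open>Left multiplications by elements of \<open>R\<close> are \<open>A\<close>-linear, and
  right ideals of \<open>R\<close> are \<open>A\<close>-submodules, so detection over
  \<open>A\<close> supplies the finite sets asked for by \<open>right_fully_boundedI\<close>. It
  serves both for \<open>A\<close> mapped into \<open>R\<close> and for the inclusion of the
  invariants in \<open>A\<close>.\<close>

theorem right_FBN_of_noetherian_extension:
  assumes "ring A" "ring R" "i \<in> ring_hom A R"
    and FBN: "right_FBN A" and noeth: "noetherian_rmod A (ring_bimod R i)"
  shows "right_FBN R"
proof -
  interpret A: ring A by fact
  interpret R: ring R by fact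
  interpret RA: bimodule A "ring_bimod R i" by (rule ring_bimod_bimodule) fact+
  have i: "i a \<in> carrier R" if "a \<in> carrier A" for a using assms(3) that by (auto simp: ring_hom_def)
  have sub: "rsubmodule A (ring_bimod R i) K" if "right_ideal R K" for K
    using right_ideal_subset[OF that] right_ideal_zero[OF that] right_ideal_add[OF that]
      right_ideal_mult[OF that] i by (intro RA.rsubmoduleI) auto
  have "right_noetherian R"
    unfolding right_noetherian_iff
    by (rule noetherian_transfer[OF noeth, of R "regular_bimod R" "\<lambda>K. K"])
      (auto simp: right_ideal_iff[symmetric] sub)
  moreover have "right_fully_bounded R"
  proof (rule R.right_fully_boundedI)
    fix K assume K: "right_ideal R K"
    let ?X = "(\<lambda>r s. r \<otimes>\<^bsub>R\<^esub> s) ` carrier R"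
    have "?X \<subseteq> rmod_hom A (ring_bimod R i) (ring_bimod R i)"
      using i by (auto simp: rmod_hom_def R.r_distr R.m_assoc)
    then obtain \<F> where \<F>: "\<F> \<subseteq> ?X" "finite \<F>"
        "\<forall>s\<in>carrier R. (\<forall>f\<in>\<F>. f s \<in> K) \<longrightarrow> (\<forall>f\<in>?X. f s \<in> K)"
      using FBN_finite_detection[OF FBN RA.right_module_axioms noeth RA.right_module_axioms noeth sub[OF K]]
      by (metis ring_bimod_simps(1))
    then obtain F where "F \<subseteq> carrier R" "finite F" "\<F> = (\<lambda>r s. r \<otimes>\<^bsub>R\<^esub> s) ` F"
      by (metis finite_subset_image)
    then show "\<exists>F\<subseteq>carrier R. finite F \<and>
        (\<forall>s\<in>carrier R. (\<forall>r\<in>F. r \<otimes>\<^bsub>R\<^esub> s \<in> K) \<longrightarrow> (\<forall>r\<in>carrier R. r \<otimes>\<^bsub>R\<^esub> s \<in> K))"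
      using \<F>(3) by (intro exI[of _ F]) simp
  qed
  ultimately show ?thesis by (simp add: right_FBN_def)
qed

section \<open>Generated submodules and quotient modules\<close>

context right_module
begin

lemma list_span_least: "\<lbrakk>rsubmodule R M N; set xs \<subseteq> N\<rbrakk> \<Longrightarrow> list_span xs \<subseteq> N"
proof (induction xs)
  case Nil then show ?case by (simp add: rsubmodule_zero)
next
  case (Cons x xs)
  then show ?case using rsubmodule_add[OF Cons.prems(1)] rsubmodule_rsmult[OF Cons.prems(1)]
    by (auto simp: set_add_def')
qed

text \<open>A union over lists instead of an intersection of submodules: membership hands out
  finitely many generators for an induction over \<open>list_span\<close>.\<close>

definition span_of :: "'m set \<Rightarrow> 'm set"
  where "span_of S = (\<Union>xs\<in>lists S. list_span xs)"

lemma span_ofI: "\<lbrakk>x \<in> list_span xs; set xs \<subseteq> S\<rbrakk> \<Longrightarrow> x \<in> span_of S"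
  unfolding span_of_def by (auto simp: in_lists_conv_set)

lemma span_ofE:
  assumes "x \<in> span_of S" obtains xs where "set xs \<subseteq> S" "x \<in> list_span xs"
  using assms unfolding span_of_def by (auto simp: in_lists_conv_set)

lemma span_of_mono: "S \<subseteq> S' \<Longrightarrow> span_of S \<subseteq> span_of S'"
  unfolding span_of_def using lists_mono by blast

lemma span_of_superset: "S \<subseteq> carrier M \<Longrightarrow> S \<subseteq> span_of S"
proof
  fix x assume "S \<subseteq> carrier M" "x \<in> S"
  then have "x \<in> list_span [x]" using list_span_superset[of "[x]"] by auto
  then show "x \<in> span_of S" by (rule span_ofI) (use \<open>x \<in> S\<close> in simp)
qed

lemma span_of_least:
  assumes "rsubmodule R M N" "S \<subseteq> N"
  shows "span_of S \<subseteq> N"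
proof
  fix x assume "x \<in> span_of S"
  then obtain xs where xs: "set xs \<subseteq> S" "x \<in> list_span xs" by (rule span_ofE)
  then show "x \<in> N" using list_span_least[OF assms(1), of xs] assms(2) by blast
qed

lemma rsubmodule_span_of:
  assumes S: "S \<subseteq> carrier M"
  shows "rsubmodule R M (span_of S)"
proof (rule rsubmoduleI)
  have sub: "rsubmodule R M (list_span xs)" if "set xs \<subseteq> S" for xs
    using rsubmodule_list_span that S by blast
  show "span_of S \<subseteq> carrier M" using S by (intro span_of_least rsubmodule_carrier)
  show "\<zero>\<^bsub>M\<^esub> \<in> span_of S" using span_ofI[of _ "[]"] by simp
  show "x \<triangleleft>\<^bsub>M\<^esub> r \<in> span_of S" if "x \<in> span_of S" "r \<in> carrier R" for x r
    using that sub rsubmodule_rsmult by (metis span_ofE span_ofI)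
  show "x \<oplus>\<^bsub>M\<^esub> y \<in> span_of S" if xy: "x \<in> span_of S" "y \<in> span_of S" for x y
  proof -
    obtain xs ys where *: "set xs \<subseteq> S" "x \<in> list_span xs" "set ys \<subseteq> S" "y \<in> list_span ys"
      using xy by (auto elim!: span_ofE)
    let ?N = "list_span (xs @ ys)"
    have N: "rsubmodule R M ?N" using sub *(1,3) by simp
    have "set (xs @ ys) \<subseteq> ?N" using *(1,3) S by (intro list_span_superset) auto
    then have "x \<in> ?N" "y \<in> ?N"
      using *(2,4) list_span_least[OF N, of xs] list_span_least[OF N, of ys] by auto
    then show ?thesis using *(1,3) by (intro span_ofI[OF rsubmodule_add[OF N]]) auto
  qed
qed

context
  fixes N assumes N: "rsubmodule R M N"
begin

interpretation N: abelian_subgroup N M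
  using N M.abelian_group_axioms by (intro abelian_subgroupI3) (auto simp: rsubmodule_def)

lemma rcos_eq_iff:
  assumes "x \<in> carrier M" "y \<in> carrier M"
  shows "N +>\<^bsub>M\<^esub> x = N +>\<^bsub>M\<^esub> y \<longleftrightarrow> x \<oplus>\<^bsub>M\<^esub> \<ominus>\<^bsub>M\<^esub> y \<in> N"
  using N.a_rcos_module[OF assms(2,1)] N.a_repr_independence'[OF _ assms(2), of x]
    N.a_rcos_self[OF assms(1)] by metis

lemma rmod_quot_add:
  "\<lbrakk>x \<in> carrier M; y \<in> carrier M\<rbrakk>
    \<Longrightarrow> (N +>\<^bsub>M\<^esub> x) \<oplus>\<^bsub>rmod_quot M N\<^esub> (N +>\<^bsub>M\<^esub> y) = N +>\<^bsub>M\<^esub> (x \<oplus>\<^bsub>M\<^esub> y)"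
  using N.a_rcos_sum by (simp add: rmod_quot_def)

lemma rmod_quot_carrier: "x \<in> carrier M \<Longrightarrow> N +>\<^bsub>M\<^esub> x \<in> carrier (rmod_quot M N)"
  by (auto simp: rmod_quot_def A_RCOSETS_def')

lemma rmod_quot_rsmult:
  assumes x: "x \<in> carrier M" and r: "r \<in> carrier R"
  shows "(N +>\<^bsub>M\<^esub> x) \<triangleleft>\<^bsub>rmod_quot M N\<^esub> r = N +>\<^bsub>M\<^esub> (x \<triangleleft>\<^bsub>M\<^esub> r)"
proof -
  have "N +>\<^bsub>M\<^esub> (y \<triangleleft>\<^bsub>M\<^esub> r) = N +>\<^bsub>M\<^esub> (x \<triangleleft>\<^bsub>M\<^esub> r)" if y: "y \<in> N +>\<^bsub>M\<^esub> x" for y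
  proof -
    obtain n where n: "n \<in> N" "y = n \<oplus>\<^bsub>M\<^esub> x" using y by (auto simp: a_r_coset_def')
    have nc: "n \<in> carrier M" using n N rsubmodule_subset by blast
    have "y \<triangleleft>\<^bsub>M\<^esub> r \<oplus>\<^bsub>M\<^esub> \<ominus>\<^bsub>M\<^esub> (x \<triangleleft>\<^bsub>M\<^esub> r) = n \<triangleleft>\<^bsub>M\<^esub> r"
      unfolding n(2) using nc x r by (simp add: rsmult_add_left M.a_assoc M.r_neg)
    then show ?thesis using rcos_eq_iff nc x r n rsubmodule_rsmult[OF N n(1) r] by simp
  qed
  moreover have "x \<in> N +>\<^bsub>M\<^esub> x" using N.a_rcos_self[OF x] .
  ultimately have "(\<Union>y\<in>N +>\<^bsub>M\<^esub> x. N +>\<^bsub>M\<^esub> (y \<triangleleft>\<^bsub>M\<^esub> r)) = N +>\<^bsub>M\<^esub> (x \<triangleleft>\<^bsub>M\<^esub> r)" by blast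
  then show ?thesis by (simp add: rmod_quot_def)
qed

end

end


section \<open>Invariants of a right grouplike character\<close>

locale grouplike_extension = A: ring A + R: ring R
  for A :: "('a, 'x) ring_scheme" and R :: "('r, 'y) ring_scheme" +
  fixes i :: "'a \<Rightarrow> 'r" and \<chi> :: "'r \<Rightarrow> 'a"
  assumes i_hom: "i \<in> ring_hom A R" and character: "right_grouplike_character A R i \<chi>"
begin

abbreviation "\<B> \<equiv> char_invariants A R i \<chi>"
abbreviation "B \<equiv> char_invariant_ring A R i \<chi>"
abbreviation "A\<^sub>R \<equiv> char_rmod A R i \<chi>"

lemma i_simps [simp]:
  "a \<in> carrier A \<Longrightarrow> i a \<in> carrier R"
  "\<lbrakk>a \<in> carrier A; b \<in> carrier A\<rbrakk> \<Longrightarrow> i (a \<oplus>\<^bsub>A\<^esub> b) = i a \<oplus>\<^bsub>R\<^esub> i b"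
  "\<lbrakk>a \<in> carrier A; b \<in> carrier A\<rbrakk> \<Longrightarrow> i (a \<otimes>\<^bsub>A\<^esub> b) = i a \<otimes>\<^bsub>R\<^esub> i b"
  "i \<one>\<^bsub>A\<^esub> = \<one>\<^bsub>R\<^esub>"
  using i_hom by (auto simp: ring_hom_def)

lemma \<chi>_simps [simp]:
  "r \<in> carrier R \<Longrightarrow> \<chi> r \<in> carrier A"
  "\<lbrakk>r \<in> carrier R; s \<in> carrier R\<rbrakk> \<Longrightarrow> \<chi> (r \<oplus>\<^bsub>R\<^esub> s) = \<chi> r \<oplus>\<^bsub>A\<^esub> \<chi> s"
  "\<lbrakk>r \<in> carrier R; a \<in> carrier A\<rbrakk> \<Longrightarrow> \<chi> (r \<otimes>\<^bsub>R\<^esub> i a) = \<chi> r \<otimes>\<^bsub>A\<^esub> a"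
  "\<lbrakk>r \<in> carrier R; s \<in> carrier R\<rbrakk> \<Longrightarrow> \<chi> (i (\<chi> r) \<otimes>\<^bsub>R\<^esub> s) = \<chi> (r \<otimes>\<^bsub>R\<^esub> s)"
  "\<chi> \<one>\<^bsub>R\<^esub> = \<one>\<^bsub>A\<^esub>"
  using character by (auto simp: right_grouplike_character_def rmod_hom_def)

lemma \<chi>_i [simp]: "a \<in> carrier A \<Longrightarrow> \<chi> (i a) = a"
  using \<chi>_simps(3)[of "\<one>\<^bsub>R\<^esub>" a] by (simp del: \<chi>_simps(3))

sublocale AR: right_module R A\<^sub>R
  by (rule char_rmod_right_module[OF A.ring_axioms R.ring_axioms i_hom character])

sublocale RA: bimodule A "ring_bimod R i"
  by (rule ring_bimod_bimodule[OF A.ring_axioms R.ring_axioms i_hom])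

lemma invariantI:
  "\<lbrakk>b \<in> carrier A; \<And>r. r \<in> carrier R \<Longrightarrow> b \<otimes>\<^bsub>A\<^esub> \<chi> r = \<chi> (i b \<otimes>\<^bsub>R\<^esub> r)\<rbrakk> \<Longrightarrow> b \<in> \<B>"
  by (simp add: char_invariants_def)

lemma invariant_closed [simp]: "b \<in> \<B> \<Longrightarrow> b \<in> carrier A"
  by (simp add: char_invariants_def)

lemma invariant_\<chi>: "\<lbrakk>b \<in> \<B>; r \<in> carrier R\<rbrakk> \<Longrightarrow> \<chi> (i b \<otimes>\<^bsub>R\<^esub> r) = b \<otimes>\<^bsub>A\<^esub> \<chi> r"
  unfolding char_invariants_def by auto

lemma invariant_act:
  assumes "b \<in> \<B>" "a \<in> carrier A" "r \<in> carrier R"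
  shows "\<chi> (i b \<otimes>\<^bsub>R\<^esub> i a \<otimes>\<^bsub>R\<^esub> r) = b \<otimes>\<^bsub>A\<^esub> \<chi> (i a \<otimes>\<^bsub>R\<^esub> r)"
  using assms by (simp add: R.m_assoc invariant_\<chi>)

lemma subring_invariants: "subring \<B> A"
proof (rule A.subringI)
  have zero: "i \<zero>\<^bsub>A\<^esub> = \<zero>\<^bsub>R\<^esub>" using i_hom A.ring_axioms R.ring_axioms ring_hom_zero by metis
  show "\<B> \<subseteq> carrier A" by auto
  show "\<one>\<^bsub>A\<^esub> \<in> \<B>" by (rule invariantI) simp_all
  show mult: "b \<otimes>\<^bsub>A\<^esub> c \<in> \<B>" if "b \<in> \<B>" "c \<in> \<B>" for b c
    using that by (intro invariantI) (simp_all add: A.m_assoc R.m_assoc invariant_\<chi>)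
  show add: "b \<oplus>\<^bsub>A\<^esub> c \<in> \<B>" if "b \<in> \<B>" "c \<in> \<B>" for b c
    using that by (intro invariantI) (simp_all add: A.l_distr R.l_distr invariant_\<chi>)
  show "\<ominus>\<^bsub>A\<^esub> b \<in> \<B>" if b: "b \<in> \<B>" for b
  proof -
    have "(\<ominus>\<^bsub>A\<^esub> b) \<otimes>\<^bsub>A\<^esub> \<chi> r = \<chi> (i (\<ominus>\<^bsub>A\<^esub> b) \<otimes>\<^bsub>R\<^esub> r)" if r: "r \<in> carrier R" for r
    proof -
      have bc: "b \<in> carrier A" using b by simp
      have "\<chi> (i b \<otimes>\<^bsub>R\<^esub> r) \<oplus>\<^bsub>A\<^esub> \<chi> (i (\<ominus>\<^bsub>A\<^esub> b) \<otimes>\<^bsub>R\<^esub> r) = \<chi> (i (b \<oplus>\<^bsub>A\<^esub> \<ominus>\<^bsub>A\<^esub> b) \<otimes>\<^bsub>R\<^esub> r)"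
        using bc r by (simp add: R.l_distr del: A.r_neg)
      also have "\<dots> = \<chi> (i \<zero>\<^bsub>A\<^esub>)" using bc r by (simp add: A.r_neg zero)
      also have "\<dots> = \<zero>\<^bsub>A\<^esub>" by (rule \<chi>_i) simp
      finally show ?thesis using bc b r by (simp add: A.l_minus invariant_\<chi> A.minus_equality A.a_comm)
    qed
    then show ?thesis using b by (intro invariantI) simp_all
  qed
qed

sublocale B: ring B
  by (rule A.subring_is_ring[OF subring_invariants])

lemma invariant_hom: "b \<in> \<B> \<Longrightarrow> (\<lambda>a. b \<otimes>\<^bsub>A\<^esub> a) \<in> rmod_hom R A\<^sub>R A\<^sub>R"
  by (auto simp: rmod_hom_def A.r_distr invariant_act)

text \<open>\<open>\<chi> r\<close> is \<open>\<one>\<close> acted on by \<open>r\<close> and also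
  by \<open>i (\<chi> r)\<close>; computing \<open>h (\<chi> r)\<close> both ways gives invariance.
  The endomorphisms of \<open>A\<^sub>R\<close> are thus the left multiplications by
  invariants.\<close>

lemma endomorphism_invariant:
  assumes "h \<in> rmod_hom R A\<^sub>R A\<^sub>R"
  shows "h \<one>\<^bsub>A\<^esub> \<in> \<B>"
proof -
  have h: "h a \<in> carrier A" "r \<in> carrier R \<Longrightarrow> h (\<chi> (i a \<otimes>\<^bsub>R\<^esub> r)) = \<chi> (i (h a) \<otimes>\<^bsub>R\<^esub> r)" if "a \<in> carrier A" for a r
    using rmod_homD(1,3)[OF assms] that by auto
  have "h (\<chi> r) = h \<one>\<^bsub>A\<^esub> \<otimes>\<^bsub>A\<^esub> \<chi> r" if r: "r \<in> carrier R" for r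
    using h(2)[of "\<one>\<^bsub>A\<^esub>" "i (\<chi> r)"] h(1)[of "\<one>\<^bsub>A\<^esub>"] r by simp
  moreover have "h (\<chi> r) = \<chi> (i (h \<one>\<^bsub>A\<^esub>) \<otimes>\<^bsub>R\<^esub> r)" if r: "r \<in> carrier R" for r
    using h(2)[of "\<one>\<^bsub>A\<^esub>" r] r by simp
  ultimately show ?thesis using h(1)[of "\<one>\<^bsub>A\<^esub>"] by (intro invariantI) simp_all
qed

text \<open>Acting by \<open>i a\<close> is right multiplication by \<open>a\<close>, so submodules
  of \<open>A\<^sub>R\<close> are right ideals of \<open>A\<close> and inherit its chain
  condition.\<close>

lemma rsubmodule_right_mult:
  assumes "rsubmodule R A\<^sub>R N" "x \<in> N" "a \<in> carrier A"
  shows "x \<otimes>\<^bsub>A\<^esub> a \<in> N"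
  using rsubmodule_rsmult[OF assms(1,2), of "i a"] rsubmodule_subset[OF assms(1)] assms(2,3) by auto

lemma noetherian_char_rmod:
  assumes "right_noetherian A"
  shows "noetherian_rmod R A\<^sub>R"
proof (rule noetherian_transfer[of A "regular_bimod A" _ _ "\<lambda>N. N"])
  show "noetherian_rmod A (regular_bimod A)" using assms by (simp add: right_noetherian_iff)
  show "rsubmodule A (regular_bimod A) N" if N: "rsubmodule R A\<^sub>R N" for N
    unfolding right_ideal_iff[symmetric]
    using rsubmodule_subset[OF N] rsubmodule_zero[OF N] rsubmodule_add[OF N] rsubmodule_right_mult[OF N]
    by (intro A.right_idealI) auto
qed auto

text \<open>\<open>AR.span_of K\<close> is the right ideal \<open>K A\<close>, since an invariant
  \<open>k\<close> satisfies \<open>k \<triangleleft> r = k \<chi>(r)\<close>. The condition says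
  that extending \<open>K\<close> to \<open>A\<close> and contracting back adds nothing.\<close>

definition contracting :: bool
  where "contracting \<longleftrightarrow> (\<forall>K. right_ideal B K \<longrightarrow> AR.span_of K \<inter> \<B> \<subseteq> K)"

text \<open>Under \<open>contracting\<close>, \<open>AR.span_of\<close> embeds the right ideals of
  \<open>B\<close> into the \<open>R\<close>-submodules of \<open>A\<close>. Detection over
  \<open>R\<close> is applied to the left multiplications by invariants and to
  \<open>V = K A\<close>; on elements of \<open>B\<close>, membership in \<open>K A\<close> and in
  \<open>K\<close> agree.\<close>

theorem right_FBN_invariants:
  assumes contr: contracting and FBN: "right_FBN R" and noeth: "right_noetherian A"
  shows "right_FBN B"
proof -
  have KA: "K \<subseteq> carrier A\<^sub>R" "K \<subseteq> \<B>" if "right_ideal B K" for K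
    using right_ideal_subset[OF that] by auto
  have c: "x \<in> K" if "right_ideal B K" "x \<in> AR.span_of K" "x \<in> \<B>" for x K
    using contr that unfolding contracting_def by blast
  have "right_noetherian B"
    unfolding right_noetherian_iff
  proof (rule noetherian_transfer[OF noetherian_char_rmod[OF noeth], where \<phi> = AR.span_of],
      unfold right_ideal_iff[symmetric])
    show "rsubmodule R A\<^sub>R (AR.span_of K)" if "right_ideal B K" for K
      using KA(1)[OF that] by (rule AR.rsubmodule_span_of)
    show "AR.span_of K \<subseteq> AR.span_of K'" if "K \<subseteq> K'" for K K'
      using that by (rule AR.span_of_mono)
    show "K' \<subseteq> K" if "right_ideal B K" "right_ideal B K'" "AR.span_of K = AR.span_of K'" for K K'
      using c[OF that(1)] KA[OF that(2)] AR.span_of_superset[of K'] that(3) by blast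
  qed
  moreover have "right_fully_bounded B"
  proof (rule B.right_fully_boundedI)
    fix K assume K: "right_ideal B K"
    let ?V = "AR.span_of K"
    have V: "rsubmodule R A\<^sub>R ?V" using KA(1)[OF K] by (rule AR.rsubmodule_span_of)
    let ?X = "(\<lambda>b a. b \<otimes>\<^bsub>A\<^esub> a) ` \<B>"
    have "?X \<subseteq> rmod_hom R A\<^sub>R A\<^sub>R" using invariant_hom by blast
    then obtain \<F> where \<F>: "\<F> \<subseteq> ?X" "finite \<F>"
        "\<forall>a\<in>carrier A. (\<forall>f\<in>\<F>. f a \<in> ?V) \<longrightarrow> (\<forall>f\<in>?X. f a \<in> ?V)"
      using FBN_finite_detection[OF FBN AR.right_module_axioms noetherian_char_rmod[OF noeth]
          AR.right_module_axioms noetherian_char_rmod[OF noeth] V, of ?X]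
      by (metis char_rmod_simps(1))
    then obtain F where F: "F \<subseteq> \<B>" "finite F" "\<F> = (\<lambda>b a. b \<otimes>\<^bsub>A\<^esub> a) ` F"
      by (metis finite_subset_image)
    have iff: "b \<otimes>\<^bsub>A\<^esub> c \<in> ?V \<longleftrightarrow> b \<otimes>\<^bsub>A\<^esub> c \<in> K" if "b \<in> \<B>" "c \<in> \<B>" for b c
      using c[OF K, of "b \<otimes>\<^bsub>A\<^esub> c"] AR.span_of_superset[OF KA(1)[OF K]] B.m_closed[of b c] that by auto
    have "\<forall>s\<in>\<B>. (\<forall>r\<in>F. r \<otimes>\<^bsub>A\<^esub> s \<in> K) \<longrightarrow> (\<forall>r\<in>\<B>. r \<otimes>\<^bsub>A\<^esub> s \<in> K)"
    proof (intro ballI impI)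
      fix s r assume s: "s \<in> \<B>" "\<forall>r\<in>F. r \<otimes>\<^bsub>A\<^esub> s \<in> K" and r: "r \<in> \<B>"
      have "\<forall>f\<in>\<F>. f s \<in> ?V" using s iff F by auto
      then have "r \<otimes>\<^bsub>A\<^esub> s \<in> ?V" using \<F>(3) s(1) r by auto
      then show "r \<otimes>\<^bsub>A\<^esub> s \<in> K" using iff r s(1) by blast
    qed
    then show "\<exists>F\<subseteq>carrier B. finite F \<and>
        (\<forall>s\<in>carrier B. (\<forall>r\<in>F. r \<otimes>\<^bsub>B\<^esub> s \<in> K) \<longrightarrow> (\<forall>r\<in>carrier B. r \<otimes>\<^bsub>B\<^esub> s \<in> K))"
      using F(1,2) by (intro exI[of _ F]) simp
  qed
  ultimately show ?thesis by (simp add: right_FBN_def)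
qed


section \<open>Contraction of right ideals, and the section obtained from projectivity\<close>

text \<open>Exchanges a coefficient \<open>x\<close> in \<open>A\<close> for an invariant
  \<open>c\<close>, modulo \<open>S\<close>. The map \<open>a \<mapsto> x a\<close> need not be
  \<open>R\<close>-linear, but it is modulo \<open>{a. k a \<in> S}\<close>, because
  \<open>k x\<close> differs from the invariant \<open>b\<close> by an element of \<open>S\<close>.
  A lift to an endomorphism of \<open>A\<close> is left multiplication by an invariant
  \<open>c\<close>, and \<open>k (x - c)\<close> falls into \<open>S\<close>.\<close>

lemma quasi_projective_division:
  assumes qp: "quasi_projective R A\<^sub>R" and k: "k \<in> \<B>" and S: "rsubmodule R A\<^sub>R S"
    and b: "b \<in> \<B>" "b = k \<otimes>\<^bsub>A\<^esub> x \<oplus>\<^bsub>A\<^esub> s" "x \<in> carrier A" "s \<in> S"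
  obtains c where "c \<in> \<B>" "b \<ominus>\<^bsub>A\<^esub> k \<otimes>\<^bsub>A\<^esub> c \<in> S"
proof -
  have minus: "\<ominus>\<^bsub>A\<^sub>R\<^esub> a = \<ominus>\<^bsub>A\<^esub> a" if "a \<in> carrier A" for a
    using that by (intro AR.M.minus_equality) (auto simp: A.l_neg)
  let ?N = "{a \<in> carrier A. k \<otimes>\<^bsub>A\<^esub> a \<in> S}"
  have N: "rsubmodule R A\<^sub>R ?N"
    using rsubmodule_vimage[OF AR.right_module_axioms AR.right_module_axioms invariant_hom[OF k] S] by simp
  have sc: "s \<in> carrier A" using S b(4) rsubmodule_subset by fastforce
  have kc: "k \<in> carrier A" using k by simp
  let ?g = "\<lambda>a. ?N +>\<^bsub>A\<^sub>R\<^esub> (x \<otimes>\<^bsub>A\<^esub> a)"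
  have "?g \<in> rmod_hom R A\<^sub>R (rmod_quot A\<^sub>R ?N)"
    unfolding rmod_hom_def
  proof (intro CollectI conjI funcsetI ballI)
    fix a assume a: "a \<in> carrier A\<^sub>R"
    then have xa: "x \<otimes>\<^bsub>A\<^esub> a \<in> carrier A\<^sub>R" using b(3) by simp
    show "?g a \<in> carrier (rmod_quot A\<^sub>R ?N)" by (rule AR.rmod_quot_carrier[OF N xa])
    show "?g (a \<oplus>\<^bsub>A\<^sub>R\<^esub> a') = ?g a \<oplus>\<^bsub>rmod_quot A\<^sub>R ?N\<^esub> ?g a'" if "a' \<in> carrier A\<^sub>R" for a'
      using a that b(3) AR.rmod_quot_add[OF N xa, of "x \<otimes>\<^bsub>A\<^esub> a'"] by (simp add: A.r_distr)
    show "?g (a \<triangleleft>\<^bsub>A\<^sub>R\<^esub> r) = ?g a \<triangleleft>\<^bsub>rmod_quot A\<^sub>R ?N\<^esub> r" if r: "r \<in> carrier R" for r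
    proof -
      have ac: "a \<in> carrier A" using a by simp
      \<comment> \<open>Linearity amounts to \<open>k (?u - ?v) \<in> S\<close>. Substituting
        \<open>b = k x + s\<close> on both sides of the invariance of \<open>b\<close> leaves only
        terms built from \<open>s\<close>.\<close>
      let ?u = "x \<otimes>\<^bsub>A\<^esub> \<chi> (i a \<otimes>\<^bsub>R\<^esub> r)" and ?v = "\<chi> (i (x \<otimes>\<^bsub>A\<^esub> a) \<otimes>\<^bsub>R\<^esub> r)"
      have uv: "?u \<in> carrier A" "?v \<in> carrier A" using ac b(3) r by simp_all
      have "k \<otimes>\<^bsub>A\<^esub> ?v = \<chi> (i (k \<otimes>\<^bsub>A\<^esub> x \<otimes>\<^bsub>A\<^esub> a) \<otimes>\<^bsub>R\<^esub> r)"
        using invariant_act[OF k, of "x \<otimes>\<^bsub>A\<^esub> a" r] ac b(3) kc r by (simp add: R.m_assoc)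
      then have "k \<otimes>\<^bsub>A\<^esub> ?v \<oplus>\<^bsub>A\<^esub> \<chi> (i (s \<otimes>\<^bsub>A\<^esub> a) \<otimes>\<^bsub>R\<^esub> r) = \<chi> (i (b \<otimes>\<^bsub>A\<^esub> a) \<otimes>\<^bsub>R\<^esub> r)"
        unfolding b(2) using ac b(3) kc r sc by (simp add: A.l_distr R.l_distr)
      also have "\<dots> = b \<otimes>\<^bsub>A\<^esub> \<chi> (i a \<otimes>\<^bsub>R\<^esub> r)"
        using invariant_act[OF b(1) ac r] b(1) ac by simp
      also have "\<dots> = k \<otimes>\<^bsub>A\<^esub> ?u \<oplus>\<^bsub>A\<^esub> s \<otimes>\<^bsub>A\<^esub> \<chi> (i a \<otimes>\<^bsub>R\<^esub> r)"
        unfolding b(2) using ac b(3) kc r sc by (simp add: A.l_distr A.m_assoc)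
      finally have eq: "k \<otimes>\<^bsub>A\<^esub> ?v \<oplus>\<^bsub>A\<^esub> \<chi> (i (s \<otimes>\<^bsub>A\<^esub> a) \<otimes>\<^bsub>R\<^esub> r) =
          k \<otimes>\<^bsub>A\<^esub> ?u \<oplus>\<^bsub>A\<^esub> s \<otimes>\<^bsub>A\<^esub> \<chi> (i a \<otimes>\<^bsub>R\<^esub> r)" .
      let ?y = "\<chi> (i (s \<otimes>\<^bsub>A\<^esub> a) \<otimes>\<^bsub>R\<^esub> r)" and ?z = "s \<otimes>\<^bsub>A\<^esub> \<chi> (i a \<otimes>\<^bsub>R\<^esub> r)"
      have yS: "?y \<in> S"
        using rsubmodule_rsmult[OF S rsubmodule_right_mult[OF S b(4) ac] r] by simp
      have zS: "\<ominus>\<^bsub>A\<^esub> ?z \<in> S"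
        using AR.rsubmodule_minus[OF S rsubmodule_right_mult[OF S b(4), of "\<chi> (i a \<otimes>\<^bsub>R\<^esub> r)"]] minus ac r sc
        by simp
      have c: "?y \<in> carrier A" "?z \<in> carrier A" "k \<otimes>\<^bsub>A\<^esub> ?u \<in> carrier A" "k \<otimes>\<^bsub>A\<^esub> ?v \<in> carrier A"
        using ac sc r uv kc by simp_all
      have "k \<otimes>\<^bsub>A\<^esub> (?u \<oplus>\<^bsub>A\<^esub> \<ominus>\<^bsub>A\<^esub> ?v) = k \<otimes>\<^bsub>A\<^esub> ?u \<oplus>\<^bsub>A\<^esub> \<ominus>\<^bsub>A\<^esub> (k \<otimes>\<^bsub>A\<^esub> ?v)"
        using uv kc by (simp add: A.r_distr A.r_minus)
      also have "k \<otimes>\<^bsub>A\<^esub> ?u = (k \<otimes>\<^bsub>A\<^esub> ?v \<oplus>\<^bsub>A\<^esub> ?y) \<oplus>\<^bsub>A\<^esub> \<ominus>\<^bsub>A\<^esub> ?z"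
        unfolding eq using c by (simp only: A.a_assoc A.r_neg A.a_inv_closed A.r_zero)
      also have "(k \<otimes>\<^bsub>A\<^esub> ?v \<oplus>\<^bsub>A\<^esub> ?y) \<oplus>\<^bsub>A\<^esub> \<ominus>\<^bsub>A\<^esub> ?z \<oplus>\<^bsub>A\<^esub> \<ominus>\<^bsub>A\<^esub> (k \<otimes>\<^bsub>A\<^esub> ?v) = ?y \<oplus>\<^bsub>A\<^esub> \<ominus>\<^bsub>A\<^esub> ?z"
        using c by (simp only: A.a_assoc A.a_lcomm[of "k \<otimes>\<^bsub>A\<^esub> ?v"] A.a_comm[of "k \<otimes>\<^bsub>A\<^esub> ?v"]
          A.r_neg A.a_inv_closed A.a_closed A.l_neg A.r_zero A.l_zero)
      finally have "k \<otimes>\<^bsub>A\<^esub> (?u \<oplus>\<^bsub>A\<^esub> \<ominus>\<^bsub>A\<^esub> ?v) \<in> S" using rsubmodule_add[OF S yS zS] by simp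
      then have "?u \<oplus>\<^bsub>A\<^sub>R\<^esub> \<ominus>\<^bsub>A\<^sub>R\<^esub> ?v \<in> ?N" using uv by (simp add: minus)
      then have "?N +>\<^bsub>A\<^sub>R\<^esub> ?u = ?N +>\<^bsub>A\<^sub>R\<^esub> ?v"
        using AR.rcos_eq_iff[OF N, of ?u ?v] uv by (metis char_rmod_simps(1))
      moreover have "?g a \<triangleleft>\<^bsub>rmod_quot A\<^sub>R ?N\<^esub> r = ?N +>\<^bsub>A\<^sub>R\<^esub> ?v"
        using AR.rmod_quot_rsmult[OF N xa r] by (simp only: char_rmod_simps)
      moreover have "?g (a \<triangleleft>\<^bsub>A\<^sub>R\<^esub> r) = ?N +>\<^bsub>A\<^sub>R\<^esub> ?u" by (simp only: char_rmod_simps)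
      ultimately show ?thesis by metis
    qed
  qed
  from bspec[OF qp[unfolded quasi_projective_def, THEN spec, THEN mp, OF N] this]
  obtain h where h: "h \<in> rmod_hom R A\<^sub>R A\<^sub>R" "\<forall>a\<in>carrier A. ?g a = ?N +>\<^bsub>A\<^sub>R\<^esub> h a"
    unfolding char_rmod_simps by (rule bexE)
  \<comment> \<open>An endomorphism of \<open>A\<^sub>R\<close> is left multiplication by its value
    at \<open>\<one>\<close>; comparing it with \<open>?g\<close> there puts \<open>x - ?c\<close>
    into \<open>?N\<close>.\<close>
  let ?c = "h \<one>\<^bsub>A\<^esub>"
  have c: "?c \<in> \<B>" by (rule endomorphism_invariant[OF h(1)])
  then have cc: "?c \<in> carrier A" by simp
  have "?N +>\<^bsub>A\<^sub>R\<^esub> x = ?N +>\<^bsub>A\<^sub>R\<^esub> ?c" using bspec[OF h(2) A.one_closed] b(3) by simp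
  then have "x \<oplus>\<^bsub>A\<^sub>R\<^esub> \<ominus>\<^bsub>A\<^sub>R\<^esub> ?c \<in> ?N"
    using AR.rcos_eq_iff[OF N, of x ?c] b(3) cc by (metis char_rmod_simps(1))
  then have "k \<otimes>\<^bsub>A\<^esub> (x \<oplus>\<^bsub>A\<^esub> \<ominus>\<^bsub>A\<^esub> ?c) \<in> S" using cc by (simp add: minus)
  then have "k \<otimes>\<^bsub>A\<^esub> (x \<oplus>\<^bsub>A\<^esub> \<ominus>\<^bsub>A\<^esub> ?c) \<oplus>\<^bsub>A\<^esub> s \<in> S" using rsubmodule_add[OF S _ b(4)] by simp
  also have "k \<otimes>\<^bsub>A\<^esub> (x \<oplus>\<^bsub>A\<^esub> \<ominus>\<^bsub>A\<^esub> ?c) \<oplus>\<^bsub>A\<^esub> s = b \<ominus>\<^bsub>A\<^esub> k \<otimes>\<^bsub>A\<^esub> ?c"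
    unfolding b(2) a_minus_def using b(3) kc sc cc by (simp add: A.r_distr A.r_minus A.a_ac)
  finally show thesis using that c by blast
qed

text \<open>Dividing by the head \<open>k\<close> of the list of generators gives an invariant
  \<open>c\<close> with \<open>b - k c\<close> in the span of the tail. This difference is again
  invariant, hence in \<open>K\<close> by induction, and \<open>k c\<close> is in \<open>K\<close>
  as well.\<close>

lemma quasi_projective_contracting:
  assumes qp: "quasi_projective R A\<^sub>R"
  shows contracting
  unfolding contracting_def
proof (intro allI impI subsetI)
  fix K b assume K: "right_ideal B K" and b: "b \<in> AR.span_of K \<inter> \<B>"
  have KB: "K \<subseteq> \<B>" using right_ideal_subset[OF K] by simp
  have "b \<in> K" if "set ks \<subseteq> K" "b \<in> AR.list_span ks" "b \<in> \<B>" for ks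
    using that
  proof (induction ks arbitrary: b)
    case Nil then show ?case using right_ideal_zero[OF K] by simp
  next
    case (Cons k ks)
    have k: "k \<in> K" "k \<in> \<B>" using Cons.prems(1) KB by auto
    have S: "rsubmodule R A\<^sub>R (AR.list_span ks)"
      using Cons.prems(1) KB by (intro AR.rsubmodule_list_span) auto
    obtain r s where rs: "r \<in> carrier R" "s \<in> AR.list_span ks" "b = k \<triangleleft>\<^bsub>A\<^sub>R\<^esub> r \<oplus>\<^bsub>A\<^sub>R\<^esub> s"
      using Cons.prems(2) by (auto simp: set_add_def')
    have "b = k \<otimes>\<^bsub>A\<^esub> \<chi> r \<oplus>\<^bsub>A\<^esub> s" using rs k by (simp add: invariant_\<chi>)
    then obtain c where c: "c \<in> \<B>" "b \<ominus>\<^bsub>A\<^esub> k \<otimes>\<^bsub>A\<^esub> c \<in> AR.list_span ks"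
      using quasi_projective_division[OF qp k(2) S Cons.prems(3), of "\<chi> r" s] rs by auto
    have kc: "k \<otimes>\<^bsub>A\<^esub> c \<in> K" using right_ideal_mult[OF K k(1)] c(1) by simp
    then have "k \<otimes>\<^bsub>A\<^esub> c \<in> \<B>" using KB by blast
    moreover have "\<ominus>\<^bsub>A\<^esub> (k \<otimes>\<^bsub>A\<^esub> c) \<in> \<B>" using subringE(5)[OF subring_invariants calculation] .
    ultimately have "b \<ominus>\<^bsub>A\<^esub> k \<otimes>\<^bsub>A\<^esub> c \<in> \<B>"
      using subringE(7)[OF subring_invariants Cons.prems(3)] by (simp add: a_minus_def)
    then have "b \<ominus>\<^bsub>A\<^esub> k \<otimes>\<^bsub>A\<^esub> c \<in> K" using Cons.IH c(2) Cons.prems(1) by simp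
    then have "(b \<ominus>\<^bsub>A\<^esub> k \<otimes>\<^bsub>A\<^esub> c) \<oplus>\<^bsub>A\<^esub> k \<otimes>\<^bsub>A\<^esub> c \<in> K" using right_ideal_add[OF K _ kc] by simp
    also have "(b \<ominus>\<^bsub>A\<^esub> k \<otimes>\<^bsub>A\<^esub> c) \<oplus>\<^bsub>A\<^esub> k \<otimes>\<^bsub>A\<^esub> c = b"
      using Cons.prems(3) \<open>k \<otimes>\<^bsub>A\<^esub> c \<in> \<B>\<close> by (simp add: a_minus_def A.a_assoc A.l_neg del: A.m_closed)
    finally show ?case .
  qed
  then show "b \<in> K" using b by (auto elim: AR.span_ofE)
qed

text \<open>\<open>\<chi>\<close> maps the regular module \<open>R\<close>-linearly onto
  \<open>A\<^sub>R\<close>, so it has a section \<open>\<sigma>\<close>, and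
  \<open>t = \<sigma> \<one>\<close>. The product \<open>t r = \<sigma> (\<chi> r)\<close> depends
  on \<open>r\<close> only through \<open>\<chi> r\<close>, which \<open>i (\<chi> r)\<close>
  shares.\<close>

lemma projective_section:
  assumes "projective R A\<^sub>R"
  obtains t where "t \<in> carrier R" "\<chi> t = \<one>\<^bsub>A\<^esub>" "\<And>r. r \<in> carrier R \<Longrightarrow> t \<otimes>\<^bsub>R\<^esub> r = t \<otimes>\<^bsub>R\<^esub> i (\<chi> r)"
proof -
  have reg: "right_module R (regular_bimod R)"
    using regular_bimodule[OF R.ring_axioms] by (simp add: bimodule_def)
  have p: "\<chi> \<in> rmod_hom R (regular_bimod R) A\<^sub>R" by (auto simp: rmod_hom_def)
  have "a \<in> \<chi> ` carrier R" if "a \<in> carrier A" for a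
    using that by (intro image_eqI[of _ _ "i a"]) auto
  then have surj: "\<chi> ` carrier (regular_bimod R) = carrier A\<^sub>R" by auto
  have "(\<lambda>a. a) \<in> rmod_hom R A\<^sub>R A\<^sub>R" by (auto simp: rmod_hom_def)
  then obtain \<sigma> where \<sigma>: "\<sigma> \<in> rmod_hom R A\<^sub>R (regular_bimod R)" "\<And>a. a \<in> carrier A \<Longrightarrow> \<chi> (\<sigma> a) = a"
    using projective_lifting[OF assms reg AR.right_module_axioms p surj, of "\<lambda>a. a"]
    by (metis char_rmod_simps(1))
  have act: "\<sigma> \<one>\<^bsub>A\<^esub> \<otimes>\<^bsub>R\<^esub> r = \<sigma> (\<chi> r)" if "r \<in> carrier R" for r
    using rmod_homD(3)[OF \<sigma>(1), of "\<one>\<^bsub>A\<^esub>" r] that by simp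
  show thesis
  proof (rule that)
    show "\<sigma> \<one>\<^bsub>A\<^esub> \<in> carrier R" using rmod_homD(1)[OF \<sigma>(1), of "\<one>\<^bsub>A\<^esub>"] by simp
    show "\<chi> (\<sigma> \<one>\<^bsub>A\<^esub>) = \<one>\<^bsub>A\<^esub>" using \<sigma>(2) by simp
    show "\<sigma> \<one>\<^bsub>A\<^esub> \<otimes>\<^bsub>R\<^esub> r = \<sigma> \<one>\<^bsub>A\<^esub> \<otimes>\<^bsub>R\<^esub> i (\<chi> r)" if "r \<in> carrier R" for r
      using act[OF that] act[of "i (\<chi> r)"] that by simp
  qed
qed

end

text \<open>A section of \<open>\<chi>\<close> is given by an element \<open>t\<close>, and \<open>a \<mapsto> \<chi> (a t)\<close> is then a retraction of \<open>A\<close> onto the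
  invariants.\<close>

locale split_grouplike_extension = grouplike_extension A R i \<chi>
  for A :: "('a, 'x) ring_scheme" and R :: "('r, 'y) ring_scheme" and i \<chi> +
  fixes t
  assumes t_closed [simp]: "t \<in> carrier R" and \<chi>_t [simp]: "\<chi> t = \<one>\<^bsub>A\<^esub>"
    and t_mult: "r \<in> carrier R \<Longrightarrow> t \<otimes>\<^bsub>R\<^esub> r = t \<otimes>\<^bsub>R\<^esub> i (\<chi> r)"
begin

definition trace :: "'a \<Rightarrow> 'a"
  where "trace a = \<chi> (i a \<otimes>\<^bsub>R\<^esub> t)"

text \<open>By \<open>t_mult\<close>, the \<open>r\<close> in \<open>\<chi> (i a t r)\<close> may be
  replaced by \<open>i (\<chi> r)\<close>, which right linearity of \<open>\<chi>\<close> pulls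
  out.\<close>

lemma trace_invariant:
  assumes "a \<in> carrier A" shows "trace a \<in> \<B>"
proof (rule invariantI)
  show "trace a \<in> carrier A" using assms by (simp add: trace_def)
  fix r assume r: "r \<in> carrier R"
  have "\<chi> (i (trace a) \<otimes>\<^bsub>R\<^esub> r) = \<chi> (i a \<otimes>\<^bsub>R\<^esub> (t \<otimes>\<^bsub>R\<^esub> r))"
    using assms r by (simp add: trace_def R.m_assoc)
  also have "\<dots> = \<chi> (i a \<otimes>\<^bsub>R\<^esub> t \<otimes>\<^bsub>R\<^esub> i (\<chi> r))"
    unfolding t_mult[OF r] using assms r by (subst R.m_assoc) simp_all
  also have "\<dots> = trace a \<otimes>\<^bsub>A\<^esub> \<chi> r" using assms r by (simp add: trace_def)
  finally show "trace a \<otimes>\<^bsub>A\<^esub> \<chi> r = \<chi> (i (trace a) \<otimes>\<^bsub>R\<^esub> r)" by simp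
qed

text \<open>The trace commutes with left multiplication by invariants, so it maps \<open>K A\<close>
  into \<open>K\<close>; as \<open>\<chi> t = \<one>\<close>, it fixes every invariant.\<close>

lemma contracting: contracting
  unfolding contracting_def
proof (intro allI impI subsetI)
  fix K b assume K: "right_ideal B K" and b: "b \<in> AR.span_of K \<inter> \<B>"
  have KB: "K \<subseteq> \<B>" using right_ideal_subset[OF K] by simp
  have "a \<in> carrier A \<and> trace a \<in> K" if "set ks \<subseteq> K" "a \<in> AR.list_span ks" for ks a
    using that
  proof (induction ks arbitrary: a)
    case Nil
    have "i \<zero>\<^bsub>A\<^esub> = \<zero>\<^bsub>R\<^esub>" using i_hom A.ring_axioms R.ring_axioms ring_hom_zero by metis
    moreover have "\<chi> \<zero>\<^bsub>R\<^esub> = \<zero>\<^bsub>A\<^esub>" using \<chi>_i[of "\<zero>\<^bsub>A\<^esub>"] calculation by simp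
    ultimately show ?case using Nil right_ideal_zero[OF K] by (simp add: trace_def)
  next
    case (Cons k ks)
    obtain r s where rs: "r \<in> carrier R" "s \<in> AR.list_span ks" "a = k \<triangleleft>\<^bsub>A\<^sub>R\<^esub> r \<oplus>\<^bsub>A\<^sub>R\<^esub> s"
      using Cons.prems(2) by (auto simp: set_add_def')
    have s: "s \<in> carrier A" "trace s \<in> K" using Cons.IH rs(2) Cons.prems(1) by auto
    have k: "k \<in> K" "k \<in> \<B>" using Cons.prems(1) KB by auto
    have a: "a = k \<otimes>\<^bsub>A\<^esub> \<chi> r \<oplus>\<^bsub>A\<^esub> s" using rs k by (simp add: invariant_\<chi>)
    have "trace a = k \<otimes>\<^bsub>A\<^esub> trace (\<chi> r) \<oplus>\<^bsub>A\<^esub> trace s"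
      unfolding a trace_def using k s rs(1) invariant_act[OF k(2), of "\<chi> r" t]
      by (simp add: R.l_distr)
    moreover have "k \<otimes>\<^bsub>A\<^esub> trace (\<chi> r) \<in> K"
      using right_ideal_mult[OF K k(1), of "trace (\<chi> r)"] trace_invariant rs(1) by simp
    ultimately show ?case using right_ideal_add[OF K _ s(2)] a k s(1) rs(1) by simp
  qed
  then have "trace b \<in> K" using b by (auto elim: AR.span_ofE)
  moreover have "trace b = b" using b by (simp add: trace_def invariant_\<chi>)
  ultimately show "b \<in> K" by simp
qed

end

section \<open>Maps out of tensor products\<close>

lemma finsum_additive:
  assumes "abelian_group G" "abelian_group H" "h \<in> carrier G \<rightarrow> carrier H"
    and add: "\<And>x y. \<lbrakk>x \<in> carrier G; y \<in> carrier G\<rbrakk> \<Longrightarrow> h (x \<oplus>\<^bsub>G\<^esub> y) = h x \<oplus>\<^bsub>H\<^esub> h y"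
    and "finite S" "c \<in> S \<rightarrow> carrier G"
  shows "h (finsum G c S) = finsum H (\<lambda>k. h (c k)) S"
  using assms(5,6)
proof (induction S rule: finite_induct)
  case empty
  interpret G: abelian_group G by fact
  interpret H: abelian_group H by fact
  have "h \<zero>\<^bsub>G\<^esub> \<oplus>\<^bsub>H\<^esub> h \<zero>\<^bsub>G\<^esub> = h \<zero>\<^bsub>G\<^esub>" "h \<zero>\<^bsub>G\<^esub> \<in> carrier H"
    using add[of "\<zero>\<^bsub>G\<^esub>" "\<zero>\<^bsub>G\<^esub>"] assms(3) by (auto dest: funcset_mem)
  then show ?case using H.add.r_cancel_one' by simp
next
  case (insert x S)
  interpret G: abelian_group G by fact
  interpret H: abelian_group H by fact
  have "finsum G c S \<in> carrier G" "c x \<in> carrier G" using insert.prems by auto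
  moreover have "(\<lambda>k. h (c k)) \<in> S \<rightarrow> carrier H" "h (c x) \<in> carrier H"
    using insert.prems assms(3) by (auto simp: Pi_iff)
  ultimately show ?case using insert add by auto
qed

lemma finsum_image:
  assumes "abelian_group G" "abelian_group H" "h \<in> carrier G \<rightarrow> carrier H"
    and "\<And>x y. \<lbrakk>x \<in> carrier G; y \<in> carrier G\<rbrakk> \<Longrightarrow> h (x \<oplus>\<^bsub>G\<^esub> y) = h x \<oplus>\<^bsub>H\<^esub> h y"
    and "finite S" and c: "\<And>k. k \<in> S \<Longrightarrow> c k \<in> carrier G" and d: "\<And>k. k \<in> S \<Longrightarrow> h (c k) = d k"
  shows "h (finsum G c S) = finsum H d S"
proof -
  interpret H: abelian_group H by fact
  have "h (finsum G c S) = finsum H (\<lambda>k. h (c k)) S"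
    using c by (intro finsum_additive assms) auto
  also have "\<dots> = finsum H d S"
    using c d assms(3) by (intro H.finsum_cong') (force simp: Pi_iff)+
  finally show ?thesis .
qed

context tensor_bimodules
begin

sublocale T: bimodule A T
  by (rule bimodule_tensor)

abbreviation "pure \<equiv> pure_tensor A M N"

lemma pure_tensor_add_left:
  assumes "x \<in> carrier M" "x' \<in> carrier M" "y \<in> carrier N"
  shows "pure (x \<oplus>\<^bsub>M\<^esub> x') y = pure x y \<oplus>\<^bsub>T\<^esub> pure x' y"
  unfolding pure_tensor_def add_coset[OF frag_of_closed[OF assms(1,3)] frag_of_closed[OF assms(2,3)]]
  using assms rel1[OF assms]
  by (intro coset_eqI tensor_free_add frag_of_closed M.M.a_closed) (simp_all add: diff_diff_add)

lemma pure_tensor_add_right: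
  assumes "x \<in> carrier M" "y \<in> carrier N" "y' \<in> carrier N"
  shows "pure x (y \<oplus>\<^bsub>N\<^esub> y') = pure x y \<oplus>\<^bsub>T\<^esub> pure x y'"
  unfolding pure_tensor_def add_coset[OF frag_of_closed[OF assms(1,2)] frag_of_closed[OF assms(1,3)]]
  using assms rel2[OF assms]
  by (intro coset_eqI tensor_free_add frag_of_closed N.M.a_closed) (simp_all add: diff_diff_add)

text \<open>Serves as an induction principle: a property is extended from pure tensors to all
  tensors by showing that it cuts out a submodule.\<close>

lemma pure_tensors_generate:
  assumes S: "rsubmodule A T S" and pure: "\<And>x y. \<lbrakk>x \<in> carrier M; y \<in> carrier N\<rbrakk> \<Longrightarrow> pure x y \<in> S"
  shows "carrier T \<subseteq> S"
proof
  fix X assume "X \<in> carrier T"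
  then obtain c where c: "c \<in> carrier F" "X = K #>\<^bsub>F\<^esub> c" by (auto simp: carrier_tensor)
  have "Poly_Mapping.keys c \<subseteq> carrier M \<times> carrier N" using c(1) by simp
  then have "c \<in> carrier F \<and> K #>\<^bsub>F\<^esub> c \<in> S"
  proof (induction c rule: frag_induction)
    case zero
    have "K #>\<^bsub>F\<^esub> \<one>\<^bsub>F\<^esub> = K"
      using F.coset_mult_one subgroup.subset[OF K_subgroup] by blast
    moreover have "\<zero>\<^bsub>T\<^esub> = K" by (simp add: tensor_def Let_def FactGroup_def)
    ultimately show ?case using rsubmodule_zero[OF S] by simp
  next
    case (one z)
    then obtain x y where z: "z = (x, y)" "x \<in> carrier M" "y \<in> carrier N" by blast
    then show ?case using pure[OF z(2,3)] frag_of_closed by (simp add: pure_tensor_def)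
  next
    case (diff a b)
    have ab: "a - b \<in> carrier F" using diff tensor_free_diff by blast
    have "(K #>\<^bsub>F\<^esub> b) \<oplus>\<^bsub>T\<^esub> (K #>\<^bsub>F\<^esub> (a - b)) = K #>\<^bsub>F\<^esub> a"
      using add_coset[of b "a - b"] diff ab by simp
    moreover have "K #>\<^bsub>F\<^esub> (a - b) \<in> carrier T" unfolding carrier_tensor using ab by (rule imageI)
    ultimately have "K #>\<^bsub>F\<^esub> (a - b) \<in> S"
      using T.rsubmodule_add_cancel[OF S, of "K #>\<^bsub>F\<^esub> b"] diff by metis
    then show ?case using ab by blast
  qed
  then show "X \<in> S" using c(2) by blast
qed

text \<open>The additive extension to the free group kills the relators, hence \<open>K\<close>, and
  so is constant on cosets. The target is just an abelian group because maps such as \<open>X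
  \<otimes> s \<mapsto> X \<triangleleft> \<nu>(s \<otimes> v)\<close> need not be right linear over
  \<open>A\<close>.\<close>

lemma tensor_lift:
  fixes G :: "('g, 'w) ring_scheme"
  assumes "abelian_group G"
    and closed: "\<And>x y. \<lbrakk>x \<in> carrier M; y \<in> carrier N\<rbrakk> \<Longrightarrow> \<beta> x y \<in> carrier G"
    and add_left: "\<And>x x' y. \<lbrakk>x \<in> carrier M; x' \<in> carrier M; y \<in> carrier N\<rbrakk>
      \<Longrightarrow> \<beta> (x \<oplus>\<^bsub>M\<^esub> x') y = \<beta> x y \<oplus>\<^bsub>G\<^esub> \<beta> x' y"
    and add_right: "\<And>x y y'. \<lbrakk>x \<in> carrier M; y \<in> carrier N; y' \<in> carrier N\<rbrakk>
      \<Longrightarrow> \<beta> x (y \<oplus>\<^bsub>N\<^esub> y') = \<beta> x y \<oplus>\<^bsub>G\<^esub> \<beta> x y'"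
    and balanced: "\<And>x a y. \<lbrakk>x \<in> carrier M; a \<in> carrier A; y \<in> carrier N\<rbrakk>
      \<Longrightarrow> \<beta> (x \<triangleleft>\<^bsub>M\<^esub> a) y = \<beta> x (a \<triangleright>\<^bsub>N\<^esub> y)"
  obtains h where "h \<in> carrier T \<rightarrow> carrier G"
    and "\<And>X Y. \<lbrakk>X \<in> carrier T; Y \<in> carrier T\<rbrakk> \<Longrightarrow> h (X \<oplus>\<^bsub>T\<^esub> Y) = h X \<oplus>\<^bsub>G\<^esub> h Y"
    and "\<And>x y. \<lbrakk>x \<in> carrier M; y \<in> carrier N\<rbrakk> \<Longrightarrow> h (pure x y) = \<beta> x y"
proof -
  interpret G: abelian_group G by fact
  have "case_prod \<beta> ` (carrier M \<times> carrier N) \<subseteq> carrier (add_monoid G)" using closed by auto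
  then obtain k where k: "k \<in> hom F (add_monoid G)"
      "\<And>z. z \<in> carrier M \<times> carrier N \<Longrightarrow> k (frag_of z) = case_prod \<beta> z"
    using comm_group.free_Abelian_group_universal[OF G.a_comm_group, of "case_prod \<beta>"] by blast
  interpret k: group_hom F "add_monoid G" k
    using k(1) F.is_group G.a_group by (simp add: group_hom_def group_hom_axioms_def)
  have kF: "k c \<in> carrier G" if "c \<in> carrier F" for c using k.hom_closed[OF that] by simp
  have k_diff: "k (c - d) = k c \<oplus>\<^bsub>G\<^esub> \<ominus>\<^bsub>G\<^esub> k d" if c: "c \<in> carrier F" and d: "d \<in> carrier F" for c d
  proof -
    have "k (c - d) \<oplus>\<^bsub>G\<^esub> k d = k c"
      using k.hom_mult[OF tensor_free_diff[OF c d] d] by simp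
    then show ?thesis using kF[OF c] kF[OF d] kF[OF tensor_free_diff[OF c d]]
      by (metis G.a_inv_closed G.add.m_assoc G.r_neg G.r_zero)
  qed
  have kp: "k (frag_of (x, y)) = \<beta> x y" if "x \<in> carrier M" "y \<in> carrier N" for x y
    using k(2)[of "(x, y)"] that by simp
  have fc: "frag_of (x, y) \<in> carrier F" if "x \<in> carrier M" "y \<in> carrier N" for x y
    using that by (rule frag_of_closed)
  have rel: "k d = \<zero>\<^bsub>G\<^esub>" if "d \<in> tensor_relators A M N" for d
    using that unfolding tensor_relators_def
  proof (elim UnE CollectE exE conjE)
    fix x x' y assume d: "d = frag_of (x \<oplus>\<^bsub>M\<^esub> x', y) - frag_of (x, y) - frag_of (x', y)"
      and c: "x \<in> carrier M" "x' \<in> carrier M" "y \<in> carrier N"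
    have "k d = \<beta> x y \<oplus>\<^bsub>G\<^esub> \<beta> x' y \<oplus>\<^bsub>G\<^esub> \<ominus>\<^bsub>G\<^esub> \<beta> x y \<oplus>\<^bsub>G\<^esub> \<ominus>\<^bsub>G\<^esub> \<beta> x' y"
      unfolding d using c by (simp only: k_diff tensor_free_diff fc M.M.a_closed kp add_left)
    then show ?thesis using c closed
      by (simp add: G.a_assoc G.a_lcomm[of "\<beta> x' y"] G.r_neg G.a_comm[of "\<beta> x' y"] G.r_neg2)
  next
    fix x y y' assume d: "d = frag_of (x, y \<oplus>\<^bsub>N\<^esub> y') - frag_of (x, y) - frag_of (x, y')"
      and c: "x \<in> carrier M" "y \<in> carrier N" "y' \<in> carrier N"
    have "k d = \<beta> x y \<oplus>\<^bsub>G\<^esub> \<beta> x y' \<oplus>\<^bsub>G\<^esub> \<ominus>\<^bsub>G\<^esub> \<beta> x y \<oplus>\<^bsub>G\<^esub> \<ominus>\<^bsub>G\<^esub> \<beta> x y'"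
      unfolding d using c by (simp only: k_diff tensor_free_diff fc N.M.a_closed kp add_right)
    then show ?thesis using c closed
      by (simp add: G.a_assoc G.a_lcomm[of "\<beta> x y'"] G.r_neg G.a_comm[of "\<beta> x y'"] G.r_neg2)
  next
    fix x a y assume d: "d = frag_of (x \<triangleleft>\<^bsub>M\<^esub> a, y) - frag_of (x, a \<triangleright>\<^bsub>N\<^esub> y)"
      and c: "x \<in> carrier M" "a \<in> carrier A" "y \<in> carrier N"
    have "k d = \<beta> x (a \<triangleright>\<^bsub>N\<^esub> y) \<oplus>\<^bsub>G\<^esub> \<ominus>\<^bsub>G\<^esub> \<beta> x (a \<triangleright>\<^bsub>N\<^esub> y)"
      unfolding d using c by (simp only: k_diff fc M.rsmult_closed N.lsmult_closed kp balanced)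
    then show ?thesis using c closed by (simp add: G.r_neg)
  qed
  have "K \<subseteq> kernel F (add_monoid G) k"
    unfolding tensor_kernel_def
  proof (rule F.generate_subgroup_incl)
    show "tensor_relators A M N \<subseteq> kernel F (add_monoid G) k"
    proof
      fix d assume d: "d \<in> tensor_relators A M N"
      then have "d \<in> carrier F" using relators_carrier by blast
      then show "d \<in> kernel F (add_monoid G) k"
        using rel[OF d] by (simp add: kernel_def del: carrier_free_Abelian_group_iff)
    qed
  qed (rule k.subgroup_kernel)
  then have kK: "k d = \<zero>\<^bsub>G\<^esub>" if "d \<in> K" for d
    using that by (simp add: kernel_def subset_iff del: carrier_free_Abelian_group_iff)
  have const: "k c = k d" if cd: "c \<in> carrier F" "d \<in> carrier F" "K #>\<^bsub>F\<^esub> c = K #>\<^bsub>F\<^esub> d" for c d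
  proof -
    have "c \<in> K #>\<^bsub>F\<^esub> d" using F.rcos_self[OF cd(1) K_subgroup] cd(3) by simp
    then have "k c \<oplus>\<^bsub>G\<^esub> \<ominus>\<^bsub>G\<^esub> k d = \<zero>\<^bsub>G\<^esub>"
      using coset_memD(2)[OF _ cd(2)] kK k_diff[OF cd(1,2)] by metis
    then show ?thesis using G.minus_equality[of "k c" "\<ominus>\<^bsub>G\<^esub> k d"] kF[OF cd(1)] kF[OF cd(2)] by simp
  qed
  obtain h where h: "h \<in> hom (F Mod K) (add_monoid G)" "\<And>c. c \<in> carrier F \<Longrightarrow> h (K #>\<^bsub>F\<^esub> c) = k c"
    using FactGroup_universal[OF k(1) K_normal const] by blast
  show thesis
  proof
    show "h \<in> carrier T \<rightarrow> carrier G" using h(2) kF by (auto simp: carrier_tensor)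
    show "h (X \<oplus>\<^bsub>T\<^esub> Y) = h X \<oplus>\<^bsub>G\<^esub> h Y" if "X \<in> carrier T" "Y \<in> carrier T" for X Y
      using h(1) that by (simp add: tensor_def Let_def hom_def)
    show "h (pure x y) = \<beta> x y" if "x \<in> carrier M" "y \<in> carrier N" for x y
      unfolding pure_tensor_def using h(2)[OF fc[OF that]] kp[OF that] by simp
  qed
qed

text \<open>Tensors of generators suffice: a coefficient on the first factor can be pushed into the
  second, which carries the right action of the tensor product.\<close>

lemma tensor_finitely_generated:
  assumes "rmod_finitely_generated A M" "rmod_finitely_generated A N"
  shows "rmod_finitely_generated A T"
proof -
  obtain S where S: "finite S" "S \<subseteq> carrier M" "\<And>L. \<lbrakk>rsubmodule A M L; S \<subseteq> L\<rbrakk> \<Longrightarrow> carrier M \<subseteq> L"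
    using assms(1) unfolding rmod_finitely_generated_def by blast
  obtain S' where S': "finite S'" "S' \<subseteq> carrier N" "\<And>L. \<lbrakk>rsubmodule A N L; S' \<subseteq> L\<rbrakk> \<Longrightarrow> carrier N \<subseteq> L"
    using assms(2) unfolding rmod_finitely_generated_def by blast
  show ?thesis
  proof (rule T.rmod_finitely_generatedI)
    show "finite (case_prod pure ` (S \<times> S'))" using S(1) S'(1) by simp
    show "case_prod pure ` (S \<times> S') \<subseteq> carrier T" using S(2) S'(2) pure_tensor_closed by auto
    fix L assume L: "rsubmodule A T L" and gen: "case_prod pure ` (S \<times> S') \<subseteq> L"
    note L0 = rsubmodule_zero[OF L] and Ladd = rsubmodule_add[OF L] and Lmult = rsubmodule_rsmult[OF L]
    have pure_hom: "(\<lambda>y. pure x y) \<in> rmod_hom A N T" if "x \<in> carrier M" for x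
      using that by (auto simp: rmod_hom_def pure_tensor_closed pure_tensor_add_right pure_tensor_rsmult)
    have 1: "pure x y \<in> L" if x: "x \<in> S" and y: "y \<in> carrier N" for x y
    proof -
      have "x \<in> carrier M" using x S(2) by blast
      from rsubmodule_vimage[OF N.right_module_axioms T.right_module_axioms pure_hom[OF this] L]
      have "carrier N \<subseteq> {y \<in> carrier N. pure x y \<in> L}" by (rule S'(3)) (use S'(2) gen x in auto)
      then show ?thesis using y by blast
    qed
    \<comment> \<open>The second variable had to be exhausted first: closure under
      \<open>x \<triangleleft> a\<close> needs \<open>pure x (a \<triangleright> y)\<close> in
      \<open>L\<close>, where \<open>a \<triangleright> y\<close> is in general no
      generator.\<close>
    have "rsubmodule A M {x \<in> carrier M. \<forall>y\<in>carrier N. pure x y \<in> L}"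
    proof (rule M.rsubmoduleI)
      have "pure \<zero>\<^bsub>M\<^esub> y \<in> L" if y: "y \<in> carrier N" for y
      proof -
        have "pure \<zero>\<^bsub>M\<^esub> y \<oplus>\<^bsub>T\<^esub> pure \<zero>\<^bsub>M\<^esub> y = pure \<zero>\<^bsub>M\<^esub> y"
          using pure_tensor_add_left[of "\<zero>\<^bsub>M\<^esub>" "\<zero>\<^bsub>M\<^esub>" y] y by simp
        then have "pure \<zero>\<^bsub>M\<^esub> y = \<zero>\<^bsub>T\<^esub>"
          using pure_tensor_closed[of "\<zero>\<^bsub>M\<^esub>" y] y T.M.add.r_cancel_one' by simp
        then show ?thesis using L0 by simp
      qed
      then show "\<zero>\<^bsub>M\<^esub> \<in> {x \<in> carrier M. \<forall>y\<in>carrier N. pure x y \<in> L}" by simp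
      show "x \<triangleleft>\<^bsub>M\<^esub> a \<in> {x \<in> carrier M. \<forall>y\<in>carrier N. pure x y \<in> L}"
        if "x \<in> {x \<in> carrier M. \<forall>y\<in>carrier N. pure x y \<in> L}" "a \<in> carrier A" for x a
        using that by (auto simp: pure_tensor_balanced)
      show "x \<oplus>\<^bsub>M\<^esub> x' \<in> {x \<in> carrier M. \<forall>y\<in>carrier N. pure x y \<in> L}"
        if "x \<in> {x \<in> carrier M. \<forall>y\<in>carrier N. pure x y \<in> L}"
          "x' \<in> {x \<in> carrier M. \<forall>y\<in>carrier N. pure x y \<in> L}" for x x'
        using that Ladd by (auto simp: pure_tensor_add_left)
    qed auto
    then have "carrier M \<subseteq> {x \<in> carrier M. \<forall>y\<in>carrier N. pure x y \<in> L}"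
      by (rule S(3)) (use S(2) 1 in auto)
    then show "carrier T \<subseteq> L" by (intro pure_tensors_generate[OF L]) blast
  qed
qed

end

section \<open>Invertible bimodules\<close>

lemma (in bimodule) lsmult_zero_left [simp]:
  assumes "x \<in> carrier M" shows "\<zero>\<^bsub>A\<^esub> \<triangleright>\<^bsub>M\<^esub> x = \<zero>\<^bsub>M\<^esub>"
  using lsmult_add_left[of "\<zero>\<^bsub>A\<^esub>" "\<zero>\<^bsub>A\<^esub>" x] assms M.add.r_cancel_one' by simp

text \<open>One of the two maps of a Morita context; both \<open>f\<close> and \<open>g\<close>
  become instances. The image of \<open>f\<close> is a right ideal, so \<open>f_one\<close> amounts
  to surjectivity.\<close>

locale evaluation = tensor_bimodules A M N
  for A :: "('a, 'x) ring_scheme" (structure) and M :: "('a, 'm, 'y) bimod_scheme" (structure)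
    and N :: "('a, 'n, 'z) bimod_scheme" (structure) +
  fixes f
  assumes f_hom: "f \<in> bimod_hom A (tensor A M N) (regular_bimod A)"
    and f_one: "\<one>\<^bsub>A\<^esub> \<in> f ` carrier (tensor A M N)"
begin

abbreviation "ev x y \<equiv> f (pure x y)"

lemma f_simps:
  "X \<in> carrier T \<Longrightarrow> f X \<in> carrier A"
  "\<lbrakk>X \<in> carrier T; Y \<in> carrier T\<rbrakk> \<Longrightarrow> f (X \<oplus>\<^bsub>T\<^esub> Y) = f X \<oplus>\<^bsub>A\<^esub> f Y"
  "\<lbrakk>X \<in> carrier T; a \<in> carrier A\<rbrakk> \<Longrightarrow> f (X \<triangleleft>\<^bsub>T\<^esub> a) = f X \<otimes>\<^bsub>A\<^esub> a"
  "\<lbrakk>X \<in> carrier T; a \<in> carrier A\<rbrakk> \<Longrightarrow> f (a \<triangleright>\<^bsub>T\<^esub> X) = a \<otimes>\<^bsub>A\<^esub> f X"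
  using f_hom by (auto simp: bimod_hom_def rmod_hom_def)

lemma f_zero: "f \<zero>\<^bsub>T\<^esub> = \<zero>\<^bsub>A\<^esub>"
proof -
  have "f \<in> rmod_hom A T (regular_bimod A)" using f_hom by (simp add: bimod_hom_def)
  then show ?thesis
    using rmod_hom_zero[OF T.right_module_axioms] regular_bimodule[OF M.R.ring_axioms]
    by (fastforce simp: bimodule_def)
qed

lemma ev_simps:
  "\<lbrakk>x \<in> carrier M; y \<in> carrier N\<rbrakk> \<Longrightarrow> ev x y \<in> carrier A"
  "\<lbrakk>x \<in> carrier M; x' \<in> carrier M; y \<in> carrier N\<rbrakk> \<Longrightarrow> ev (x \<oplus>\<^bsub>M\<^esub> x') y = ev x y \<oplus>\<^bsub>A\<^esub> ev x' y"
  "\<lbrakk>x \<in> carrier M; y \<in> carrier N; y' \<in> carrier N\<rbrakk> \<Longrightarrow> ev x (y \<oplus>\<^bsub>N\<^esub> y') = ev x y \<oplus>\<^bsub>A\<^esub> ev x y'"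
  "\<lbrakk>x \<in> carrier M; y \<in> carrier N; a \<in> carrier A\<rbrakk> \<Longrightarrow> ev (x \<triangleleft>\<^bsub>M\<^esub> a) y = ev x (a \<triangleright>\<^bsub>N\<^esub> y)"
  "\<lbrakk>x \<in> carrier M; y \<in> carrier N; a \<in> carrier A\<rbrakk> \<Longrightarrow> ev (a \<triangleright>\<^bsub>M\<^esub> x) y = a \<otimes>\<^bsub>A\<^esub> ev x y"
  "\<lbrakk>x \<in> carrier M; y \<in> carrier N; a \<in> carrier A\<rbrakk> \<Longrightarrow> ev x (y \<triangleleft>\<^bsub>N\<^esub> a) = ev x y \<otimes>\<^bsub>A\<^esub> a"
  by (simp_all add: pure_tensor_add_left pure_tensor_add_right pure_tensor_balanced
      pure_tensor_lsmult[symmetric] pure_tensor_rsmult[symmetric] f_simps pure_tensor_closed)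

text \<open>Stands in for writing \<open>\<one>\<close> as a finite sum of values
  \<open>ev x y\<close>.\<close>

lemma values_generate:
  assumes S: "rsubmodule A T S" and pure: "\<And>x y. \<lbrakk>x \<in> carrier M; y \<in> carrier N\<rbrakk> \<Longrightarrow> pure x y \<in> S"
  obtains X where "X \<in> S" "X \<in> carrier T" "f X = \<one>\<^bsub>A\<^esub>"
proof -
  obtain X where X: "X \<in> carrier T" "f X = \<one>\<^bsub>A\<^esub>" using f_one by auto
  then show thesis using that pure_tensors_generate[OF S pure] by blast
qed

text \<open>As \<open>a\<close> times \<open>ev x y\<close> is \<open>ev (a x) y\<close>, the
  elements \<open>a\<close> and \<open>b\<close> agree as multipliers on all values of
  \<open>f\<close>, in particular on \<open>\<one>\<close>.\<close>

lemma left_faithful: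
  assumes a: "a \<in> carrier A" "b \<in> carrier A" and eq: "\<And>x. x \<in> carrier M \<Longrightarrow> a \<triangleright>\<^bsub>M\<^esub> x = b \<triangleright>\<^bsub>M\<^esub> x"
  shows "a = b"
proof -
  let ?S = "{X \<in> carrier T. a \<otimes>\<^bsub>A\<^esub> f X = b \<otimes>\<^bsub>A\<^esub> f X}"
  have S: "rsubmodule A T ?S"
    using a by (intro T.rsubmoduleI) (auto simp: f_zero f_simps M.R.r_distr M.R.m_assoc[symmetric])
  have "pure x y \<in> ?S" if "x \<in> carrier M" "y \<in> carrier N" for x y
    using that a eq[of x] ev_simps(5)[of x y a] ev_simps(5)[of x y b] by (simp add: pure_tensor_closed)
  then obtain X where "X \<in> ?S" "f X = \<one>\<^bsub>A\<^esub>" using values_generate[OF S] by blast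
  then show ?thesis using a by simp
qed

text \<open>If \<open>\<one>\<close> is the sum of \<open>ev x_j y_j\<close>, every
  \<open>x'\<close> is the sum of \<open>ev x_j y_j \<triangleright> x' = x_j \<triangleleft> g y_j
  x'\<close>, so the \<open>x_j\<close> generate. In place of the sum, \<open>P X S\<close> records
  that \<open>S\<close> generates all \<open>f X \<triangleright> x\<close>.\<close>

lemma left_finitely_generated:
  assumes g: "\<And>y x'. \<lbrakk>y \<in> carrier N; x' \<in> carrier M\<rbrakk> \<Longrightarrow> g y x' \<in> carrier A"
    and assoc: "\<And>x y x'. \<lbrakk>x \<in> carrier M; y \<in> carrier N; x' \<in> carrier M\<rbrakk> \<Longrightarrow> ev x y \<triangleright>\<^bsub>M\<^esub> x' = x \<triangleleft>\<^bsub>M\<^esub> g y x'"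
  shows "rmod_finitely_generated A M"
proof -
  define P where "P X S \<longleftrightarrow> finite S \<and> S \<subseteq> carrier M \<and>
    (\<forall>L. rsubmodule A M L \<longrightarrow> S \<subseteq> L \<longrightarrow> (\<forall>x\<in>carrier M. f X \<triangleright>\<^bsub>M\<^esub> x \<in> L))" for X S
  let ?S = "{X \<in> carrier T. \<exists>S. P X S}"
  have "rsubmodule A T ?S"
  proof (rule T.rsubmoduleI)
    have "P \<zero>\<^bsub>T\<^esub> {}" by (simp add: P_def f_zero rsubmodule_zero)
    then show "\<zero>\<^bsub>T\<^esub> \<in> ?S" by blast
    show "X \<oplus>\<^bsub>T\<^esub> Y \<in> ?S" if XY: "X \<in> ?S" "Y \<in> ?S" for X Y
    proof -
      obtain S S' where "P X S" "P Y S'" using XY by blast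
      then have "P (X \<oplus>\<^bsub>T\<^esub> Y) (S \<union> S')"
        using XY by (auto simp: P_def f_simps M.lsmult_add_left intro: rsubmodule_add)
      then show ?thesis using XY T.M.a_closed by blast
    qed
    show "X \<triangleleft>\<^bsub>T\<^esub> a \<in> ?S" if X: "X \<in> ?S" and a: "a \<in> carrier A" for X a
    proof -
      obtain S where S: "P X S" using X by blast
      have "f (X \<triangleleft>\<^bsub>T\<^esub> a) \<triangleright>\<^bsub>M\<^esub> x = f X \<triangleright>\<^bsub>M\<^esub> (a \<triangleright>\<^bsub>M\<^esub> x)" if "x \<in> carrier M" for x
        using X a that by (simp add: f_simps M.lsmult_assoc)
      then have "P (X \<triangleleft>\<^bsub>T\<^esub> a) S" using S a by (simp add: P_def)
      then show ?thesis using X a T.rsmult_closed by blast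
    qed
  qed auto
  moreover have "pure x y \<in> ?S" if "x \<in> carrier M" "y \<in> carrier N" for x y
  proof -
    have "P (pure x y) {x}" using that g assoc by (auto simp: P_def intro: rsubmodule_rsmult)
    then show ?thesis using that pure_tensor_closed by blast
  qed
  ultimately obtain X where "X \<in> ?S" "f X = \<one>\<^bsub>A\<^esub>" by (rule values_generate)
  then obtain S where S: "finite S" "S \<subseteq> carrier M"
      "\<And>L x. \<lbrakk>rsubmodule A M L; S \<subseteq> L; x \<in> carrier M\<rbrakk> \<Longrightarrow> \<one>\<^bsub>A\<^esub> \<triangleright>\<^bsub>M\<^esub> x \<in> L"
    by (auto simp: P_def)
  show ?thesis by (rule M.rmod_finitely_generatedI[OF S(1,2)]) (use S(3) in auto)
qed

end

section \<open>Frobenius extensions\<close>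

locale Frobenius_system = A: ring A + R: ring R + I: bimodule A I
  for A :: "('a, 'x) ring_scheme" and R :: "('r, 'y) ring_scheme"
    and I :: "('a, 'i, 'z) bimod_scheme" +
  fixes i :: "'a \<Rightarrow> 'r" and n :: nat and p u q \<nu>
  assumes i_hom: "i \<in> ring_hom A R"
    and pqu [simp]: "k < n \<Longrightarrow> p k \<in> carrier R" "k < n \<Longrightarrow> u k \<in> carrier I" "k < n \<Longrightarrow> q k \<in> carrier R"
    and \<nu>: "\<nu> \<in> bimod_hom A (tensor A (ring_bimod R i) I) (regular_bimod A)"
    and Casimir: "r \<in> carrier R \<Longrightarrow>
      (\<Oplus>\<^bsub>tensor A (tensor A (ring_bimod R i) I) (ring_bimod R i)\<^esub>k\<in>{..<n}.
        pure_tensor A (tensor A (ring_bimod R i) I) (ring_bimod R i)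
          (pure_tensor A (ring_bimod R i) I (r \<otimes>\<^bsub>R\<^esub> p k) (u k)) (q k)) =
      (\<Oplus>\<^bsub>tensor A (tensor A (ring_bimod R i) I) (ring_bimod R i)\<^esub>k\<in>{..<n}.
        pure_tensor A (tensor A (ring_bimod R i) I) (ring_bimod R i)
          (pure_tensor A (ring_bimod R i) I (p k) (u k)) (q k \<otimes>\<^bsub>R\<^esub> r))"
    and counit: "v \<in> carrier I \<Longrightarrow>
      (\<Oplus>\<^bsub>tensor A (ring_bimod R i) I\<^esub>k\<in>{..<n}.
        pure_tensor A (ring_bimod R i) I (p k)
          (u k \<triangleleft>\<^bsub>I\<^esub> \<nu> (pure_tensor A (ring_bimod R i) I (q k) v))) =
      pure_tensor A (ring_bimod R i) I \<one>\<^bsub>R\<^esub> v"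
begin

lemma i_simps [simp]:
  "a \<in> carrier A \<Longrightarrow> i a \<in> carrier R"
  "\<lbrakk>a \<in> carrier A; b \<in> carrier A\<rbrakk> \<Longrightarrow> i (a \<oplus>\<^bsub>A\<^esub> b) = i a \<oplus>\<^bsub>R\<^esub> i b"
  "\<lbrakk>a \<in> carrier A; b \<in> carrier A\<rbrakk> \<Longrightarrow> i (a \<otimes>\<^bsub>A\<^esub> b) = i a \<otimes>\<^bsub>R\<^esub> i b"
  "i \<one>\<^bsub>A\<^esub> = \<one>\<^bsub>R\<^esub>"
  using i_hom by (auto simp: ring_hom_def)

lemma R_bimodule: "bimodule A (ring_bimod R i)"
  by (rule ring_bimod_bimodule[OF A.ring_axioms R.ring_axioms i_hom])

sublocale RI: tensor_bimodules A "ring_bimod R i" I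
  by (intro tensor_bimodules.intro R_bimodule I.bimodule_axioms)

sublocale RIR: tensor_bimodules A "tensor A (ring_bimod R i) I" "ring_bimod R i"
  by (intro tensor_bimodules.intro R_bimodule RI.bimodule_tensor)

sublocale IR: tensor_bimodules A I "ring_bimod R i"
  by (intro tensor_bimodules.intro R_bimodule I.bimodule_axioms)

abbreviation "\<nu>\<^sub>2 r v \<equiv> \<nu> (RI.pure r v)"

lemma RI_pure_closed [simp]: "\<lbrakk>r \<in> carrier R; v \<in> carrier I\<rbrakk> \<Longrightarrow> RI.pure r v \<in> carrier RI.T"
  using RI.pure_tensor_closed[of r v] by simp

lemma \<nu>_simps:
  "X \<in> carrier RI.T \<Longrightarrow> \<nu> X \<in> carrier A"
  "\<lbrakk>X \<in> carrier RI.T; Y \<in> carrier RI.T\<rbrakk> \<Longrightarrow> \<nu> (X \<oplus>\<^bsub>RI.T\<^esub> Y) = \<nu> X \<oplus>\<^bsub>A\<^esub> \<nu> Y"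
  "\<lbrakk>X \<in> carrier RI.T; a \<in> carrier A\<rbrakk> \<Longrightarrow> \<nu> (a \<triangleright>\<^bsub>RI.T\<^esub> X) = a \<otimes>\<^bsub>A\<^esub> \<nu> X"
  using \<nu> by (auto simp: bimod_hom_def rmod_hom_def)

lemma \<nu>\<^sub>2_simps:
  "\<lbrakk>r \<in> carrier R; v \<in> carrier I\<rbrakk> \<Longrightarrow> \<nu>\<^sub>2 r v \<in> carrier A"
  "\<lbrakk>r \<in> carrier R; s \<in> carrier R; v \<in> carrier I\<rbrakk> \<Longrightarrow> \<nu>\<^sub>2 (r \<oplus>\<^bsub>R\<^esub> s) v = \<nu>\<^sub>2 r v \<oplus>\<^bsub>A\<^esub> \<nu>\<^sub>2 s v"
  "\<lbrakk>r \<in> carrier R; v \<in> carrier I; a \<in> carrier A\<rbrakk> \<Longrightarrow> \<nu>\<^sub>2 (i a \<otimes>\<^bsub>R\<^esub> r) v = a \<otimes>\<^bsub>A\<^esub> \<nu>\<^sub>2 r v"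
  using RI.pure_tensor_add_left[of r s v] RI.pure_tensor_lsmult[of r v a]
  by (simp_all add: \<nu>_simps) (metis RI_pure_closed \<nu>_simps(3))

text \<open>By \<open>Casimir\<close> and \<open>counit\<close>, \<open>\<Sum> p_k \<otimes> u_k
  \<nu>(q_k r \<otimes> v) = \<Sum> r p_k \<otimes> u_k \<nu>(q_k \<otimes> v) = r \<otimes>
  v\<close>. Here \<open>\<Lambda>\<close> applies \<open>\<nu>(- \<otimes> v)\<close> to the last
  factor and \<open>\<mu>\<close> multiplies the first by \<open>r\<close>; both prescriptions are
  balanced over \<open>A\<close>.\<close>

lemma dual_basis:
  assumes r: "r \<in> carrier R" and v: "v \<in> carrier I"
  shows "(\<Oplus>\<^bsub>RI.T\<^esub>k\<in>{..<n}. RI.pure (p k) (u k \<triangleleft>\<^bsub>I\<^esub> \<nu>\<^sub>2 (q k \<otimes>\<^bsub>R\<^esub> r) v)) = RI.pure r v"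
proof -
  obtain \<Lambda> where \<Lambda>: "\<Lambda> \<in> carrier RIR.T \<rightarrow> carrier RI.T"
      "\<And>X Y. \<lbrakk>X \<in> carrier RIR.T; Y \<in> carrier RIR.T\<rbrakk> \<Longrightarrow> \<Lambda> (X \<oplus>\<^bsub>RIR.T\<^esub> Y) = \<Lambda> X \<oplus>\<^bsub>RI.T\<^esub> \<Lambda> Y"
      "\<And>X s. \<lbrakk>X \<in> carrier RI.T; s \<in> carrier R\<rbrakk> \<Longrightarrow> \<Lambda> (RIR.pure X s) = X \<triangleleft>\<^bsub>RI.T\<^esub> \<nu>\<^sub>2 s v"
  proof (rule RIR.tensor_lift[OF RI.abelian_group_tensor, of "\<lambda>X s. X \<triangleleft>\<^bsub>RI.T\<^esub> \<nu>\<^sub>2 s v"])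
    show "X \<triangleleft>\<^bsub>RI.T\<^esub> a \<triangleleft>\<^bsub>RI.T\<^esub> \<nu>\<^sub>2 s v = X \<triangleleft>\<^bsub>RI.T\<^esub> \<nu>\<^sub>2 (a \<triangleright>\<^bsub>ring_bimod R i\<^esub> s) v"
      if "X \<in> carrier RI.T" "a \<in> carrier A" "s \<in> carrier (ring_bimod R i)" for X a s
      using that v by (simp add: \<nu>\<^sub>2_simps RI.T.rsmult_assoc)
  qed (use v in \<open>auto simp: \<nu>\<^sub>2_simps RI.T.rsmult_add_left RI.T.rsmult_add_right\<close>)
  obtain \<mu> where \<mu>: "\<mu> \<in> carrier RI.T \<rightarrow> carrier RI.T"
      "\<And>X Y. \<lbrakk>X \<in> carrier RI.T; Y \<in> carrier RI.T\<rbrakk> \<Longrightarrow> \<mu> (X \<oplus>\<^bsub>RI.T\<^esub> Y) = \<mu> X \<oplus>\<^bsub>RI.T\<^esub> \<mu> Y"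
      "\<And>s w. \<lbrakk>s \<in> carrier R; w \<in> carrier I\<rbrakk> \<Longrightarrow> \<mu> (RI.pure s w) = RI.pure (r \<otimes>\<^bsub>R\<^esub> s) w"
  proof (rule RI.tensor_lift[OF RI.abelian_group_tensor, of "\<lambda>s w. RI.pure (r \<otimes>\<^bsub>R\<^esub> s) w"])
    show "RI.pure (r \<otimes>\<^bsub>R\<^esub> (s \<triangleleft>\<^bsub>ring_bimod R i\<^esub> a)) w = RI.pure (r \<otimes>\<^bsub>R\<^esub> s) (a \<triangleright>\<^bsub>I\<^esub> w)"
      if "s \<in> carrier (ring_bimod R i)" "a \<in> carrier A" "w \<in> carrier I" for s a w
      using that r RI.pure_tensor_balanced[of "r \<otimes>\<^bsub>R\<^esub> s" w a] by (simp add: R.m_assoc)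
    show "RI.pure (r \<otimes>\<^bsub>R\<^esub> (s \<oplus>\<^bsub>ring_bimod R i\<^esub> s')) w =
        RI.pure (r \<otimes>\<^bsub>R\<^esub> s) w \<oplus>\<^bsub>RI.T\<^esub> RI.pure (r \<otimes>\<^bsub>R\<^esub> s') w"
      if "s \<in> carrier (ring_bimod R i)" "s' \<in> carrier (ring_bimod R i)" "w \<in> carrier I" for s s' w
      using that r RI.pure_tensor_add_left[of "r \<otimes>\<^bsub>R\<^esub> s" "r \<otimes>\<^bsub>R\<^esub> s'" w] by (simp add: R.r_distr)
  qed (use r RI.pure_tensor_add_right in auto)
  have closed: "RI.pure s (u k \<triangleleft>\<^bsub>I\<^esub> \<nu>\<^sub>2 s' v) \<in> carrier RI.T" if "k < n" "s \<in> carrier R" "s' \<in> carrier R" for k s s'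
    using that v by (simp add: \<nu>\<^sub>2_simps)
  have RIR_closed: "RIR.pure (RI.pure s (u k)) s' \<in> carrier RIR.T" if "k < n" "s \<in> carrier R" "s' \<in> carrier R" for k s s'
    using RIR.pure_tensor_closed[of "RI.pure s (u k)" s'] that by simp
  have step: "\<Lambda> (RIR.pure (RI.pure s (u k)) s') = RI.pure s (u k \<triangleleft>\<^bsub>I\<^esub> \<nu>\<^sub>2 s' v)"
    if "k < n" "s \<in> carrier R" "s' \<in> carrier R" for k s s'
    using \<Lambda>(3)[of "RI.pure s (u k)" s'] RI.pure_tensor_rsmult[of s "u k" "\<nu>\<^sub>2 s' v"] that v
    by (simp add: \<nu>\<^sub>2_simps)
  have "(\<Oplus>\<^bsub>RI.T\<^esub>k\<in>{..<n}. RI.pure (p k) (u k \<triangleleft>\<^bsub>I\<^esub> \<nu>\<^sub>2 (q k \<otimes>\<^bsub>R\<^esub> r) v)) =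
      \<Lambda> (\<Oplus>\<^bsub>RIR.T\<^esub>k\<in>{..<n}. RIR.pure (RI.pure (p k) (u k)) (q k \<otimes>\<^bsub>R\<^esub> r))"
    by (rule finsum_image[OF RIR.abelian_group_tensor RI.abelian_group_tensor \<Lambda>(1,2), symmetric])
      (use r RIR_closed step in simp_all)
  also have "\<dots> = \<Lambda> (\<Oplus>\<^bsub>RIR.T\<^esub>k\<in>{..<n}. RIR.pure (RI.pure (r \<otimes>\<^bsub>R\<^esub> p k) (u k)) (q k))"
    using Casimir[OF r] by simp
  also have "\<dots> = (\<Oplus>\<^bsub>RI.T\<^esub>k\<in>{..<n}. RI.pure (r \<otimes>\<^bsub>R\<^esub> p k) (u k \<triangleleft>\<^bsub>I\<^esub> \<nu>\<^sub>2 (q k) v))"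
    by (rule finsum_image[OF RIR.abelian_group_tensor RI.abelian_group_tensor \<Lambda>(1,2)])
      (use r RIR_closed step in simp_all)
  also have "\<dots> = \<mu> (\<Oplus>\<^bsub>RI.T\<^esub>k\<in>{..<n}. RI.pure (p k) (u k \<triangleleft>\<^bsub>I\<^esub> \<nu>\<^sub>2 (q k) v))"
    by (rule finsum_image[OF RI.abelian_group_tensor RI.abelian_group_tensor \<mu>(1,2), symmetric])
      (use r v closed in \<open>simp_all add: \<mu>(3) \<nu>\<^sub>2_simps\<close>)
  also have "\<dots> = \<mu> (RI.pure \<one>\<^bsub>R\<^esub> v)" by (simp only: counit[OF v])
  also have "\<dots> = RI.pure r v" using \<mu>(3) r v by simp
  finally show ?thesis .
qed

text \<open>The form in which the dual basis is used: with values in \<open>R\<close> it yields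
  generators of \<open>R\<close>, with values in \<open>I\<close> it computes the maps that read off
  elements of \<open>A\<close>.\<close>

lemma dual_basis_image:
  fixes G :: "('g, 'w) ring_scheme"
  assumes G: "abelian_group G"
    and closed: "\<And>s w. \<lbrakk>s \<in> carrier R; w \<in> carrier I\<rbrakk> \<Longrightarrow> \<beta> s w \<in> carrier G"
    and add_left: "\<And>s s' w. \<lbrakk>s \<in> carrier R; s' \<in> carrier R; w \<in> carrier I\<rbrakk>
      \<Longrightarrow> \<beta> (s \<oplus>\<^bsub>R\<^esub> s') w = \<beta> s w \<oplus>\<^bsub>G\<^esub> \<beta> s' w"
    and add_right: "\<And>s w w'. \<lbrakk>s \<in> carrier R; w \<in> carrier I; w' \<in> carrier I\<rbrakk>
      \<Longrightarrow> \<beta> s (w \<oplus>\<^bsub>I\<^esub> w') = \<beta> s w \<oplus>\<^bsub>G\<^esub> \<beta> s w'"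
    and balanced: "\<And>s a w. \<lbrakk>s \<in> carrier R; a \<in> carrier A; w \<in> carrier I\<rbrakk>
      \<Longrightarrow> \<beta> (s \<otimes>\<^bsub>R\<^esub> i a) w = \<beta> s (a \<triangleright>\<^bsub>I\<^esub> w)"
    and r: "r \<in> carrier R" and v: "v \<in> carrier I"
  shows "(\<Oplus>\<^bsub>G\<^esub>k\<in>{..<n}. \<beta> (p k) (u k \<triangleleft>\<^bsub>I\<^esub> \<nu>\<^sub>2 (q k \<otimes>\<^bsub>R\<^esub> r) v)) = \<beta> r v"
proof -
  interpret G: abelian_group G by fact
  obtain h where h: "h \<in> carrier RI.T \<rightarrow> carrier G"
      "\<And>X Y. \<lbrakk>X \<in> carrier RI.T; Y \<in> carrier RI.T\<rbrakk> \<Longrightarrow> h (X \<oplus>\<^bsub>RI.T\<^esub> Y) = h X \<oplus>\<^bsub>G\<^esub> h Y"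
      "\<And>s w. \<lbrakk>s \<in> carrier R; w \<in> carrier I\<rbrakk> \<Longrightarrow> h (RI.pure s w) = \<beta> s w"
    by (rule RI.tensor_lift[OF G, of \<beta>]) (use closed add_left add_right balanced in auto)
  have c: "u k \<triangleleft>\<^bsub>I\<^esub> \<nu>\<^sub>2 (q k \<otimes>\<^bsub>R\<^esub> r) v \<in> carrier I" if "k < n" for k
    using that r v by (simp add: \<nu>\<^sub>2_simps)
  have "\<beta> r v = h (\<Oplus>\<^bsub>RI.T\<^esub>k\<in>{..<n}. RI.pure (p k) (u k \<triangleleft>\<^bsub>I\<^esub> \<nu>\<^sub>2 (q k \<otimes>\<^bsub>R\<^esub> r) v))"
    by (simp only: dual_basis[OF r v] h(3)[OF r v])
  also have "\<dots> = (\<Oplus>\<^bsub>G\<^esub>k\<in>{..<n}. \<beta> (p k) (u k \<triangleleft>\<^bsub>I\<^esub> \<nu>\<^sub>2 (q k \<otimes>\<^bsub>R\<^esub> r) v))"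
    by (rule finsum_image[OF RI.abelian_group_tensor G h(1,2)]) (use c in \<open>simp_all add: h(3)\<close>)
  finally show ?thesis by (rule sym)
qed

end

section \<open>Finite generation and chain conditions from a Morita context\<close>

locale Morita_Frobenius_system =
  Frobenius_system A R I i n p u q \<nu> + IJ: evaluation A I J f + JI: evaluation A J I g
  for A :: "('a, 'x) ring_scheme" and R :: "('r, 'y) ring_scheme"
    and I :: "('a, 'i, 'z) bimod_scheme" and J :: "('a, 'j, 'w) bimod_scheme"
    and i n p u q \<nu> f g +
  assumes assoc_f: "\<lbrakk>x \<in> carrier I; y \<in> carrier J; x' \<in> carrier I\<rbrakk> \<Longrightarrow> IJ.ev x y \<triangleright>\<^bsub>I\<^esub> x' = x \<triangleleft>\<^bsub>I\<^esub> JI.ev y x'"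
    and assoc_g: "\<lbrakk>y \<in> carrier J; x \<in> carrier I; y' \<in> carrier J\<rbrakk> \<Longrightarrow> JI.ev y x \<triangleright>\<^bsub>J\<^esub> y' = y \<triangleleft>\<^bsub>J\<^esub> IJ.ev x y'"
begin

lemma I_finitely_generated: "rmod_finitely_generated A I"
  by (rule IJ.left_finitely_generated[OF JI.ev_simps(1) assoc_f])

lemma J_finitely_generated: "rmod_finitely_generated A J"
  by (rule JI.left_finitely_generated[OF IJ.ev_simps(1) assoc_g])

text \<open>Applying \<open>s \<otimes> w \<mapsto> s i(f(w \<otimes> y))\<close> to the dual basis
  identity writes \<open>r i(f(v \<otimes> y))\<close> as a sum of elements
  \<open>p_k i(f(u_k \<otimes> y'))\<close>. Finitely many \<open>y'\<close> suffice because
  \<open>J\<close> is finitely generated. As \<open>\<one>\<close> is a sum of values of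
  \<open>f\<close>, \<open>r\<close> itself is reached.\<close>

lemma R_finitely_generated: "rmod_finitely_generated A (ring_bimod R i)"
proof -
  obtain S where S: "finite S" "S \<subseteq> carrier J" "\<And>L. \<lbrakk>rsubmodule A J L; S \<subseteq> L\<rbrakk> \<Longrightarrow> carrier J \<subseteq> L"
    using J_finitely_generated unfolding rmod_finitely_generated_def by blast
  let ?gen = "\<lambda>(k, y). p k \<otimes>\<^bsub>R\<^esub> i (IJ.ev (u k) y)"
  show ?thesis
  proof (rule RI.M.rmod_finitely_generatedI)
    show "finite (?gen ` ({..<n} \<times> S))" using S(1) by simp
    show "?gen ` ({..<n} \<times> S) \<subseteq> carrier (ring_bimod R i)" using S(2) by (auto simp: IJ.ev_simps)
    fix L assume L: "rsubmodule A (ring_bimod R i) L" and gen: "?gen ` ({..<n} \<times> S) \<subseteq> L"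
    note L0 = rsubmodule_zero[OF L] and Ladd = rsubmodule_add[OF L] and Lmult = rsubmodule_rsmult[OF L]
      and Lsub = rsubmodule_subset[OF L]
    have zero: "i \<zero>\<^bsub>A\<^esub> = \<zero>\<^bsub>R\<^esub>" using i_hom A.ring_axioms R.ring_axioms ring_hom_zero by metis
    have gen_all: "p k \<otimes>\<^bsub>R\<^esub> i (IJ.ev (u k) y) \<in> L" if k: "k < n" and y: "y \<in> carrier J" for k y
    proof -
      have hom: "(\<lambda>y. p k \<otimes>\<^bsub>R\<^esub> i (IJ.ev (u k) y)) \<in> rmod_hom A J (ring_bimod R i)"
        using k by (auto simp: rmod_hom_def IJ.ev_simps R.r_distr R.m_assoc)
      have "carrier J \<subseteq> {y \<in> carrier J. p k \<otimes>\<^bsub>R\<^esub> i (IJ.ev (u k) y) \<in> L}"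
        by (rule S(3)[OF rsubmodule_vimage[OF IJ.N.right_module_axioms RI.M.right_module_axioms hom L]])
          (use S(2) gen k in force)
      then show ?thesis using y by blast
    qed
    have ev: "r \<otimes>\<^bsub>R\<^esub> i (IJ.ev v y) \<in> L" if r: "r \<in> carrier R" and v: "v \<in> carrier I" and y: "y \<in> carrier J" for r v y
    proof -
      have c: "\<nu>\<^sub>2 (q k \<otimes>\<^bsub>R\<^esub> r) v \<in> carrier A" if "k < n" for k using that r v by (simp add: \<nu>\<^sub>2_simps)
      have eq: "(\<Oplus>\<^bsub>ring_bimod R i\<^esub>k\<in>{..<n}. p k \<otimes>\<^bsub>R\<^esub> i (IJ.ev (u k \<triangleleft>\<^bsub>I\<^esub> \<nu>\<^sub>2 (q k \<otimes>\<^bsub>R\<^esub> r) v) y)) =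
          r \<otimes>\<^bsub>R\<^esub> i (IJ.ev v y)"
        by (rule dual_basis_image[OF RI.M.abelian_group_axioms _ _ _ _ r v])
          (use y in \<open>auto simp: IJ.ev_simps R.l_distr R.r_distr R.m_assoc\<close>)
      \<comment> \<open>The bound is generalised to \<open>m \<le> n\<close> for the induction,
        because the summands are known to lie in \<open>L\<close> only below
        \<open>n\<close>.\<close>
      have "(\<Oplus>\<^bsub>ring_bimod R i\<^esub>k\<in>{..<m}. p k \<otimes>\<^bsub>R\<^esub> i (IJ.ev (u k \<triangleleft>\<^bsub>I\<^esub> \<nu>\<^sub>2 (q k \<otimes>\<^bsub>R\<^esub> r) v) y)) \<in> L"
        if "m \<le> n" for m
        using that
      proof (induction m)
        case 0 then show ?case using L0 by simp
      next
        case (Suc m)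
        have "p k \<otimes>\<^bsub>R\<^esub> i (IJ.ev (u k \<triangleleft>\<^bsub>I\<^esub> \<nu>\<^sub>2 (q k \<otimes>\<^bsub>R\<^esub> r) v) y) \<in> L" if "k < n" for k
          using that c[OF that] gen_all[OF that, of "\<nu>\<^sub>2 (q k \<otimes>\<^bsub>R\<^esub> r) v \<triangleright>\<^bsub>J\<^esub> y"] y by (simp add: IJ.ev_simps)
        then show ?case
          unfolding lessThan_Suc using Suc Ladd Lsub
          by (subst RI.M.M.finsum_insert) (auto dest: subsetD)
      qed
      from this[OF order_refl] show ?thesis unfolding eq .
    qed
    let ?S = "{X \<in> carrier IJ.T. \<forall>r\<in>carrier R. r \<otimes>\<^bsub>R\<^esub> i (f X) \<in> L}"
    have "rsubmodule A IJ.T ?S"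
    proof (rule IJ.T.rsubmoduleI)
      show "\<zero>\<^bsub>IJ.T\<^esub> \<in> ?S" using L0 by (simp add: IJ.f_zero zero)
      show "X \<oplus>\<^bsub>IJ.T\<^esub> Y \<in> ?S" if "X \<in> ?S" "Y \<in> ?S" for X Y
        using that Ladd by (auto simp: IJ.f_simps R.r_distr)
      show "X \<triangleleft>\<^bsub>IJ.T\<^esub> a \<in> ?S" if "X \<in> ?S" "a \<in> carrier A" for X a
        using that Lmult by (auto simp: IJ.f_simps R.m_assoc[symmetric])
    qed auto
    moreover have "IJ.pure x y \<in> ?S" if "x \<in> carrier I" "y \<in> carrier J" for x y
      using that ev IJ.pure_tensor_closed by blast
    ultimately obtain X where "X \<in> ?S" "f X = \<one>\<^bsub>A\<^esub>" by (rule IJ.values_generate)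
    then show "carrier (ring_bimod R i) \<subseteq> L" by auto
  qed
qed

end

text \<open>The map \<open>\<Theta> r v\<close> sends \<open>z w\<close> to
  \<open>w \<chi>(r) v\<close>, and right multiplication by \<open>b\<close> in
  \<open>I \<otimes> R\<close> replaces \<open>r\<close> by \<open>b r\<close>. On the submodule
  generated by \<open>z(W)\<close>, the maps \<open>\<Theta> (a' t) v\<close> therefore take values
  \<open>w v\<close> with one \<open>w\<close> in \<open>W\<close> for all \<open>v\<close>, because
  \<open>\<chi>(b a' t)\<close> is a trace, hence invariant. Faithfulness of \<open>I\<close> then
  identifies \<open>w\<close>.\<close>

lemma (in Morita_Frobenius_system) noetherian_over_invariants:
  assumes split: "split_grouplike_extension A R i \<chi> t" and noeth: "right_noetherian A"
  shows "noetherian_rmod (char_invariant_ring A R i \<chi>) (ring_bimod A (\<lambda>a. a))"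
proof -
  interpret S: split_grouplike_extension A R i \<chi> t by fact
  let ?Z = "IR.T" and ?M = "ring_bimod A (\<lambda>a. a)"
  have noethZ: "noetherian_rmod A ?Z"
    by (rule IR.T.noetherian_finitely_generated[OF noeth
        IR.tensor_finitely_generated[OF I_finitely_generated R_finitely_generated]])
  define z where "z w = (\<Oplus>\<^bsub>?Z\<^esub>k\<in>{..<n}. IR.pure ((w \<otimes>\<^bsub>A\<^esub> \<chi> (p k)) \<triangleright>\<^bsub>I\<^esub> u k) (q k))" for w
  have summand: "IR.pure ((w \<otimes>\<^bsub>A\<^esub> \<chi> (p k)) \<triangleright>\<^bsub>I\<^esub> u k) (q k) \<in> carrier ?Z" if "k < n" "w \<in> carrier A" for w k
    using that by (intro IR.pure_tensor_closed) simp_all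
  have z_closed: "z w \<in> carrier ?Z" if "w \<in> carrier A" for w
    unfolding z_def using summand that by (intro IR.T.M.finsum_closed) auto
  \<comment> \<open>Bundled into one predicate, so that a single choice yields the family
    \<open>\<Theta>\<close> with all its properties.\<close>
  define P where "P r v h \<longleftrightarrow> h \<in> carrier ?Z \<rightarrow> carrier I \<and>
    (\<forall>X\<in>carrier ?Z. \<forall>Y\<in>carrier ?Z. h (X \<oplus>\<^bsub>?Z\<^esub> Y) = h X \<oplus>\<^bsub>I\<^esub> h Y) \<and>
    (\<forall>x\<in>carrier I. \<forall>s\<in>carrier R. h (IR.pure x s) = x \<triangleleft>\<^bsub>I\<^esub> \<nu>\<^sub>2 (s \<otimes>\<^bsub>R\<^esub> r) v)" for r v h
  have "\<exists>h. P r v h" if r: "r \<in> carrier R" and v: "v \<in> carrier I" for r v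
  proof -
    obtain h where "h \<in> carrier ?Z \<rightarrow> carrier I"
      "\<And>X Y. \<lbrakk>X \<in> carrier ?Z; Y \<in> carrier ?Z\<rbrakk> \<Longrightarrow> h (X \<oplus>\<^bsub>?Z\<^esub> Y) = h X \<oplus>\<^bsub>I\<^esub> h Y"
      "\<And>x s. \<lbrakk>x \<in> carrier I; s \<in> carrier (ring_bimod R i)\<rbrakk> \<Longrightarrow> h (IR.pure x s) = x \<triangleleft>\<^bsub>I\<^esub> \<nu>\<^sub>2 (s \<otimes>\<^bsub>R\<^esub> r) v"
    proof (rule IR.tensor_lift[OF I.M.abelian_group_axioms, of "\<lambda>x s. x \<triangleleft>\<^bsub>I\<^esub> \<nu>\<^sub>2 (s \<otimes>\<^bsub>R\<^esub> r) v"])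
      show "x \<triangleleft>\<^bsub>I\<^esub> a \<triangleleft>\<^bsub>I\<^esub> \<nu>\<^sub>2 (s \<otimes>\<^bsub>R\<^esub> r) v = x \<triangleleft>\<^bsub>I\<^esub> \<nu>\<^sub>2 ((a \<triangleright>\<^bsub>ring_bimod R i\<^esub> s) \<otimes>\<^bsub>R\<^esub> r) v"
        if "x \<in> carrier I" "a \<in> carrier A" "s \<in> carrier (ring_bimod R i)" for x a s
        using that r v by (simp add: \<nu>\<^sub>2_simps I.rsmult_assoc R.m_assoc)
    qed (use r v in \<open>auto simp: \<nu>\<^sub>2_simps I.rsmult_add_left I.rsmult_add_right R.l_distr\<close>)
    then show ?thesis unfolding P_def by auto
  qed
  then obtain \<Theta> where "\<And>r v. \<lbrakk>r \<in> carrier R; v \<in> carrier I\<rbrakk> \<Longrightarrow> P r v (\<Theta> r v)" by metis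
  then have \<Theta>: "\<Theta> r v \<in> carrier ?Z \<rightarrow> carrier I"
      "\<And>X Y. \<lbrakk>X \<in> carrier ?Z; Y \<in> carrier ?Z\<rbrakk> \<Longrightarrow> \<Theta> r v (X \<oplus>\<^bsub>?Z\<^esub> Y) = \<Theta> r v X \<oplus>\<^bsub>I\<^esub> \<Theta> r v Y"
      "\<And>x s. \<lbrakk>x \<in> carrier I; s \<in> carrier R\<rbrakk> \<Longrightarrow> \<Theta> r v (IR.pure x s) = x \<triangleleft>\<^bsub>I\<^esub> \<nu>\<^sub>2 (s \<otimes>\<^bsub>R\<^esub> r) v"
    if "r \<in> carrier R" "v \<in> carrier I" for r v
    using that unfolding P_def by blast+
  have \<Theta>_closed: "\<Theta> r v X \<in> carrier I" if "r \<in> carrier R" "v \<in> carrier I" "X \<in> carrier ?Z" for r v X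
    using \<Theta>(1)[OF that(1,2)] that(3) by (rule funcset_mem)
  have \<Theta>_zero: "\<Theta> r v \<zero>\<^bsub>?Z\<^esub> = \<zero>\<^bsub>I\<^esub>" if "r \<in> carrier R" "v \<in> carrier I" for r v
  proof -
    have "\<Theta> r v \<zero>\<^bsub>?Z\<^esub> \<oplus>\<^bsub>I\<^esub> \<Theta> r v \<zero>\<^bsub>?Z\<^esub> = \<Theta> r v \<zero>\<^bsub>?Z\<^esub>"
      using \<Theta>(2)[OF that, of "\<zero>\<^bsub>?Z\<^esub>" "\<zero>\<^bsub>?Z\<^esub>"] by simp
    then show ?thesis using \<Theta>_closed[OF that, of "\<zero>\<^bsub>?Z\<^esub>"] I.M.add.r_cancel_one' by simp
  qed
  have \<Theta>_act: "\<Theta> r v (X \<triangleleft>\<^bsub>?Z\<^esub> a) = \<Theta> (i a \<otimes>\<^bsub>R\<^esub> r) v X"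
    if r: "r \<in> carrier R" and v: "v \<in> carrier I" and X: "X \<in> carrier ?Z" and a: "a \<in> carrier A" for r v X a
  proof -
    \<comment> \<open>\<open>r\<close> and \<open>a\<close> are quantified inside the set: for
      \<open>X \<triangleleft> b\<close>, the identity for \<open>X\<close> is used with
      \<open>b a\<close> and \<open>r\<close>, and again with \<open>b\<close> and
      \<open>i a r\<close>.\<close>
    let ?S = "{X \<in> carrier ?Z. \<forall>r\<in>carrier R. \<forall>a\<in>carrier A. \<Theta> r v (X \<triangleleft>\<^bsub>?Z\<^esub> a) = \<Theta> (i a \<otimes>\<^bsub>R\<^esub> r) v X}"
    have "rsubmodule A ?Z ?S"
    proof (rule IR.T.rsubmoduleI)
      show "\<zero>\<^bsub>?Z\<^esub> \<in> ?S" using v by (simp add: \<Theta>_zero)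
      show "X \<oplus>\<^bsub>?Z\<^esub> Y \<in> ?S" if "X \<in> ?S" "Y \<in> ?S" for X Y
        using that v by (simp add: \<Theta>(2) IR.T.rsmult_add_left)
      show "X \<triangleleft>\<^bsub>?Z\<^esub> b \<in> ?S" if "X \<in> ?S" "b \<in> carrier A" for X b
        using that v by (simp add: IR.T.rsmult_assoc R.m_assoc)
    qed auto
    moreover have "IR.pure x s \<in> ?S" if "x \<in> carrier I" "s \<in> carrier (ring_bimod R i)" for x s
    proof -
      have "\<Theta> r v (IR.pure x s \<triangleleft>\<^bsub>?Z\<^esub> a) = \<Theta> (i a \<otimes>\<^bsub>R\<^esub> r) v (IR.pure x s)"
        if "r \<in> carrier R" "a \<in> carrier A" for r a
        using IR.pure_tensor_rsmult[OF \<open>x \<in> carrier I\<close> \<open>s \<in> carrier (ring_bimod R i)\<close> that(2)] that v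
          \<open>x \<in> carrier I\<close> \<open>s \<in> carrier (ring_bimod R i)\<close>
        by (simp add: \<Theta>(3) R.m_assoc)
      then show ?thesis using IR.pure_tensor_closed[OF that] by blast
    qed
    ultimately have "carrier ?Z \<subseteq> ?S" by (rule IR.pure_tensors_generate)
    then show ?thesis using X r a by blast
  qed
  have \<Theta>_z: "\<Theta> r v (z w) = (w \<otimes>\<^bsub>A\<^esub> \<chi> r) \<triangleright>\<^bsub>I\<^esub> v"
    if r: "r \<in> carrier R" and v: "v \<in> carrier I" and w: "w \<in> carrier A" for r v w
  proof -
    define h where "h = \<Theta> r v"
    have h: "h \<in> carrier ?Z \<rightarrow> carrier I"
      "\<And>X Y. \<lbrakk>X \<in> carrier ?Z; Y \<in> carrier ?Z\<rbrakk> \<Longrightarrow> h (X \<oplus>\<^bsub>?Z\<^esub> Y) = h X \<oplus>\<^bsub>I\<^esub> h Y"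
      "\<And>x s. \<lbrakk>x \<in> carrier I; s \<in> carrier R\<rbrakk> \<Longrightarrow> h (IR.pure x s) = x \<triangleleft>\<^bsub>I\<^esub> \<nu>\<^sub>2 (s \<otimes>\<^bsub>R\<^esub> r) v"
      unfolding h_def using \<Theta>[OF r v] by blast+
    have "h (z w) = (\<Oplus>\<^bsub>I\<^esub>k\<in>{..<n}. (w \<otimes>\<^bsub>A\<^esub> \<chi> (p k)) \<triangleright>\<^bsub>I\<^esub> (u k \<triangleleft>\<^bsub>I\<^esub> \<nu>\<^sub>2 (q k \<otimes>\<^bsub>R\<^esub> r) v))"
      unfolding z_def
      by (rule finsum_image[OF IR.abelian_group_tensor I.M.abelian_group_axioms h(1,2)])
        (use summand r v w in \<open>simp_all add: h(3) \<nu>\<^sub>2_simps I.lsmult_rsmult\<close>)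
    \<comment> \<open>The dual basis identity for \<open>\<beta> s x = (w \<chi>(s)) x\<close>,
      which is balanced because \<open>\<chi>\<close> is right \<open>A\<close>-linear.\<close>
    also have "\<dots> = (w \<otimes>\<^bsub>A\<^esub> \<chi> r) \<triangleright>\<^bsub>I\<^esub> v"
      by (rule dual_basis_image[OF I.M.abelian_group_axioms _ _ _ _ r v])
        (use w in \<open>simp_all add: I.lsmult_add_left I.lsmult_add_right I.lsmult_assoc A.r_distr A.m_assoc\<close>)
    finally show ?thesis unfolding h_def .
  qed
  have sub: "W \<subseteq> carrier A" if "rsubmodule S.B ?M W" for W
    using rsubmodule_subset[OF that] by simp
  have zsub: "z ` W \<subseteq> carrier ?Z" if "rsubmodule S.B ?M W" for W
    using sub[OF that] z_closed by blast
  show ?thesis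
  proof (rule noetherian_transfer[OF noethZ, where \<phi> = "\<lambda>W. IR.T.span_of (z ` W)"])
    show "rsubmodule A ?Z (IR.T.span_of (z ` W))" if "rsubmodule S.B ?M W" for W
      by (rule IR.T.rsubmodule_span_of[OF zsub[OF that]])
    show "IR.T.span_of (z ` W) \<subseteq> IR.T.span_of (z ` W')" if "W \<subseteq> W'" for W W'
      by (rule IR.T.span_of_mono[OF image_mono[OF that]])
    show "W' \<subseteq> W" if W: "rsubmodule S.B ?M W" and W': "rsubmodule S.B ?M W'"
      and eq: "IR.T.span_of (z ` W) = IR.T.span_of (z ` W')" for W W'
    proof
      fix a assume a: "a \<in> W'"
      then have ac: "a \<in> carrier A" using sub[OF W'] by blast
      note W0 = rsubmodule_zero[OF W] and Wadd = rsubmodule_add[OF W] and Wmult = rsubmodule_rsmult[OF W]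
        and Wc = subsetD[OF sub[OF W]]
      \<comment> \<open>\<open>w\<close> may depend on \<open>a'\<close> and \<open>X\<close> but
        serves all \<open>v\<close>. Admitting every \<open>a'\<close> makes \<open>?S\<close>
        stable under the action, since acting by \<open>b\<close> replaces \<open>a'\<close> by
        \<open>b a'\<close>.\<close>
      define Q where "Q a' X w \<longleftrightarrow> w \<in> W \<and> (\<forall>v\<in>carrier I. \<Theta> (i a' \<otimes>\<^bsub>R\<^esub> t) v X = w \<triangleright>\<^bsub>I\<^esub> v)" for a' X w
      let ?S = "{X \<in> carrier ?Z. \<forall>a'\<in>carrier A. \<exists>w. Q a' X w}"
      have S: "rsubmodule A ?Z ?S"
      proof (rule IR.T.rsubmoduleI)
        have "Q a' \<zero>\<^bsub>?Z\<^esub> \<zero>\<^bsub>A\<^esub>" if "a' \<in> carrier A" for a'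
          using that W0 by (simp add: Q_def \<Theta>_zero)
        then show "\<zero>\<^bsub>?Z\<^esub> \<in> ?S" by blast
        have "Q a' (X \<oplus>\<^bsub>?Z\<^esub> Y) (w \<oplus>\<^bsub>A\<^esub> w')"
          if "a' \<in> carrier A" "X \<in> carrier ?Z" "Y \<in> carrier ?Z" "Q a' X w" "Q a' Y w'" for a' X Y w w'
          using that Wadd[of w w'] Wc by (simp add: Q_def \<Theta>(2) I.lsmult_add_left)
        then show "X \<oplus>\<^bsub>?Z\<^esub> Y \<in> ?S" if "X \<in> ?S" "Y \<in> ?S" for X Y
          using that IR.T.M.a_closed by blast
        have "Q a' (X \<triangleleft>\<^bsub>?Z\<^esub> b) w" if "a' \<in> carrier A" "X \<in> carrier ?Z" "b \<in> carrier A" "Q (b \<otimes>\<^bsub>A\<^esub> a') X w" for a' b X w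
          using that by (simp add: Q_def \<Theta>_act R.m_assoc)
        then show "X \<triangleleft>\<^bsub>?Z\<^esub> b \<in> ?S" if "X \<in> ?S" "b \<in> carrier A" for X b
          using that IR.T.rsmult_closed A.m_closed by blast
      qed auto
      have "Q a' (z w) (w \<otimes>\<^bsub>A\<^esub> S.trace a')" if "a' \<in> carrier A" "w \<in> W" for a' w
        using that Wmult[of w "S.trace a'"] Wc[of w] S.trace_invariant
        by (simp add: Q_def \<Theta>_z S.trace_def)
      then have "z ` W \<subseteq> ?S" using z_closed Wc by blast
      then have "IR.T.span_of (z ` W) \<subseteq> ?S" by (rule IR.T.span_of_least[OF S])
      moreover have "z a \<in> IR.T.span_of (z ` W)"
        unfolding eq using IR.T.span_of_superset[OF zsub[OF W']] a by blast
      \<comment> \<open>With \<open>a' = \<one>\<close> the map is \<open>\<Theta> t v\<close>,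
        which sends \<open>z a\<close> to \<open>a v\<close> because
        \<open>\<chi> t = \<one>\<close>.\<close>
      ultimately obtain w where "Q \<one>\<^bsub>A\<^esub> (z a) w" using A.one_closed by blast
      then have w: "w \<in> W" "\<And>v. v \<in> carrier I \<Longrightarrow> a \<triangleright>\<^bsub>I\<^esub> v = w \<triangleright>\<^bsub>I\<^esub> v"
        using ac by (simp_all add: Q_def \<Theta>_z)
      then have "a = w" using IJ.left_faithful ac Wc by blast
      then show "a \<in> W" using w(1) by simp
    qed
  qed
qed

section \<open>Equivalence of the three conditions\<close>

theorem theorem4p5:
  fixes A :: "'a ring" and R :: "'r ring" and i :: "'a \<Rightarrow> 'r" and \<chi> :: "'r \<Rightarrow> 'a"
  assumes "ring A" and "ring R" and "i \<in> ring_hom A R"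
    and "right_grouplike_character A R i \<chi>"
  shows
    "let B = char_invariant_ring A R i \<chi>;
         A\<^sub>R = char_rmod A R i \<chi>;
         C1 = (rmod_finitely_generated A (ring_bimod R i) \<and> right_FBN A);
         C2 = (right_FBN R \<and> right_noetherian A);
         C3 = (right_FBN B \<and> right_noetherian A)
     in (C1 \<longrightarrow> C2)
      \<and> (quasi_projective R A\<^sub>R \<longrightarrow> C2 \<longrightarrow> C3)
      \<and> (\<forall>(I :: ('a, 'i) bimod) (J :: ('a, 'j) bimod) f g.
           projective R A\<^sub>R \<and> strict_Morita_context A I J f g \<and> Frobenius_extension A R i I
           \<longrightarrow> (C3 \<longrightarrow> C1) \<and> (C1 \<longleftrightarrow> C2) \<and> (C2 \<longleftrightarrow> C3))"
proof -
  interpret G: grouplike_extension A R i \<chi>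
    by (intro grouplike_extension.intro grouplike_extension_axioms.intro assms)
  have 12: "right_FBN R" "right_noetherian A" if "rmod_finitely_generated A (ring_bimod R i)" "right_FBN A"
  proof -
    show noeth: "right_noetherian A" using that(2) by (simp add: right_FBN_def)
    show "right_FBN R"
      by (rule right_FBN_of_noetherian_extension[OF assms(1-3) that(2)
          G.RA.noetherian_finitely_generated[OF noeth that(1)]])
  qed
  have 23: "right_FBN G.B" if "quasi_projective R G.A\<^sub>R" "right_FBN R" "right_noetherian A"
    by (rule G.right_FBN_invariants[OF G.quasi_projective_contracting[OF that(1)] that(2,3)])
  \<comment> \<open>Finite generation of \<open>R\<close> comes from the Frobenius system, so (3)
    implies (1) comes down to passing FBN from the invariants to \<open>A\<close>. Contraction is
    supplied here by the trace.\<close>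
  have 3: "rmod_finitely_generated A (ring_bimod R i)"
      "\<lbrakk>right_FBN G.B; right_noetherian A\<rbrakk> \<Longrightarrow> right_FBN A"
      "\<lbrakk>right_FBN R; right_noetherian A\<rbrakk> \<Longrightarrow> right_FBN G.B"
    if proj: "projective R G.A\<^sub>R" and Morita: "strict_Morita_context A I J f g"
      and Frob: "Frobenius_extension A R i I"
    for I :: "('a, 'i) bimod" and J :: "('a, 'j) bimod" and f g
  proof -
    obtain t where "t \<in> carrier R" "\<chi> t = \<one>\<^bsub>A\<^esub>" "\<And>r. r \<in> carrier R \<Longrightarrow> t \<otimes>\<^bsub>R\<^esub> r = t \<otimes>\<^bsub>R\<^esub> i (\<chi> r)"
      using G.projective_section[OF proj] by blast
    then interpret S: split_grouplike_extension A R i \<chi> t by unfold_locales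
    obtain n :: nat and p u q \<nu> where
      "\<nu> \<in> bimod_hom A (tensor A (ring_bimod R i) I) (regular_bimod A)"
      "\<forall>k<n. p k \<in> carrier R \<and> u k \<in> carrier I \<and> q k \<in> carrier R"
      "\<forall>r\<in>carrier R.
        (\<Oplus>\<^bsub>tensor A (tensor A (ring_bimod R i) I) (ring_bimod R i)\<^esub>k\<in>{..<n}.
          pure_tensor A (tensor A (ring_bimod R i) I) (ring_bimod R i)
            (pure_tensor A (ring_bimod R i) I (r \<otimes>\<^bsub>R\<^esub> p k) (u k)) (q k)) =
        (\<Oplus>\<^bsub>tensor A (tensor A (ring_bimod R i) I) (ring_bimod R i)\<^esub>k\<in>{..<n}.
          pure_tensor A (tensor A (ring_bimod R i) I) (ring_bimod R i)
            (pure_tensor A (ring_bimod R i) I (p k) (u k)) (q k \<otimes>\<^bsub>R\<^esub> r))"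
      "\<forall>v\<in>carrier I.
        (\<Oplus>\<^bsub>tensor A (ring_bimod R i) I\<^esub>k\<in>{..<n}.
          pure_tensor A (ring_bimod R i) I (p k)
            (u k \<triangleleft>\<^bsub>I\<^esub> \<nu> (pure_tensor A (ring_bimod R i) I (q k) v))) =
        pure_tensor A (ring_bimod R i) I \<one>\<^bsub>R\<^esub> v"
      using Frob unfolding Frobenius_extension_def Let_def by (elim exE bexE conjE)
    then have "Frobenius_system A R I i n p u q \<nu>"
      using Morita
      by (intro Frobenius_system.intro Frobenius_system_axioms.intro assms)
        (simp_all add: strict_Morita_context_def)
    moreover have "evaluation A I J f" "evaluation A J I g"
      using Morita
      by (auto simp: strict_Morita_context_def evaluation_def evaluation_axioms_def
          tensor_bimodules_def bimod_iso_def bij_betw_def)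
    ultimately interpret F: Morita_Frobenius_system A R I J i n p u q \<nu> f g
      using Morita by (auto simp: Morita_Frobenius_system_def Morita_Frobenius_system_axioms_def
          strict_Morita_context_def)
    show "rmod_finitely_generated A (ring_bimod R i)" by (rule F.R_finitely_generated)
    \<comment> \<open>The extension result for the inclusion of the invariants in \<open>A\<close>,
      over which \<open>A\<close> is a noetherian right module.\<close>
    show "right_FBN A" if "right_FBN G.B" "right_noetherian A"
      by (rule right_FBN_of_noetherian_extension[OF G.B.ring_axioms assms(1) _ that(1)
          F.noetherian_over_invariants[OF S.split_grouplike_extension_axioms that(2)]])
        (auto simp: ring_hom_def)
    show "right_FBN G.B" if "right_FBN R" "right_noetherian A"
      by (rule G.right_FBN_invariants[OF S.contracting that])
  qed
  show ?thesis unfolding Let_def using 12 23 3 by blast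
qed

end
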